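(* Let $G$ be a second countable compact group and let $J\subseteq L^1(G)$ be a closed left ideal. Then $$(\operatorname{Ran} J)^\perp = \operatorname{Bim}(J^\perp).$$
   Context: Notation (for a second countable locally compact group $G$ with left Haar measure and modular function $\Delta$). $\lambda,\rho$ are the left and right regular representations on $L^2(G)$: $(\lambda_s f)(t)=f(s^{-1}t)$, $(\rho_r f)(s)=\Delta(r)^{1/2}f(sr)$. $\operatorname{VN}(G)$ is the weak-* closed linear span of $\{\lambda_x:x\in G\}$ in $\mathcal B(L^2(G))$. $M_a$ is multiplication by $a\in L^\infty(G)$ on $L^2(G)$. $\mathcal T(G)$ is the predual of $\mathcal B(L^2(G))$ (the trace class with trace norm $\|\cdot\|_t$), identified with functions $h(x,y)=\sum_i f_i(x)g_i(y)$, $\sum_i\|f_i\|_2^2<\infty$, $\sum_i\|g_i\|_2^2<\infty$, with pairing $\langle T,h\rangle_t=\sum_i (Tf_i,\overline{g_i})$. $M(G)$ is the convolution algebra of bounded complex Borel measures; $L^1(G)$ is identified with the absolutely continuous ones. For $\mu\in M(G)$, $\Theta(\mu):\mathcal B(L^2(G))\to\mathcal B(L^2(G))$ is the bounded weak-* continuous map $\langle\Theta(\mu)(T),h\rangle_t=\int_G\langle \rho_rT\rho_r^*,h\rangle_t\,d\mu(r)$, $h\in\mathcal T(G)$, and $\theta(\mu):\mathcal T(G)\to\mathcal T(G)$ is its predual. For a closed left ideal $J\subseteq L^1(G)$: $J^\perp=\{a\in L^\infty(G):\int_G af=0\ \forall f\in J\}$; $\operatorname{Ran}J$ is the $\|\cdot\|_t$-closed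 linear span of $\{\theta(f)(h): f\in J,\ h\in\mathcal T(G)\}$ in $\mathcal T(G)$; $(\operatorname{Ran}J)^\perp$ is its annihilator in $\mathcal B(L^2(G))$. For a subspace $\mathcal U\subseteq L^\infty(G)$, $\operatorname{Bim}(\mathcal U)$ is the weak-* closed linear span of $\{AM_aB: A,B\in\operatorname{VN}(G),\ a\in\mathcal U\}$ in $\mathcal B(L^2(G))$. *)

theory Defs
  imports "HOL-Analysis.Analysis" "HOL-Library.Function_Algebras"
begin

section \<open>Second countable locally compact groups with a left Haar measure\<close>

text \<open>The group operation is written additively (it need not be commutative), because
  \<^class>\<open>topological_group_add\<close> is the library's class of topological groups: the product
  $st$ is \<open>s + t\<close> and the inverse $s^{-1}$ is \<open>- s\<close>. The left Haar measure is part of the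
  structure; no normalisation is imposed.\<close>

class haar_group = topological_group_add + t2_space + second_countable_topology +
  fixes haar :: "'a measure"
  assumes locally_compact: "\<exists>U K. open U \<and> compact K \<and> x \<in> U \<and> U \<subseteq> K"
    and sets_haar: "sets haar = sets borel"
    and haar_left_invariant: "A \<in> sets borel \<Longrightarrow> emeasure haar ((\<lambda>x. s + x) ` A) = emeasure haar A"
    and haar_compact_finite: "compact K \<Longrightarrow> emeasure haar K < \<infinity>"
    and haar_open_pos: "open V \<Longrightarrow> V \<noteq> {} \<Longrightarrow> emeasure haar V > 0"

text \<open>The modular function: $\mu(Er) = \Delta(r)\mu(E)$.\<close>

definition modular_fun :: "'a::haar_group \<Rightarrow> real"
  where "modular_fun r = (THE c. c > 0 \<and>
    (\<forall>E\<in>sets borel. emeasure haar ((\<lambda>x. x + r) ` E) = ennreal c * emeasure haar E))"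

section \<open>The Hilbert space \<open>L\<^sup>2(G)\<close>\<close>

definition sq_integrable :: "('a::haar_group \<Rightarrow> complex) \<Rightarrow> bool"
  where "sq_integrable f \<longleftrightarrow>
    f \<in> borel_measurable haar \<and> integrable haar (\<lambda>x. (cmod (f x))\<^sup>2)"

definition L2_eq :: "('a::haar_group \<Rightarrow> complex) \<Rightarrow> ('a \<Rightarrow> complex) \<Rightarrow> bool"
  where "L2_eq f g \<longleftrightarrow> sq_integrable f \<and> sq_integrable g \<and> (AE x in haar. f x = g x)"

lemma sq_integrable_zero: "sq_integrable (\<lambda>x. 0)"
  by (simp add: sq_integrable_def)

lemma borel_measurable_cnj:
  "f \<in> borel_measurable M \<Longrightarrow> (\<lambda>x. cnj (f x)) \<in> borel_measurable M"
  by (rule measurable_compose[OF _ borel_measurable_continuous_onI])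
    (auto intro: continuous_intros)

lemma sq_integrable_scale:
  assumes "sq_integrable f" shows "sq_integrable (\<lambda>x. c * f x)"
  using assms
  by (auto simp: sq_integrable_def norm_mult power_mult_distrib intro: borel_measurable_times)

lemma sq_integrable_cnj:
  assumes "sq_integrable f" shows "sq_integrable (\<lambda>x. cnj (f x))"
  using assms by (simp add: sq_integrable_def borel_measurable_cnj)

lemma sq_integrable_add:
  assumes "sq_integrable f" "sq_integrable g" shows "sq_integrable (\<lambda>x. f x + g x)"
proof -
  have m: "f \<in> borel_measurable haar" "g \<in> borel_measurable haar"
    using assms by (auto simp: sq_integrable_def)
  have "integrable haar (\<lambda>x. 2 * (cmod (f x))\<^sup>2 + 2 * (cmod (g x))\<^sup>2)"
    using assms by (auto simp: sq_integrable_def)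
  then have "integrable haar (\<lambda>x. (cmod (f x + g x))\<^sup>2)"
  proof (rule Bochner_Integration.integrable_bound)
    show "(\<lambda>x. (cmod (f x + g x))\<^sup>2) \<in> borel_measurable haar" using m by simp
    have "(cmod (f x + g x))\<^sup>2 \<le> 2 * (cmod (f x))\<^sup>2 + 2 * (cmod (g x))\<^sup>2" for x
    proof -
      have "(cmod (f x + g x))\<^sup>2 \<le> (cmod (f x) + cmod (g x))\<^sup>2"
        by (intro power_mono norm_triangle_ineq) simp
      also have "\<dots> \<le> 2 * (cmod (f x))\<^sup>2 + 2 * (cmod (g x))\<^sup>2"
        using sum_squares_bound[of "cmod (f x)" "cmod (g x)"] by (simp add: power2_sum)
      finally show ?thesis .
    qed
    then show "AE x in haar. norm ((cmod (f x + g x))\<^sup>2)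
        \<le> norm (2 * (cmod (f x))\<^sup>2 + 2 * (cmod (g x))\<^sup>2)" by simp
  qed
  then show ?thesis using m by (simp add: sq_integrable_def)
qed

lemma sq_integrable_mult:
  assumes "sq_integrable f" "sq_integrable g" shows "integrable haar (\<lambda>x. f x * cnj (g x))"
proof -
  have m: "f \<in> borel_measurable haar" "g \<in> borel_measurable haar"
    using assms by (auto simp: sq_integrable_def)
  have "integrable haar (\<lambda>x. (cmod (f x))\<^sup>2 + (cmod (g x))\<^sup>2)"
    using assms by (auto simp: sq_integrable_def)
  then show ?thesis
  proof (rule Bochner_Integration.integrable_bound)
    show "(\<lambda>x. f x * cnj (g x)) \<in> borel_measurable haar"
      using m by (intro borel_measurable_times borel_measurable_cnj)
    have "cmod (f x) * cmod (g x) \<le> (cmod (f x))\<^sup>2 + (cmod (g x))\<^sup>2" for x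
    proof -
      have "0 \<le> cmod (f x) * cmod (g x)" by simp
      then show ?thesis
        using sum_squares_bound[of "cmod (f x)" "cmod (g x)"] by linarith
    qed
    then show "AE x in haar. norm (f x * cnj (g x)) \<le> norm ((cmod (f x))\<^sup>2 + (cmod (g x))\<^sup>2)"
      by (simp add: norm_mult)
  qed
qed

quotient_type (overloaded) 'a L2 = "'a::haar_group \<Rightarrow> complex" / partial: L2_eq
proof (rule part_equivpI)
  show "\<exists>x :: 'a \<Rightarrow> complex. L2_eq x x" by (rule exI[of _ "\<lambda>x. 0"]) (simp add: L2_eq_def sq_integrable_zero)
  show "symp (L2_eq :: ('a \<Rightarrow> complex) \<Rightarrow> _)" by (auto simp: symp_def L2_eq_def eq_commute)
  show "transp (L2_eq :: ('a \<Rightarrow> complex) \<Rightarrow> _)"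
  proof (rule transpI)
    fix f g h :: "'a \<Rightarrow> complex"
    assume *: "L2_eq f g" "L2_eq g h"
    then have "AE x in haar. f x = g x" "AE x in haar. g x = h x" by (auto simp: L2_eq_def)
    then have "AE x in haar. f x = h x" by eventually_elim simp
    then show "L2_eq f h" using * by (auto simp: L2_eq_def)
  qed
qed

instantiation L2 :: (haar_group) ab_group_add
begin

lift_definition zero_L2 :: "'a L2" is "\<lambda>x. 0"
  by (simp add: L2_eq_def sq_integrable_zero)

lift_definition plus_L2 :: "'a L2 \<Rightarrow> 'a L2 \<Rightarrow> 'a L2" is "\<lambda>f g x. f x + g x"
  by (auto simp: L2_eq_def intro!: sq_integrable_add elim: eventually_elim2)

lift_definition uminus_L2 :: "'a L2 \<Rightarrow> 'a L2" is "\<lambda>f x. - f x"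
  using sq_integrable_scale[of _ "-1"] by (auto simp: L2_eq_def)

definition minus_L2 :: "'a L2 \<Rightarrow> 'a L2 \<Rightarrow> 'a L2" where "minus_L2 f g = f + (- g)"

instance
proof
  fix a b c :: "'a L2"
  show "a + b + c = a + (b + c)" by transfer (auto simp: L2_eq_def add.assoc intro!: sq_integrable_add)
  show "a + b = b + a" by transfer (auto simp: L2_eq_def add.commute intro!: sq_integrable_add)
  show "0 + a = a" by transfer (auto simp: L2_eq_def)
  show "- a + a = 0" by transfer (auto simp: L2_eq_def sq_integrable_zero)
  show "a - b = a + - b" by (simp add: minus_L2_def)
qed

end

lift_definition cscale :: "complex \<Rightarrow> 'a::haar_group L2 \<Rightarrow> 'a L2" is "\<lambda>c f x. c * f x"
  by (auto simp: L2_eq_def intro: sq_integrable_scale)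

lift_definition cinner :: "'a::haar_group L2 \<Rightarrow> 'a L2 \<Rightarrow> complex"
  is "\<lambda>f g. \<integral>x. f x * cnj (g x) \<partial>haar"
proof -
  fix f f' g g' :: "'a \<Rightarrow> complex"
  assume *: "L2_eq f f'" "L2_eq g g'"
  then have "AE x in haar. f x = f' x" "AE x in haar. g x = g' x" by (auto simp: L2_eq_def)
  then have "AE x in haar. f x * cnj (g x) = f' x * cnj (g' x)" by eventually_elim simp
  then show "(\<integral>x. f x * cnj (g x) \<partial>haar) = (\<integral>x. f' x * cnj (g' x) \<partial>haar)"
    using * by (intro integral_cong_AE borel_measurable_times borel_measurable_cnj)
      (auto simp: L2_eq_def sq_integrable_def)
qed

lift_definition L2_cnj :: "'a::haar_group L2 \<Rightarrow> 'a L2" is "\<lambda>f x. cnj (f x)"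
  by (auto simp: L2_eq_def intro: sq_integrable_cnj)

lemma cinner_add_left: "cinner (f + g) h = cinner f h + cinner g h"
  by transfer (simp add: L2_eq_def distrib_right sq_integrable_mult)

lemma cinner_scale_left: "cinner (cscale c f) h = c * cinner f h"
  by transfer (simp add: mult.assoc)

lemma cinner_commute: "cinner g f = cnj (cinner f g)"
  by transfer (simp add: mult.commute flip: Bochner_Integration.integral_cnj)

lemma cscale_add_right: "cscale c (f + g) = cscale c f + cscale c g"
  by transfer (auto simp: L2_eq_def distrib_left intro!: sq_integrable_add sq_integrable_scale)

lemma cscale_add_left: "cscale (c + d) f = cscale c f + cscale d f"
  by transfer (auto simp: L2_eq_def distrib_right intro!: sq_integrable_add sq_integrable_scale
      dest: sq_integrable_scale)

lemma cscale_cscale: "cscale c (cscale d f) = cscale (c * d) f"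
  by transfer (auto simp: L2_eq_def mult.assoc intro!: sq_integrable_scale)

lemma cscale_one: "cscale 1 f = f"
  by transfer (auto simp: L2_eq_def)

lemma cinner_self_real: "cinner f f = complex_of_real (Re (cinner f f))"
  using cinner_commute[of f f] by (simp add: complex_eq_iff)

lemma cinner_self: "Re (cinner f f) \<ge> 0" "Re (cinner f f) = 0 \<longleftrightarrow> f = 0"
proof -
  have *: "(\<integral>x. f x * cnj (f x) \<partial>haar) = complex_of_real (\<integral>x. (cmod (f x))\<^sup>2 \<partial>haar)"
    for f :: "'a \<Rightarrow> complex"
    by (simp only: complex_norm_square[symmetric] integral_complex_of_real)
  show "Re (cinner f f) \<ge> 0" by transfer (simp add: *)
  show "Re (cinner f f) = 0 \<longleftrightarrow> f = 0"
  proof transfer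
    fix f :: "'a \<Rightarrow> complex" assume "L2_eq f f"
    then have f: "sq_integrable f" by (simp add: L2_eq_def)
    then have "(\<integral>x. (cmod (f x))\<^sup>2 \<partial>haar) = 0 \<longleftrightarrow> (AE x in haar. (cmod (f x))\<^sup>2 = 0)"
      by (intro integral_nonneg_eq_0_iff_AE) (auto simp: sq_integrable_def)
    then show "Re (\<integral>x. f x * cnj (f x) \<partial>haar) = 0 \<longleftrightarrow> L2_eq f (\<lambda>x. 0)"
      using f by (simp add: * L2_eq_def sq_integrable_zero)
  qed
qed

instantiation L2 :: (haar_group) real_inner
begin

definition scaleR_L2 :: "real \<Rightarrow> 'a L2 \<Rightarrow> 'a L2" where "scaleR_L2 r = cscale (complex_of_real r)"
definition inner_L2 :: "'a L2 \<Rightarrow> 'a L2 \<Rightarrow> real" where "inner_L2 f g = Re (cinner f g)"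
definition norm_L2 :: "'a L2 \<Rightarrow> real" where "norm_L2 f = sqrt (inner f f)"
definition sgn_L2 :: "'a L2 \<Rightarrow> 'a L2" where "sgn_L2 f = inverse (norm f) *\<^sub>R f"
definition dist_L2 :: "'a L2 \<Rightarrow> 'a L2 \<Rightarrow> real" where "dist_L2 f g = norm (f - g)"
definition uniformity_L2 :: "('a L2 \<times> 'a L2) filter"
  where "uniformity_L2 = (INF e\<in>{0 <..}. principal {(f, g). dist f g < e})"
definition open_L2 :: "'a L2 set \<Rightarrow> bool"
  where "open_L2 U \<longleftrightarrow> (\<forall>f\<in>U. eventually (\<lambda>(f', g). f' = f \<longrightarrow> g \<in> U) uniformity)"

instance
proof
  fix f g h :: "'a L2" and r s :: real
  show "r *\<^sub>R (f + g) = r *\<^sub>R f + r *\<^sub>R g"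
    by (simp add: scaleR_L2_def cscale_add_right)
  show "(r + s) *\<^sub>R f = r *\<^sub>R f + s *\<^sub>R f"
    by (simp add: scaleR_L2_def cscale_add_left)
  show "r *\<^sub>R s *\<^sub>R f = (r * s) *\<^sub>R f"
    by (simp add: scaleR_L2_def cscale_cscale)
  show "1 *\<^sub>R f = f"
    by (simp add: scaleR_L2_def cscale_one)
  show "inner f g = inner g f"
    unfolding inner_L2_def by (subst cinner_commute) simp
  show "inner (f + g) h = inner f h + inner g h"
    by (simp add: inner_L2_def cinner_add_left)
  show "inner (r *\<^sub>R f) g = r * inner f g"
    by (simp add: inner_L2_def scaleR_L2_def cinner_scale_left)
  show "0 \<le> inner f f" "inner f f = 0 \<longleftrightarrow> f = 0"
    by (simp_all add: inner_L2_def cinner_self)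
  show "norm f = sqrt (inner f f)" by (rule norm_L2_def)
  show "sgn f = inverse (norm f) *\<^sub>R f" by (rule sgn_L2_def)
  show "dist f g = norm (f - g)" by (rule dist_L2_def)
  show "(uniformity :: ('a L2 \<times> 'a L2) filter) = (INF e\<in>{0 <..}. principal {(f, g). dist f g < e})"
    by (rule uniformity_L2_def)
  show "open U \<longleftrightarrow> (\<forall>f\<in>U. eventually (\<lambda>(f', g). f' = f \<longrightarrow> g \<in> U) uniformity)"
    for U :: "'a L2 set" by (rule open_L2_def)
qed

end

section \<open>Bounded operators on \<open>L\<^sup>2(G)\<close>\<close>

type_synonym 'a oper = "'a L2 \<Rightarrow>\<^sub>L 'a L2"

text \<open>The library's type of bounded operators is that of the real-linear ones; $\mathcal B(L^2(G))$
  consists of those which are complex-linear.\<close>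

definition BL2 :: "'a::haar_group oper set"
  where "BL2 = {T. \<forall>c f. blinfun_apply T (cscale c f) = cscale c (blinfun_apply T f)}"

lemma norm_cscale: "norm (cscale c f) = cmod c * norm f"
proof -
  have "cinner (cscale c f) (cscale c f) = (c * cnj c) * cinner f f"
    using cinner_commute[of f "cscale c f"] cinner_commute[of f f] by (simp add: cinner_scale_left)
  then have "cinner (cscale c f) (cscale c f) = complex_of_real ((cmod c)\<^sup>2 * Re (cinner f f))"
    using cinner_self_real[of f] by (metis complex_norm_square of_real_mult)
  then show ?thesis by (simp add: norm_L2_def inner_L2_def real_sqrt_mult)
qed

lemma bounded_linear_cscale: "bounded_linear (cscale c :: 'a::haar_group L2 \<Rightarrow> 'a L2)"
  by (rule bounded_linear_intro[where K = "cmod c"])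
    (simp_all add: cscale_add_right scaleR_L2_def cscale_cscale norm_cscale mult.commute)

definition oscale :: "complex \<Rightarrow> 'a::haar_group oper \<Rightarrow> 'a oper"
  where "oscale c T = Blinfun (cscale c) o\<^sub>L T"

lemma oscale_apply: "blinfun_apply (oscale c T) f = cscale c (blinfun_apply T f)"
  by (simp add: oscale_def bounded_linear_Blinfun_apply[OF bounded_linear_cscale])

global_interpretation oper: vector_space "oscale :: complex \<Rightarrow> 'a::haar_group oper \<Rightarrow> 'a oper"
  by standard
    (auto intro!: blinfun_eqI simp: oscale_apply blinfun.add_left cscale_add_right cscale_add_left
      cscale_cscale cscale_one)

global_interpretation cfun: vector_space "\<lambda>(c::complex) (f::'b \<Rightarrow> complex) x. c * f x"
  by standard (simp_all add: fun_eq_iff algebra_simps)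

definition adj :: "'a::haar_group oper \<Rightarrow> 'a oper"
  where "adj T = (THE S. \<forall>f g. cinner (blinfun_apply T f) g = cinner f (blinfun_apply S g))"

definition left_reg :: "'a::haar_group \<Rightarrow> 'a oper"
  where "left_reg s = Blinfun (\<lambda>f. abs_L2 (\<lambda>t. rep_L2 f (- s + t)))"

definition right_reg :: "'a::haar_group \<Rightarrow> 'a oper"
  where "right_reg r =
    Blinfun (\<lambda>f. abs_L2 (\<lambda>s. complex_of_real (sqrt (modular_fun r)) * rep_L2 f (s + r)))"

text \<open>Elements of $L^1(G)$ and $L^\infty(G)$ are represented by functions. The sets of functions
  below are closed under equality almost everywhere, and so stand for sets of classes.\<close>

definition L1 :: "('a::haar_group \<Rightarrow> complex) set"
  where "L1 = {f. integrable haar f}"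

definition Linf :: "('a::haar_group \<Rightarrow> complex) set"
  where "Linf = {a \<in> borel_measurable haar. \<exists>C. AE x in haar. cmod (a x) \<le> C}"

definition mult_op :: "('a::haar_group \<Rightarrow> complex) \<Rightarrow> 'a oper"
  where "mult_op a = Blinfun (\<lambda>f. abs_L2 (\<lambda>x. a x * rep_L2 f x))"

section \<open>The predual \<open>\<T>(G)\<close>\<close>

text \<open>The elements of $\mathcal T(G)$ are represented by functions on $G \times G$, two functions
  which agree almost everywhere being identified.\<close>

definition represents ::
    "(nat \<Rightarrow> 'a::haar_group L2) \<Rightarrow> (nat \<Rightarrow> 'a L2) \<Rightarrow> ('a \<times> 'a \<Rightarrow> complex) \<Rightarrow> bool"
  where "represents f g h \<longleftrightarrow>
    summable (\<lambda>i. (norm (f i))\<^sup>2) \<and> summable (\<lambda>i. (norm (g i))\<^sup>2) \<and>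
    (AE (x, y) in haar \<Otimes>\<^sub>M haar. (\<lambda>i. rep_L2 (f i) x * rep_L2 (g i) y) sums h (x, y))"

definition TG :: "('a::haar_group \<times> 'a \<Rightarrow> complex) set"
  where "TG = {h. \<exists>f g. represents f g h}"

text \<open>The trace norm, as the norm of the projective tensor product
  $L^2(G) \hat\otimes L^2(G)$.\<close>

definition tnorm :: "('a::haar_group \<times> 'a \<Rightarrow> complex) \<Rightarrow> real"
  where "tnorm h = Inf {(\<Sum>i. norm (f i) * norm (g i)) | f g. represents f g h}"

definition tpair :: "'a::haar_group oper \<Rightarrow> ('a \<times> 'a \<Rightarrow> complex) \<Rightarrow> complex"
  where "tpair T h = (THE c. \<exists>f g. represents f g h \<and>
    c = (\<Sum>i. cinner (blinfun_apply T (f i)) (L2_cnj (g i))))"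

definition weak_star :: "'a::haar_group oper topology"
  where "weak_star = pullback_topology BL2 (\<lambda>T. restrict (tpair T) TG)
    (product_topology (\<lambda>_. euclidean) TG)"

definition VN :: "'a::haar_group oper set"
  where "VN = weak_star closure_of (oper.span (range left_reg))"

definition Bim :: "('a::haar_group \<Rightarrow> complex) set \<Rightarrow> 'a oper set"
  where "Bim U = weak_star closure_of
    (oper.span {A o\<^sub>L mult_op a o\<^sub>L B | A a B. A \<in> VN \<and> B \<in> VN \<and> a \<in> U})"

section \<open>The maps \<open>\<Theta>\<close> and \<open>\<theta>\<close>\<close>

text \<open>\<open>Theta f\<close> and \<open>theta f\<close> are $\Theta(\mu)$ and $\theta(\mu)$ for the absolutely continuous
  measure $d\mu = f\,dr$, $f \in L^1(G)$. The value of \<open>theta f h\<close> is determined up to equality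
  almost everywhere.\<close>

definition Theta :: "('a::haar_group \<Rightarrow> complex) \<Rightarrow> 'a oper \<Rightarrow> 'a oper"
  where "Theta f T = (THE S. S \<in> BL2 \<and> (\<forall>h\<in>TG.
    tpair S h = (\<integral>r. f r * tpair (right_reg r o\<^sub>L T o\<^sub>L adj (right_reg r)) h \<partial>haar)))"

definition theta ::
    "('a::haar_group \<Rightarrow> complex) \<Rightarrow> ('a \<times> 'a \<Rightarrow> complex) \<Rightarrow> ('a \<times> 'a \<Rightarrow> complex)"
  where "theta f h = (SOME k. k \<in> TG \<and> (\<forall>T\<in>BL2. tpair T k = tpair (Theta f T) h))"

section \<open>Ideals and annihilators\<close>

definition norm_closure :: "('b::minus \<Rightarrow> real) \<Rightarrow> 'b set \<Rightarrow> 'b set \<Rightarrow> 'b set"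
  where "norm_closure N X S = {x \<in> X. \<forall>\<epsilon>>0. \<exists>y\<in>S. N (x - y) < \<epsilon>}"

definition L1_norm :: "('a::haar_group \<Rightarrow> complex) \<Rightarrow> real"
  where "L1_norm f = (\<integral>x. cmod (f x) \<partial>haar)"

definition convol ::
    "('a::haar_group \<Rightarrow> complex) \<Rightarrow> ('a \<Rightarrow> complex) \<Rightarrow> ('a \<Rightarrow> complex)"
  where "convol f g t = (\<integral>s. f s * g (- s + t) \<partial>haar)"

definition closed_left_ideal :: "('a::haar_group \<Rightarrow> complex) set \<Rightarrow> bool"
  where "closed_left_ideal J \<longleftrightarrow> J \<subseteq> L1 \<and> cfun.subspace J \<and>
    (\<forall>f\<in>L1. \<forall>g\<in>J. convol f g \<in> J) \<and> norm_closure L1_norm L1 J \<subseteq> J"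

definition L1_perp :: "('a::haar_group \<Rightarrow> complex) set \<Rightarrow> ('a \<Rightarrow> complex) set"
  where "L1_perp J = {a \<in> Linf. \<forall>f\<in>J. (\<integral>x. a x * f x \<partial>haar) = 0}"

definition Ran :: "('a::haar_group \<Rightarrow> complex) set \<Rightarrow> ('a \<times> 'a \<Rightarrow> complex) set"
  where "Ran J = norm_closure tnorm TG (cfun.span {theta f h | f h. f \<in> J \<and> h \<in> TG})"

definition TG_perp :: "('a::haar_group \<times> 'a \<Rightarrow> complex) set \<Rightarrow> 'a oper set"
  where "TG_perp R = {T \<in> BL2. \<forall>h\<in>R. tpair T h = 0}"

end

theory Submission
  imports Defs
begin

text \<open>Write $\rho_r$ for right and $\lambda_t$ for left translation. An operator $T$ annihilates
  $\mathrm{Ran}\,J$ iff all its coefficients $r \mapsto (\rho_r T \rho_r^* u, v)$ lie in $J^\perp$.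

  Let $T$ be such an operator and let $A_V$ be left convolution with the normalised indicator function
  of a neighbourhood $V$ of the identity. It commutes with every $\rho_r$, and since the group is compact,
  $A_V T A_V$ has a bounded continuous kernel $K(x, y) = (T b_y, a_x)$, where $b_y$ and $a_x$ are
  right translates of fixed vectors. Hence the restriction $a_t(x) = K(x, t^{-1}x)$ of $K$ to a translate of
  the diagonal is a coefficient of $T$, so that $a_t \in J^\perp$, and
  $A_V T A_V = \int M_{a_t} \lambda_t\,dt$ belongs to $\mathrm{Bim}(J^\perp)$. Letting $V$
  shrink gives $T \in \mathrm{Bim}(J^\perp)$.

  Conversely, elements of $\mathrm{VN}(G)$ commute with right translations, so
  $\Theta(f)(A M_a B) = A\,\Theta(f)(M_a)\,B$, and $\Theta(f)(M_a)$ is multiplication by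
  $s \mapsto \int f(r) a(sr)\,dr$, which vanishes for $f \in J$ and $a \in J^\perp$ because $J$ is a
  left ideal.

  The same kernel of $A_V T$ shows that the pairing of $T$ with a function in $\mathcal T(G)$ does not
  depend on the series chosen to represent it.\<close>

section \<open>The Hilbert space\<close>

text \<open>The constants \<open>tpair\<close>, \<open>Theta\<close>, \<open>theta\<close>,
  \<open>modular_fun\<close> and \<open>adj\<close> are given by description or choice, so much of
  the work is existence and uniqueness. The delicate case is \<open>tpair\<close>, as a function in
  T(G) has many representing series. For almost every y each of them converges in L2 to the section
  h(., y), and the pairing with \<open>avg V\<close> composed with T is an integral over these
  sections alone; strong convergence of \<open>avg V\<close> to the identity then settles T.
  Vector-valued integrals are weak integrals, obtained by cutting a continuous function into
  countably many constant pieces. The same cutting yields \<open>theta f h\<close> as an explicit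
  series; its constant 3 is the sum of a dyadic approximation. Weak-* closures of spans are handled
  by one criterion: an operator lies in the closure iff it is annihilated by every h in T(G) that
  annihilates the span. As basic open sets involve finitely many h only, this is finite-dimensional
  linear algebra. Compactness makes continuous functions bounded and the measure finite, hence the
  group unimodular and L2 a part of L1.\<close>

notation blinfun_apply (infixr "\<cdot>" 75)

lemma sq_integrable_rep: "sq_integrable (rep_L2 f)"
  using Quotient_rep_reflp[OF Quotient_L2, of f] by (simp add: L2_eq_def)

lemma abs_rep_L2: "abs_L2 (rep_L2 f) = f"
  by (rule Quotient_abs_rep[OF Quotient_L2])

lemma rep_abs_L2: "sq_integrable g \<Longrightarrow> AE x in haar. rep_L2 (abs_L2 g) x = g x"
  using Quotient_rep_abs[OF Quotient_L2, of g] by (simp add: L2_eq_def)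

lemma abs_L2_eqI: "sq_integrable f \<Longrightarrow> sq_integrable g \<Longrightarrow> AE x in haar. f x = g x \<Longrightarrow> abs_L2 f = abs_L2 g"
  using Quotient_rel_abs[OF Quotient_L2, of f g] by (simp add: L2_eq_def)

lemma L2_eqI: "AE x in haar. rep_L2 f x = rep_L2 g x \<Longrightarrow> f = g"
  using abs_L2_eqI[of "rep_L2 f" "rep_L2 g"] by (simp add: sq_integrable_rep abs_rep_L2)

lemma rep_L2_measurable [measurable]: "rep_L2 f \<in> borel_measurable haar"
  using sq_integrable_rep[of f] by (simp add: sq_integrable_def)

lemma cinner_abs:
  assumes "sq_integrable f" "sq_integrable g"
  shows "cinner (abs_L2 f) (abs_L2 g) = (\<integral>x. f x * cnj (g x) \<partial>haar)"
  using assms by (simp add: cinner.abs_eq L2_eq_def)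

lemma cinner_rep: "cinner f g = (\<integral>x. rep_L2 f x * cnj (rep_L2 g x) \<partial>haar)"
  using cinner_abs[OF sq_integrable_rep[of f] sq_integrable_rep[of g]] by (simp add: abs_rep_L2)

lemma rep_plus: "AE x in haar. rep_L2 (f + g) x = rep_L2 f x + rep_L2 g x"
proof -
  have "f + g = abs_L2 (\<lambda>x. rep_L2 f x + rep_L2 g x)"
    using plus_L2.abs_eq[of "rep_L2 f" "rep_L2 g"] by (simp add: abs_rep_L2 L2_eq_def sq_integrable_rep)
  then show ?thesis
    by (simp add: rep_abs_L2 sq_integrable_add sq_integrable_rep)
qed

lemma rep_uminus: "AE x in haar. rep_L2 (- f) x = - rep_L2 f x"
proof -
  have "- f = abs_L2 (\<lambda>x. - rep_L2 f x)"
    using uminus_L2.abs_eq[of "rep_L2 f"] by (simp add: abs_rep_L2 L2_eq_def sq_integrable_rep)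
  then show ?thesis
    using rep_abs_L2[OF sq_integrable_scale[OF sq_integrable_rep[of f], of "-1"]] by simp
qed

lemma rep_cscale: "AE x in haar. rep_L2 (cscale c f) x = c * rep_L2 f x"
proof -
  have "cscale c f = abs_L2 (\<lambda>x. c * rep_L2 f x)"
    using cscale.abs_eq[of "rep_L2 f" c] by (simp add: abs_rep_L2 L2_eq_def sq_integrable_rep)
  then show ?thesis
    using rep_abs_L2[OF sq_integrable_scale[OF sq_integrable_rep[of f], of c]] by simp
qed

lemma rep_cnj: "AE x in haar. rep_L2 (L2_cnj f) x = cnj (rep_L2 f x)"
proof -
  have "L2_cnj f = abs_L2 (\<lambda>x. cnj (rep_L2 f x))"
    using L2_cnj.abs_eq[of "rep_L2 f"] by (simp add: abs_rep_L2 L2_eq_def sq_integrable_rep)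
  then show ?thesis
    using rep_abs_L2[OF sq_integrable_cnj[OF sq_integrable_rep[of f]]] by simp
qed

lemma rep_zero: "AE x in haar. rep_L2 0 x = 0"
  using rep_abs_L2[OF sq_integrable_zero] by (simp add: zero_L2_def)

lemma rep_minus: "AE x in haar. rep_L2 (f - g) x = rep_L2 f x - rep_L2 g x"
  using rep_plus[of f "- g"] rep_uminus[of g] by eventually_elim simp

lemma norm_sq_L2: "(norm f)\<^sup>2 = (\<integral>x. (cmod (rep_L2 f x))\<^sup>2 \<partial>haar)"
proof -
  have "(norm f)\<^sup>2 = Re (cinner f f)"
    by (simp add: norm_L2_def inner_L2_def cinner_self)
  also have "cinner f f = complex_of_real (\<integral>x. (cmod (rep_L2 f x))\<^sup>2 \<partial>haar)"
    by (simp only: cinner_rep complex_norm_square[symmetric] integral_complex_of_real)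
  finally show ?thesis by simp
qed

lemma norm_sq_abs_L2: "sq_integrable f \<Longrightarrow> (norm (abs_L2 f))\<^sup>2 = (\<integral>x. (cmod (f x))\<^sup>2 \<partial>haar)"
  unfolding norm_sq_L2
  by (intro integral_cong_AE) (use rep_abs_L2[of f] in \<open>auto simp: sq_integrable_def elim: eventually_mono\<close>)

lemma nn_norm_sq_L2: "ennreal ((norm f)\<^sup>2) = (\<integral>\<^sup>+x. ennreal ((cmod (rep_L2 f x))\<^sup>2) \<partial>haar)"
  unfolding norm_sq_L2
  by (rule nn_integral_eq_integral[symmetric]) (use sq_integrable_rep[of f] in \<open>auto simp: sq_integrable_def\<close>)

lemma cinner_self_norm: "cinner f f = complex_of_real ((norm f)\<^sup>2)"
  by (subst cinner_self_real) (simp add: norm_L2_def inner_L2_def cinner_self)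

lemma cinner_add_right: "cinner h (f + g) = cinner h f + cinner h g"
  by (metis cinner_add_left cinner_commute complex_cnj_add)

lemma cinner_scale_right: "cinner h (cscale c f) = cnj c * cinner h f"
  by (metis cinner_scale_left cinner_commute complex_cnj_mult)

lemma scaleR_cscale: "r *\<^sub>R f = cscale (complex_of_real r) f" for f :: "'a::haar_group L2"
  by (simp add: scaleR_L2_def)

lemma Re_cinner_le: "Re (cinner f g) \<le> norm f * norm g"
  using Cauchy_Schwarz_ineq2[of f g] by (simp add: inner_L2_def)

lemma cmod_cinner_le: "cmod (cinner f g) \<le> norm f * norm g"
proof (cases "cinner f g = 0")
  case False
  \<comment> \<open>Rotating \<open>f\<close> by this unimodular scalar makes the inner product real
    and nonnegative, so the bound for real parts applies.\<close>
  let ?c = "cnj (cinner f g) / cmod (cinner f g)"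
  have "cinner (cscale ?c f) g = cmod (cinner f g)"
    using False by (simp add: cinner_scale_left mult.commute complex_norm_square[symmetric] power2_eq_square)
  then have "cmod (cinner f g) \<le> norm (cscale ?c f) * norm g"
    using Re_cinner_le[of "cscale ?c f" g] by simp
  then show ?thesis using False by (simp add: norm_cscale norm_divide)
qed simp

lemma bounded_linear_cinner_left: "bounded_linear (\<lambda>f. cinner f g)"
  by (rule bounded_linear_intro[where K = "norm g"])
    (auto simp: cinner_add_left scaleR_cscale cinner_scale_left scaleR_conv_of_real cmod_cinner_le)

lemma bounded_linear_cinner_right: "bounded_linear (\<lambda>g. cinner f g)"
  by (rule bounded_linear_intro[where K = "norm f"])
    (auto simp: cinner_add_right scaleR_cscale cinner_scale_right scaleR_conv_of_real cmod_cinner_le mult.commute[of "norm _" "norm f"])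

lemma bounded_bilinear_cinner: "bounded_bilinear (cinner :: 'a::haar_group L2 \<Rightarrow> _)"
  by (rule bounded_bilinear.intro)
    (auto simp: cinner_add_left cinner_add_right scaleR_cscale cinner_scale_left cinner_scale_right scaleR_conv_of_real
      intro!: exI[of _ 1] cmod_cinner_le)

lemma cinner_zero [simp]: "cinner 0 g = 0" "cinner f 0 = 0"
  using bounded_linear.linear[OF bounded_linear_cinner_left, of g, THEN linear_0]
    bounded_linear.linear[OF bounded_linear_cinner_right, of f, THEN linear_0] by auto

lemma cinner_diff_left: "cinner (f - g) h = cinner f h - cinner g h"
  by (rule bounded_linear.linear[OF bounded_linear_cinner_left, THEN linear_diff])

lemma cinner_eqI: "(\<And>h. cinner f h = cinner g h) \<Longrightarrow> f = g"
proof -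
  assume "\<And>h. cinner f h = cinner g h"
  then have "cinner (f - g) (f - g) = 0" by (simp add: cinner_diff_left)
  then show "f = g" by (simp add: cinner_self_norm)
qed

text \<open>Both sides are the bilinear integral of f g. This symmetry lets the two factors of a
  tensor exchange their roles in the pairing.\<close>

lemma cinner_cnj: "cinner f (L2_cnj g) = cinner g (L2_cnj f)"
proof -
  have "(\<integral>x. rep_L2 f x * cnj (rep_L2 (L2_cnj g) x) \<partial>haar) = (\<integral>x. rep_L2 g x * cnj (rep_L2 (L2_cnj f) x) \<partial>haar)"

    by (intro integral_cong_AE borel_measurable_times borel_measurable_cnj rep_L2_measurable) (use rep_cnj[of f] rep_cnj[of g] in \<open>eventually_elim, simp\<close>)
  then show ?thesis by (simp add: cinner_rep)
qed

lemma cinner_L2_cnj_rep: "cinner f (L2_cnj g) = (\<integral>x. rep_L2 f x * rep_L2 g x \<partial>haar)"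
  unfolding cinner_rep
  by (intro integral_cong_AE borel_measurable_times borel_measurable_cnj rep_L2_measurable) (use rep_cnj[of g] in \<open>eventually_elim, simp\<close>)

lemma L2_cnj_cnj [simp]: "L2_cnj (L2_cnj f) = f"
  by (rule L2_eqI) (use rep_cnj[of f] rep_cnj[of "L2_cnj f"] in \<open>eventually_elim, simp\<close>)

lemma norm_L2_cnj [simp]: "norm (L2_cnj f) = norm f"
proof -
  have "(norm (L2_cnj f))\<^sup>2 = (norm f)\<^sup>2"
    unfolding norm_sq_L2 by (rule integral_cong_AE) (use rep_cnj[of f] in \<open>auto elim: eventually_mono\<close>)
  then show ?thesis by simp
qed

lemma L2_cnj_cscale: "L2_cnj (cscale c f) = cscale (cnj c) (L2_cnj f)"
  by (rule L2_eqI) (use rep_cnj[of f] rep_cnj[of "cscale c f"] rep_cscale[of c f] rep_cscale[of "cnj c" "L2_cnj f"]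
     in \<open>eventually_elim, simp\<close>)

lemma cscale_zero [simp]: "cscale c 0 = 0" "cscale 0 f = 0"
  using norm_cscale[of c 0] norm_cscale[of 0 f] by auto

subsection \<open>Completeness\<close>

text \<open>Riesz-Fischer: a rapidly converging subsequence converges almost everywhere, and Fatou's
  lemma turns the pointwise limit into a norm limit of the whole sequence.\<close>

instance L2 :: (haar_group) banach
proof
  fix X :: "nat \<Rightarrow> 'a L2"
  assume X: "Cauchy X"
  \<comment> \<open>Differences below (1/4)^k have squares below (1/16)^k, which stay summable under
    the weight 4^k used below.\<close>
  have "\<exists>N. \<forall>m\<ge>N. \<forall>n\<ge>N. norm (X m - X n) < (1/4)^k" for k :: nat
    using X[unfolded Cauchy_iff] by simp
  then obtain N where N: "\<And>k m n. m \<ge> N k \<Longrightarrow> n \<ge> N k \<Longrightarrow> norm (X m - X n) < (1/4)^k" by metis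
  define s where "s = rec_nat (N 0) (\<lambda>k p. max (N (Suc k)) (Suc p))"
  have sN: "s k \<ge> N k" for k by (cases k) (auto simp: s_def)
  have s_Suc: "s k < s (Suc k)" for k by (auto simp: s_def)
  then have s: "strict_mono s" by (simp add: strict_mono_Suc_iff)
  have sk: "norm (X (s (Suc k)) - X (s k)) < (1/4)^k" for k
    using N[of k "s (Suc k)" "s k"] sN[of k] s_Suc[of k] by simp
  define d where "d k x = rep_L2 (X (s (Suc k))) x - rep_L2 (X (s k)) x" for k x
  have [measurable]: "d k \<in> borel_measurable haar" for k unfolding d_def by measurable
  have d2: "(\<integral>\<^sup>+x. ennreal ((cmod (d k x))\<^sup>2) \<partial>haar) \<le> ennreal ((1/16)^k)" for k
  proof -
    have "(\<integral>\<^sup>+x. ennreal ((cmod (d k x))\<^sup>2) \<partial>haar) = ennreal ((norm (X (s (Suc k)) - X (s k)))\<^sup>2)"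
      unfolding nn_norm_sq_L2 d_def
      by (intro nn_integral_cong_AE) (use rep_minus[of "X (s (Suc k))" "X (s k)"] in \<open>eventually_elim, simp\<close>)
    also have "\<dots> \<le> ennreal (((1/4)^k)\<^sup>2)"
      by (intro ennreal_leI power_mono less_imp_le[OF sk]) simp
    also have "((1/4)^k)\<^sup>2 = (1/16::real)^k"
      by (induction k) (auto simp: power2_eq_square)
    finally show ?thesis .
  qed
  have "(\<integral>\<^sup>+x. (\<Sum>k. ennreal (4^k * (cmod (d k x))\<^sup>2)) \<partial>haar) = (\<Sum>k. ennreal (4^k) * (\<integral>\<^sup>+x. ennreal ((cmod (d k x))\<^sup>2) \<partial>haar))"
    by (subst nn_integral_suminf) (simp_all add: ennreal_mult nn_integral_cmult)
  also have "\<dots> \<le> (\<Sum>k. ennreal (4^k) * ennreal ((1/16)^k))"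
    by (intro suminf_le mult_left_mono d2) auto
  also have "\<dots> = (\<Sum>k. ennreal ((1/4)^k))"
    by (simp add: ennreal_mult[symmetric] power_mult_distrib[symmetric])
  also have "\<dots> < \<infinity>"
    by (subst suminf_ennreal2) (auto intro!: summable_geometric)
  finally have "AE x in haar. (\<Sum>k. ennreal (4^k * (cmod (d k x))\<^sup>2)) \<noteq> \<infinity>"
    by (intro nn_integral_noteq_infinite) auto
  then have conv: "AE x in haar. convergent (\<lambda>k. rep_L2 (X (s k)) x)"
  proof eventually_elim
    case (elim x)
    have "summable (\<lambda>k. 4^k * (cmod (d k x))\<^sup>2)"
      by (rule summable_suminf_not_top) (use elim in auto)
    \<comment> \<open>Bounded terms of the weighted series already give |d k x| \<le> sqrt C
      (1/2)^k, so the subsequence is the sequence of partial sums of an absolutely convergent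
      series.\<close>
    then have "Bseq (\<lambda>k. 4^k * (cmod (d k x))\<^sup>2)"
      by (intro convergent_imp_Bseq convergentI[of _ 0] summable_LIMSEQ_zero)
    then obtain C where C: "C > 0" "\<And>k. 4^k * (cmod (d k x))\<^sup>2 \<le> C"
      unfolding Bseq_def by (auto simp: abs_le_iff)
    have p4: "(2^k)\<^sup>2 = (4::real)^k" for k :: nat
      by (induction k) (auto simp: power2_eq_square)
    have "cmod (d k x) \<le> sqrt C * (1/2)^k" for k
    proof -
      have "(2^k * cmod (d k x))\<^sup>2 \<le> C"
        unfolding power_mult_distrib p4 by (rule C(2))
      then have "2^k * cmod (d k x) \<le> sqrt C" by (rule real_le_rsqrt)
      then show ?thesis by (simp add: field_simps power_one_over)
    qed
    then have bnd: "\<And>k. k \<ge> 0 \<Longrightarrow> norm (d k x) \<le> sqrt C * (1/2)^k" by simp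
    have "summable (\<lambda>k. sqrt C * (1/2)^k)"
      by (rule summable_mult, rule summable_geometric) simp
    from summable_comparison_test'[OF this bnd] have "summable (\<lambda>k. d k x)" .
    then have "convergent (\<lambda>n. \<Sum>k<n. d k x)" by (simp add: summable_iff_convergent)
    moreover have "(\<Sum>k<n. d k x) = rep_L2 (X (s n)) x - rep_L2 (X (s 0)) x" for n
      unfolding d_def by (rule sum_lessThan_telescope)
    ultimately show ?case
      using convergent_diff_const_right_iff[of "\<lambda>n. rep_L2 (X (s n)) x" "rep_L2 (X (s 0)) x"] by simp
  qed
  define g where "g x = lim (\<lambda>k. rep_L2 (X (s k)) x)" for x
  have [measurable]: "g \<in> borel_measurable haar" unfolding g_def by measurable
  have lim: "AE x in haar. (\<lambda>k. rep_L2 (X (s k)) x) \<longlonglongrightarrow> g x"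
    using conv by eventually_elim (simp add: g_def convergent_LIMSEQ_iff)
  have fatou: "(\<integral>\<^sup>+x. ennreal ((cmod (rep_L2 (X n) x - g x))\<^sup>2) \<partial>haar) \<le> ennreal (e\<^sup>2)"
    if e: "\<And>k. k \<ge> M \<Longrightarrow> norm (X n - X k) \<le> e" "e > 0" for n e M
  proof -
    have "(\<integral>\<^sup>+x. ennreal ((cmod (rep_L2 (X n) x - g x))\<^sup>2) \<partial>haar)
        = (\<integral>\<^sup>+x. liminf (\<lambda>k. ennreal ((cmod (rep_L2 (X n) x - rep_L2 (X (s k)) x))\<^sup>2)) \<partial>haar)"
    proof (intro nn_integral_cong_AE, use lim in eventually_elim)
      case (elim x)
      have "(\<lambda>k. ennreal ((cmod (rep_L2 (X n) x - rep_L2 (X (s k)) x))\<^sup>2)) \<longlonglongrightarrow> ennreal ((cmod (rep_L2 (X n) x - g x))\<^sup>2)"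
        by (intro tendsto_intros elim)
      then show ?case by (simp only: lim_imp_Liminf[OF sequentially_bot])
    qed
    also have "\<dots> \<le> liminf (\<lambda>k. \<integral>\<^sup>+x. ennreal ((cmod (rep_L2 (X n) x - rep_L2 (X (s k)) x))\<^sup>2) \<partial>haar)"
      by (rule nn_integral_liminf) measurable
    also have "\<dots> = liminf (\<lambda>k. ennreal ((norm (X n - X (s k)))\<^sup>2))"
    proof (intro arg_cong[where f = liminf] ext)
      fix k show "(\<integral>\<^sup>+x. ennreal ((cmod (rep_L2 (X n) x - rep_L2 (X (s k)) x))\<^sup>2) \<partial>haar) = ennreal ((norm (X n - X (s k)))\<^sup>2)"
        unfolding nn_norm_sq_L2
        by (intro nn_integral_cong_AE) (use rep_minus[of "X n" "X (s k)"] in \<open>eventually_elim, simp\<close>)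
    qed
    also have "\<dots> \<le> liminf (\<lambda>k. ennreal (e\<^sup>2))"
    proof (rule Liminf_mono, rule eventually_sequentiallyI[of M])
      fix k assume "k \<ge> M"
      then have "s k \<ge> M" using seq_suble[OF s, of k] by linarith
      then show "ennreal ((norm (X n - X (s k)))\<^sup>2) \<le> ennreal (e\<^sup>2)"
        by (intro ennreal_leI power_mono e(1)) auto
    qed
    also have "\<dots> = ennreal (e\<^sup>2)" by (simp add: Liminf_const)
    finally show ?thesis .
  qed
  have cau: "\<exists>M. \<forall>n\<ge>M. \<forall>k\<ge>M. norm (X n - X k) \<le> e" if "e > 0" for e
    using X[unfolded Cauchy_iff, rule_format, OF that] less_imp_le by blast
  have sqd: "sq_integrable (\<lambda>x. rep_L2 (X n) x - g x)"
    if e: "\<And>k. k \<ge> M \<Longrightarrow> norm (X n - X k) \<le> e" "e > 0" for n e M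
    unfolding sq_integrable_def
  proof
    show "integrable haar (\<lambda>x. (cmod (rep_L2 (X n) x - g x))\<^sup>2)"
      by (rule integrableI_bounded, measurable)
        (use le_less_trans[OF fatou[of M n e, OF e]] in simp)
  qed measurable
  obtain M where M: "\<And>n k. n \<ge> M \<Longrightarrow> k \<ge> M \<Longrightarrow> norm (X n - X k) \<le> 1"
    using cau[of 1] by auto
  \<comment> \<open>\<open>g\<close> is written as \<open>X M\<close> minus the difference of
    \<open>X M\<close> and \<open>g\<close>, both of which are square integrable.\<close>
  have "sq_integrable (\<lambda>x. rep_L2 (X M) x + (-1) * (rep_L2 (X M) x - g x))"
    by (intro sq_integrable_add sq_integrable_scale sq_integrable_rep sqd[of M M 1]) (use M in auto)
  then have g: "sq_integrable g" by simp
  have nrm: "norm (X n - abs_L2 g) \<le> e" if e: "\<And>k. k \<ge> M \<Longrightarrow> norm (X n - X k) \<le> e" "e > 0" for n e M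
  proof -
    have "ennreal ((norm (X n - abs_L2 g))\<^sup>2) = (\<integral>\<^sup>+x. ennreal ((cmod (rep_L2 (X n) x - g x))\<^sup>2) \<partial>haar)"
      unfolding nn_norm_sq_L2
      by (intro nn_integral_cong_AE) (use rep_minus[of "X n" "abs_L2 g"] rep_abs_L2[OF g] in \<open>eventually_elim, simp\<close>)
    also have "\<dots> \<le> ennreal (e\<^sup>2)" by (rule fatou[OF e])
    finally show ?thesis using e(2) by (simp add: power2_le_iff_abs_le)
  qed
  have "X \<longlonglongrightarrow> abs_L2 g"
  proof (rule LIMSEQ_I)
    fix r :: real assume r: "r > 0"
    obtain M where M: "\<And>n k. n \<ge> M \<Longrightarrow> k \<ge> M \<Longrightarrow> norm (X n - X k) \<le> r/2"
      using cau[of "r/2"] r by auto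
    then have le: "norm (X n - abs_L2 g) \<le> r/2" if "n \<ge> M" for n
      using that r by (intro nrm[of M]) auto
    have "norm (X n - abs_L2 g) < r" if "n \<ge> M" for n
      using le[OF that] r by linarith
    then show "\<exists>no. \<forall>n\<ge>no. norm (X n - abs_L2 g) < r" by blast
  qed
  then show "convergent X" by (rule convergentI)
qed

section \<open>Measure preserving maps and their composition operators\<close>

lemmas [measurable_cong] = sets_haar

lemma space_haar [simp]: "space haar = UNIV"
  using sets_eq_imp_space_eq[OF sets_haar] by simp

lemma haar_measurable_continuous:
  fixes f :: "'a::haar_group \<Rightarrow> 'b::topological_space"
  assumes "continuous_on UNIV f" shows "f \<in> borel_measurable haar"
  using borel_measurable_continuous_onI[OF assms] by (simp add: measurable_cong_sets[OF sets_haar refl])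

lemma measurable_uminus_group [measurable]: "uminus \<in> borel_measurable (borel :: 'a::haar_group measure)"
  by (intro borel_measurable_continuous_onI continuous_intros)

lemma measurable_uminus_haar [measurable (raw)]:
  fixes f :: "'b \<Rightarrow> 'a::haar_group"
  assumes "f \<in> borel_measurable M" shows "(\<lambda>x. - f x) \<in> borel_measurable M"
  using measurable_compose[OF assms measurable_uminus_group] .

text \<open>Left and right translations, inversion and reflections all have this property, and it is
  closed under composition; both regular representations thus share one theory of composition
  operators.\<close>

definition mpres :: "('a::haar_group \<Rightarrow> 'a) \<Rightarrow> bool"
  where "mpres \<tau> \<longleftrightarrow> \<tau> \<in> measurable haar haar \<and> distr haar haar \<tau> = haar"

lemma mpres_measurable: "mpres \<tau> \<Longrightarrow> \<tau> \<in> measurable haar haar"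
  by (simp add: mpres_def)

lemma mpres_emeasureI:
  assumes "\<tau> \<in> measurable haar haar" "\<And>A. A \<in> sets borel \<Longrightarrow> emeasure haar (\<tau> -` A) = emeasure haar A"
  shows "mpres \<tau>"
  unfolding mpres_def
  by (intro conjI measure_eqI) (use assms in \<open>auto simp: emeasure_distr sets_haar\<close>)

lemma mpres_comp: "mpres \<sigma> \<Longrightarrow> mpres \<tau> \<Longrightarrow> mpres (\<lambda>x. \<sigma> (\<tau> x))"
  unfolding mpres_def
  by (metis comp_def distr_distr measurable_comp[of \<tau> haar haar \<sigma> haar, unfolded comp_def] ext)

lemma mpres_nn_integral:
  assumes "mpres \<tau>" "f \<in> borel_measurable haar"
  shows "(\<integral>\<^sup>+x. f (\<tau> x) \<partial>haar) = (\<integral>\<^sup>+x. f x \<partial>haar)"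
  using nn_integral_distr[of \<tau> haar haar f] assms by (simp add: mpres_def)

lemma mpres_integral:
  fixes f :: "'a::haar_group \<Rightarrow> 'b::{banach, second_countable_topology}"
  assumes "mpres \<tau>" "f \<in> borel_measurable haar"
  shows "(\<integral>x. f (\<tau> x) \<partial>haar) = (\<integral>x. f x \<partial>haar)"
  using integral_distr[of \<tau> haar haar f] assms by (simp add: mpres_def)

lemma mpres_integrable:
  fixes f :: "'a::haar_group \<Rightarrow> 'b::{banach, second_countable_topology}"
  assumes "mpres \<tau>" "integrable haar f"
  shows "integrable haar (\<lambda>x. f (\<tau> x))"
  using integrable_distr[of \<tau> haar haar f] assms by (simp add: mpres_def)

lemma mpres_AE:
  assumes "mpres \<tau>" "AE x in haar. P x"
  shows "AE x in haar. P (\<tau> x)"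
  by (metis AE_distrD assms mpres_def)

lemma mpres_sq_integrable:
  assumes "mpres \<tau>" "sq_integrable f" shows "sq_integrable (\<lambda>x. f (\<tau> x))"
  using assms mpres_integrable[of \<tau> "\<lambda>x. (cmod (f x))\<^sup>2"] measurable_compose[OF mpres_measurable, of \<tau> f borel]
  by (simp add: sq_integrable_def)

definition comp_op :: "('a::haar_group \<Rightarrow> 'a) \<Rightarrow> 'a L2 \<Rightarrow> 'a L2"
  where "comp_op \<tau> f = abs_L2 (\<lambda>x. rep_L2 f (\<tau> x))"

context
  fixes \<tau> :: "'a::haar_group \<Rightarrow> 'a"
  assumes \<tau>: "mpres \<tau>"
begin

lemma rep_comp_op: "AE x in haar. rep_L2 (comp_op \<tau> f) x = rep_L2 f (\<tau> x)"
  unfolding comp_op_def by (rule rep_abs_L2[OF mpres_sq_integrable[OF \<tau> sq_integrable_rep]])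

lemma comp_op_add: "comp_op \<tau> (f + g) = comp_op \<tau> f + comp_op \<tau> g"
  by (rule L2_eqI) (use rep_comp_op[of f] rep_comp_op[of g] rep_comp_op[of "f + g"] rep_plus[of "comp_op \<tau> f" "comp_op \<tau> g"]
      mpres_AE[OF \<tau> rep_plus[of f g]] in \<open>eventually_elim, simp\<close>)

lemma comp_op_cscale: "comp_op \<tau> (cscale c f) = cscale c (comp_op \<tau> f)"
  by (rule L2_eqI) (use rep_comp_op[of f] rep_comp_op[of "cscale c f"] rep_cscale[of c "comp_op \<tau> f"]
      mpres_AE[OF \<tau> rep_cscale[of c f]] in \<open>eventually_elim, simp\<close>)

lemma comp_op_L2_cnj: "comp_op \<tau> (L2_cnj f) = L2_cnj (comp_op \<tau> f)"
  by (rule L2_eqI) (use rep_comp_op[of f] rep_comp_op[of "L2_cnj f"] rep_cnj[of "comp_op \<tau> f"]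
      mpres_AE[OF \<tau> rep_cnj[of f]] in \<open>eventually_elim, simp\<close>)

lemma cinner_comp_op: "cinner (comp_op \<tau> f) (comp_op \<tau> g) = cinner f g"
proof -
  have "cinner (comp_op \<tau> f) (comp_op \<tau> g) = (\<integral>x. rep_L2 f (\<tau> x) * cnj (rep_L2 g (\<tau> x)) \<partial>haar)"
    unfolding cinner_rep
    by (intro integral_cong_AE borel_measurable_times borel_measurable_cnj rep_L2_measurable
        measurable_compose[OF mpres_measurable[OF \<tau>] rep_L2_measurable])
       (use rep_comp_op[of f] rep_comp_op[of g] in \<open>eventually_elim, simp\<close>)
  also have "\<dots> = cinner f g"
    unfolding cinner_rep
    by (rule mpres_integral[OF \<tau>]) (intro borel_measurable_times borel_measurable_cnj rep_L2_measurable)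
  finally show ?thesis .
qed

lemma norm_comp_op: "norm (comp_op \<tau> f) = norm f"
  by (simp add: norm_L2_def inner_L2_def cinner_comp_op)

lemma bounded_linear_comp_op: "bounded_linear (comp_op \<tau>)"
  by (rule bounded_linear_intro[where K = 1]) (simp_all add: comp_op_add scaleR_cscale comp_op_cscale norm_comp_op)

end

lemma comp_op_comp_op:
  assumes "mpres \<sigma>" "mpres \<tau>"
  shows "comp_op \<tau> (comp_op \<sigma> f) = comp_op (\<lambda>x. \<sigma> (\<tau> x)) f"
  by (rule L2_eqI) (use rep_comp_op[OF assms(2), of "comp_op \<sigma> f"] rep_comp_op[OF mpres_comp[OF assms], of f]
      mpres_AE[OF assms(2) rep_comp_op[OF assms(1), of f]] in \<open>eventually_elim, simp\<close>)

lemma comp_op_id: "comp_op (\<lambda>x. x) f = f"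
  by (simp add: comp_op_def abs_rep_L2)

lemma mpres_left: "mpres (\<lambda>x. s + x)"
proof (rule mpres_emeasureI)
  fix A :: "'a set" assume A: "A \<in> sets borel"
  have "(\<lambda>x. s + x) -` A = (\<lambda>x. - s + x) ` A"
  proof (intro set_eqI iffI)
    fix x assume "x \<in> (\<lambda>x. s + x) -` A"
    then show "x \<in> (\<lambda>x. - s + x) ` A" by (intro image_eqI[of _ _ "s + x"]) (auto simp: add.assoc[symmetric])
  qed (auto simp: add.assoc[symmetric])
  then show "emeasure haar ((\<lambda>x. s + x) -` A) = emeasure haar A"
    by (simp add: haar_left_invariant A)
qed measurable

lemma rep_left_reg: "AE t in haar. rep_L2 (left_reg s \<cdot> f) t = rep_L2 f (- s + t)"
  and left_reg_comp_op: "left_reg s \<cdot> f = comp_op (\<lambda>t. - s + t) f"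
proof -
  show "left_reg s \<cdot> f = comp_op (\<lambda>t. - s + t) f" for f
    using bounded_linear_comp_op[OF mpres_left, of "- s"] unfolding left_reg_def comp_op_def[abs_def]
    by (simp add: bounded_linear_Blinfun_apply)
  then show "AE t in haar. rep_L2 (left_reg s \<cdot> f) t = rep_L2 f (- s + t)"
    by (simp add: rep_comp_op[OF mpres_left])
qed

section \<open>Compact groups\<close>

text \<open>The assumption concerns the type alone; the \<open>itself\<close> parameter is the
  handle by which the locale is instantiated at a given group.\<close>

locale compact_haar =
  fixes ty :: "'a::haar_group itself"
  assumes compact_UNIV: "compact (UNIV :: 'a set)"
begin

sublocale finite_measure "haar :: 'a measure"
  by standard (use haar_compact_finite[OF compact_UNIV] in simp)

sublocale pair: pair_sigma_finite "haar :: 'a measure" "haar :: 'a measure" ..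

lemma haar_UNIV_pos: "measure haar (UNIV :: 'a set) > 0"
  using haar_open_pos[of "UNIV :: 'a set"] by (simp add: emeasure_eq_measure)

text \<open>Fubini for the indicator function of \<open>- x + y \<in> A\<close>: integrating over \<open>y\<close> first gives
  \<open>\<mu>(G) \<mu>(A)\<close>, integrating over \<open>x\<close> first gives \<open>\<mu>(G) \<mu>(- A)\<close>.\<close>

lemma mpres_uminus: "mpres (uminus :: 'a \<Rightarrow> 'a)"
proof (rule mpres_emeasureI)
  fix A :: "'a set" assume A [measurable]: "A \<in> sets borel"
  let ?I = "\<lambda>x. indicator A x :: ennreal"
  have "emeasure haar (UNIV :: 'a set) * emeasure haar A = (\<integral>\<^sup>+x. \<integral>\<^sup>+y. ?I (- x + y) \<partial>haar \<partial>haar)"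
  proof -
    have "(\<integral>\<^sup>+y. ?I (- x + y) \<partial>haar) = emeasure haar A" for x
      using mpres_nn_integral[OF mpres_left, of ?I "- x"] by (simp add: sets_haar)
    then show ?thesis by (simp add: mult.commute)
  qed
  also have "\<dots> = (\<integral>\<^sup>+y. \<integral>\<^sup>+x. ?I (- x + y) \<partial>haar \<partial>haar)"
    by (rule pair.Fubini'[symmetric]) (simp add: split_def)
  also have "\<dots> = (\<integral>\<^sup>+y. emeasure haar (uminus -` A) \<partial>(haar :: 'a measure))"
  proof (rule nn_integral_cong)
    fix y :: 'a
    \<comment> \<open>Replacing x by y + x turns - x + y into - (y + x) + y = - x.\<close>
    have "(\<integral>\<^sup>+x. ?I (- x + y) \<partial>haar) = (\<integral>\<^sup>+x. ?I (- (y + x) + y) \<partial>haar)"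
      by (rule mpres_nn_integral[OF mpres_left, of "\<lambda>x. ?I (- x + y)", symmetric]) simp
    also have "\<dots> = (\<integral>\<^sup>+x. ?I (- x) \<partial>haar)"
      by (simp add: minus_add add.assoc)
    also have "\<dots> = (\<integral>\<^sup>+x. indicator (uminus -` A) x \<partial>haar)"
      by (intro nn_integral_cong) (auto simp: indicator_def)
    also have "\<dots> = emeasure haar (uminus -` A)"
      using measurable_sets[OF measurable_uminus_group A] by (intro nn_integral_indicator) (simp add: sets_haar)
    finally show "(\<integral>\<^sup>+x. ?I (- x + y) \<partial>haar) = emeasure haar (uminus -` A)" .
  qed
  also have "\<dots> = emeasure haar (UNIV :: 'a set) * emeasure haar (uminus -` A)"
    by (simp add: mult.commute)
  \<comment> \<open>The factor \<mu>(G) cancels because it is positive and finite.\<close>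
  finally show "emeasure haar (uminus -` A) = emeasure haar A"
    using haar_UNIV_pos by (simp add: emeasure_eq_measure flip: ennreal_mult)
qed measurable

text \<open>x + s = - (- s + - x) is a left translation between two inversions. Hence a compact
  group is unimodular.\<close>

lemma mpres_right: "mpres (\<lambda>x :: 'a. x + s)"
  using mpres_comp[OF mpres_uminus mpres_comp[OF mpres_left[of "- s"] mpres_uminus]]
  by (simp add: minus_add)

lemma mpres_reflect: "mpres (\<lambda>x :: 'a. - x + s)" "mpres (\<lambda>x :: 'a. s - x)"
  using mpres_comp[OF mpres_right mpres_uminus, of s] mpres_comp[OF mpres_left mpres_uminus, of s] by simp_all

lemma modular_fun_eq_1: "modular_fun (r :: 'a) = 1"
  unfolding modular_fun_def
proof (rule the_equality)
  have *: "emeasure haar ((\<lambda>x. x + r) ` E) = emeasure haar E" if "E \<in> sets borel" for E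
  proof -
    have "(\<lambda>x. x + r) ` E = (\<lambda>x. x + (- r)) -` E"
    proof (intro set_eqI iffI)
      fix x assume "x \<in> (\<lambda>x. x + (- r)) -` E"
      then show "x \<in> (\<lambda>x. x + r) ` E" by (intro image_eqI[of _ _ "x + (- r)"]) (auto simp: add.assoc)
    qed (auto simp: add.assoc)
    then show ?thesis
      using emeasure_distr[of "\<lambda>x. x + (- r)" haar haar E] mpres_right[of "- r"] that
      by (simp add: mpres_def sets_haar)
  qed
  then show "1 > (0::real) \<and> (\<forall>E\<in>sets borel. emeasure haar ((\<lambda>x. x + r) ` E) = ennreal 1 * emeasure haar E)"
    by simp
  fix c :: real assume c: "c > 0 \<and> (\<forall>E\<in>sets borel. emeasure haar ((\<lambda>x. x + r) ` E) = ennreal c * emeasure haar E)"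
  \<comment> \<open>Uniqueness: c is read off from E = G, whose measure is positive and
    finite.\<close>
  have "emeasure haar (UNIV :: 'a set) = ennreal c * emeasure haar (UNIV :: 'a set)"
    using bspec[OF conjunct2[OF c], of UNIV] *[of UNIV] by simp
  then show "c = 1" using c haar_UNIV_pos
    by (simp add: emeasure_eq_measure flip: ennreal_mult)
qed

lemma right_reg_comp_op: "right_reg r \<cdot> (f :: 'a L2) = comp_op (\<lambda>t. t + r) f"
  using bounded_linear_comp_op[OF mpres_right, of r] unfolding right_reg_def comp_op_def[abs_def]
  by (simp add: bounded_linear_Blinfun_apply modular_fun_eq_1)

lemma rep_right_reg: "AE t in haar. rep_L2 (right_reg r \<cdot> (f :: 'a L2)) t = rep_L2 f (t + r)"
  by (simp add: right_reg_comp_op rep_comp_op[OF mpres_right])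

lemma right_reg_right_reg: "right_reg r \<cdot> right_reg s \<cdot> (f :: 'a L2) = right_reg (r + s) \<cdot> f"
  by (simp add: right_reg_comp_op comp_op_comp_op mpres_right add.assoc)

lemma right_reg_0 [simp]: "right_reg 0 \<cdot> (f :: 'a L2) = f"
  by (simp add: right_reg_comp_op comp_op_id)

lemma left_right_commute: "left_reg s \<cdot> right_reg r \<cdot> (f :: 'a L2) = right_reg r \<cdot> left_reg s \<cdot> f"
  by (simp add: right_reg_comp_op left_reg_comp_op comp_op_comp_op mpres_right mpres_left add.assoc)

lemma cinner_right_reg_left: "cinner (right_reg r \<cdot> (f :: 'a L2)) g = cinner f (right_reg (- r) \<cdot> g)"
proof -
  have "cinner (right_reg r \<cdot> f) (right_reg r \<cdot> right_reg (- r) \<cdot> g) = cinner f (right_reg (- r) \<cdot> g)"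
    by (simp only: right_reg_comp_op cinner_comp_op[OF mpres_right])
  then show ?thesis by (simp add: right_reg_right_reg)
qed

lemma adj_right_reg: "adj (right_reg r :: 'a oper) = right_reg (- r)"
  unfolding adj_def
proof (rule the_equality)
  show "\<forall>f g. cinner (right_reg r \<cdot> f) g = cinner f ((right_reg (- r) :: 'a oper) \<cdot> g)"
    by (simp add: cinner_right_reg_left)
  fix S :: "'a oper"
  assume S: "\<forall>f g. cinner (right_reg r \<cdot> f) g = cinner f (S \<cdot> g)"
  have "cinner (S \<cdot> g) f = cinner (right_reg (- r) \<cdot> g) f" for f g
    using S by (metis cinner_commute cinner_right_reg_left)
  then show "S = right_reg (- r)" by (intro blinfun_eqI cinner_eqI)
qed

lemma norm_right_reg: "norm (right_reg r \<cdot> (f :: 'a L2)) = norm f"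
  by (simp add: right_reg_comp_op norm_comp_op mpres_right)

lemma norm_left_reg: "norm (left_reg r \<cdot> (f :: 'a L2)) = norm f"
  by (simp add: left_reg_comp_op norm_comp_op mpres_left)

end

section \<open>Density of simple functions and strong continuity of translations\<close>

lemma norm_sq_L2_AE:
  assumes "g \<in> borel_measurable haar" "AE x in haar. rep_L2 f x = g x"
  shows "(norm f)\<^sup>2 = (\<integral>x. (cmod (g x))\<^sup>2 \<partial>haar)"
  unfolding norm_sq_L2
  by (rule integral_cong_AE) (use assms in \<open>auto elim: eventually_mono\<close>)

lemma norm_abs_minus_L2:
  assumes "sq_integrable g"
  shows "(norm (abs_L2 g - f))\<^sup>2 = (\<integral>x. (cmod (g x - rep_L2 f x))\<^sup>2 \<partial>haar)"
proof -
  have [measurable]: "g \<in> borel_measurable haar" using assms by (simp add: sq_integrable_def)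
  show ?thesis
    by (rule norm_sq_L2_AE) (measurable, use rep_abs_L2[OF assms] rep_minus[of "abs_L2 g" f] in \<open>eventually_elim, simp\<close>)
qed

lemma tendsto_L2I:
  fixes F :: "nat \<Rightarrow> 'a::haar_group L2"
  assumes "(\<lambda>n. (norm (F n - f))\<^sup>2) \<longlonglongrightarrow> 0" shows "F \<longlonglongrightarrow> f"
proof -
  have "(\<lambda>n. sqrt ((norm (F n - f))\<^sup>2)) \<longlonglongrightarrow> sqrt 0" by (rule tendsto_real_sqrt[OF assms])
  then have "(\<lambda>n. norm (F n - f)) \<longlonglongrightarrow> 0" by simp
  then show ?thesis by (rule LIM_zero_cancel[OF tendsto_norm_zero_cancel])
qed

context compact_haar
begin

lemma sq_integrable_bounded:
  assumes [measurable]: "f \<in> borel_measurable (haar :: 'a measure)" and "\<And>x. cmod (f x) \<le> C"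
  shows "sq_integrable f"
  unfolding sq_integrable_def
proof
  show "integrable haar (\<lambda>x. (cmod (f x))\<^sup>2)"
    by (rule integrable_const_bound[of "\<lambda>x. (cmod (f x))\<^sup>2" "C\<^sup>2"]) (use assms(2) in \<open>auto intro!: power_mono\<close>)
qed fact

lemma sq_integrable_indicator: "A \<in> sets borel \<Longrightarrow> sq_integrable (indicator A :: 'a \<Rightarrow> complex)"
  by (rule sq_integrable_bounded[where C = 1]) (auto simp: sets_haar split: split_indicator)

text \<open>Approximation by simple functions: they converge pointwise and are bounded by 2 |f|, so
  dominated convergence gives norm convergence. Strong convergence of translations is thereby
  reduced to indicator functions.\<close>

lemma L2_induct [case_names add scale lim indicator]:
  fixes f :: "'a L2"
  assumes add: "\<And>f g. P f \<Longrightarrow> P g \<Longrightarrow> P (f + g)"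
    and scale: "\<And>c f. P f \<Longrightarrow> P (cscale c f)"
    and lim: "\<And>X f. (\<And>n::nat. P (X n)) \<Longrightarrow> X \<longlonglongrightarrow> f \<Longrightarrow> P f"
    and ind: "\<And>A. A \<in> sets borel \<Longrightarrow> P (abs_L2 (indicator A))"
  shows "P f"
proof -
  from borel_measurable_implies_sequence_metric[OF rep_L2_measurable[of f], of 0]
  obtain F where F: "\<And>i. simple_function haar (F i)" "\<And>x. (\<lambda>i. F i x) \<longlonglongrightarrow> rep_L2 f x"
    "\<And>i x. cmod (F i x) \<le> 2 * cmod (rep_L2 f x)" by auto
  have Fm [measurable]: "F i \<in> borel_measurable haar" for i
    using F(1) by (rule borel_measurable_simple_function)
  have sq: "sq_integrable (F i)" for i
  proof -
    have "finite (F i ` UNIV)" using F(1)[of i] by (simp add: simple_function_def)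
    then have "bounded (range (F i))" by (rule finite_imp_bounded)
    then obtain C where "\<And>x. cmod (F i x) \<le> C" by (auto simp: bounded_iff)
    then show ?thesis by (intro sq_integrable_bounded) auto
  qed
  have sum: "sq_integrable (\<lambda>x. \<Sum>y\<in>S. indicator (B y) x *\<^sub>R y) \<and> P (abs_L2 (\<lambda>x. \<Sum>y\<in>S. indicator (B y) x *\<^sub>R y))"
    if "finite S" "\<And>y. B y \<in> sets borel" for S :: "complex set" and B
    using that(1)
  proof (induction S)
    case empty
    have "P (cscale 0 (abs_L2 (indicator {})))" by (intro scale ind) auto
    then show ?case by (simp add: sq_integrable_zero zero_L2_def[symmetric])
  next
    case (insert y S)
    have i: "sq_integrable (indicator (B y) :: 'a \<Rightarrow> complex)" by (intro sq_integrable_indicator that)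
    have "(\<lambda>x. \<Sum>z\<in>insert y S. indicator (B z) x *\<^sub>R z) = (\<lambda>x. y * indicator (B y) x + (\<Sum>z\<in>S. indicator (B z) x *\<^sub>R z))"
      using insert(1,2) by (intro ext, subst sum.insert) (auto simp: indicator_def)
    moreover have "abs_L2 (\<lambda>x. y * indicator (B y) x + (\<Sum>z\<in>S. indicator (B z) x *\<^sub>R z))
       = cscale y (abs_L2 (indicator (B y))) + abs_L2 (\<lambda>x. \<Sum>z\<in>S. indicator (B z) x *\<^sub>R z)"
      using insert.IH i by (simp add: cscale.abs_eq plus_L2.abs_eq L2_eq_def sq_integrable_scale)
    ultimately show ?case
      using insert.IH i that(2) by (auto intro!: add scale ind sq_integrable_add sq_integrable_scale)
  qed
  have PF: "P (abs_L2 (F i))" for i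
  proof -
    have eq: "F i = (\<lambda>x. \<Sum>y\<in>F i ` UNIV. indicator (F i -` {y}) x *\<^sub>R y)"
      by (rule ext, rule simple_function_indicator_representation_banach[OF F(1), of _ i, unfolded space_haar Int_UNIV_right, OF UNIV_I])
    have fin: "finite (F i ` UNIV)" using F(1)[of i] by (simp add: simple_function_def)
    have "F i -` {y} \<in> sets borel" for y
      using measurable_sets[OF Fm, of "{y}" i] by (simp add: sets_haar)
    with fin have "P (abs_L2 (\<lambda>x. \<Sum>y\<in>F i ` UNIV. indicator (F i -` {y}) x *\<^sub>R y))"
      by (rule sum[THEN conjunct2])
    then show ?thesis by (subst eq)
  qed
  have "(\<lambda>i. \<integral>x. (cmod (F i x - rep_L2 f x))\<^sup>2 \<partial>haar) \<longlonglongrightarrow> (\<integral>x. 0 \<partial>(haar :: 'a measure))"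
  proof (rule integral_dominated_convergence)
    \<comment> \<open>|F i - f| \<le> 2 |f| + |f|, whence the factor 9 for the squares.\<close>
    show "integrable haar (\<lambda>x. 9 * (cmod (rep_L2 f x))\<^sup>2)"
      using sq_integrable_rep[of f] by (simp add: sq_integrable_def)
    show "AE x in haar. norm ((cmod (F i x - rep_L2 f x))\<^sup>2) \<le> 9 * (cmod (rep_L2 f x))\<^sup>2" for i
    proof (rule AE_I2)
      fix x
      have "cmod (F i x - rep_L2 f x) \<le> 3 * cmod (rep_L2 f x)"
        using norm_triangle_ineq4[of "F i x" "rep_L2 f x"] F(3)[of i x] by linarith
      from power_mono[OF this, of 2] show "norm ((cmod (F i x - rep_L2 f x))\<^sup>2) \<le> 9 * (cmod (rep_L2 f x))\<^sup>2"
        by (simp add: power_mult_distrib)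
    qed
    show "AE x in haar. (\<lambda>i. (cmod (F i x - rep_L2 f x))\<^sup>2) \<longlonglongrightarrow> 0"
    proof (rule AE_I2)
      fix x
      have "(\<lambda>i. (cmod (F i x - rep_L2 f x))\<^sup>2) \<longlonglongrightarrow> (cmod (rep_L2 f x - rep_L2 f x))\<^sup>2"
        by (intro tendsto_intros F)
      then show "(\<lambda>i. (cmod (F i x - rep_L2 f x))\<^sup>2) \<longlonglongrightarrow> 0" by simp
    qed
  qed measurable
  then have "(\<lambda>i. abs_L2 (F i)) \<longlonglongrightarrow> f"
    by (intro tendsto_L2I) (simp add: norm_abs_minus_L2 sq)
  then show ?thesis by (rule lim[OF PF])
qed

text \<open>For open \<open>V\<close> the positive part of \<open>1\<^sub>V - 1\<^sub>V \<circ> \<tau>\<^sub>n\<close> tends to 0 by dominated convergence, and the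
  negative part has the same integral because \<open>\<tau>\<^sub>n\<close> preserves the measure.\<close>

lemma indicator_diff_tendsto:
  fixes \<tau> :: "nat \<Rightarrow> 'a \<Rightarrow> 'a"
  assumes mp: "\<And>n. mpres (\<tau> n)" and lim: "\<And>x. (\<lambda>n. \<tau> n x) \<longlonglongrightarrow> x" and A: "A \<in> sets borel"
  shows "(\<lambda>n. \<integral>x. \<bar>indicator A (\<tau> n x) - indicator A x :: real\<bar> \<partial>haar) \<longlonglongrightarrow> 0"
proof -
  note [measurable] = mpres_measurable[OF mp]
  let ?I = "\<lambda>A x. indicator A x :: real"
  have int: "integrable haar (?I A)" "integrable haar (\<lambda>x. ?I A (\<tau> n x))"
     "integrable haar (\<lambda>x. \<bar>?I A (\<tau> n x) - ?I A x\<bar>)" if "A \<in> sets borel" for n A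
  proof -
    show 1: "integrable haar (?I A)"
      using that by (simp add: sets_haar emeasure_eq_measure)
    show 2: "integrable haar (\<lambda>x. ?I A (\<tau> n x))" by (rule mpres_integrable[OF mp 1])
    show "integrable haar (\<lambda>x. \<bar>?I A (\<tau> n x) - ?I A x\<bar>)" using 1 2 by simp
  qed
  have "sigma_sets UNIV {S :: 'a set. open S} = sets borel" by (simp add: borel_def)
  then have "A \<in> sigma_sets UNIV {S. open S}" using A by auto
  \<comment> \<open>Open sets are stable under intersection and generate the Borel sets, so beyond
    open sets the claim has to survive complements and disjoint countable unions only.\<close>
  have st: "Int_stable {S :: 'a set. open S}" and sub: "{S :: 'a set. open S} \<subseteq> Pow UNIV" by (auto simp: Int_stable_def)
  from st sub \<open>A \<in> sigma_sets UNIV {S. open S}\<close> show ?thesis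
  proof (induction A rule: sigma_sets_induct_disjoint)
    case (basic V)
    then have V: "open V" and Vb [measurable]: "V \<in> sets borel" by auto
    let ?p = "\<lambda>n x. max 0 (?I V x - ?I V (\<tau> n x))"
    have "(\<lambda>n. \<integral>x. ?p n x \<partial>haar) \<longlonglongrightarrow> (\<integral>x. 0 \<partial>(haar :: 'a measure))"
    proof (rule integral_dominated_convergence[where w = "\<lambda>x. 1"])
      show "?p n \<in> borel_measurable haar" for n
        by (intro borel_measurable_max borel_measurable_diff borel_measurable_const borel_measurable_integrable int Vb)
      show "AE x in haar. (\<lambda>n. ?p n x) \<longlonglongrightarrow> 0"
      proof (rule AE_I2)
        fix x
        show "(\<lambda>n. ?p n x) \<longlonglongrightarrow> 0"
        proof (cases "x \<in> V")
          case True
          then have "eventually (\<lambda>n. \<tau> n x \<in> V) sequentially" using lim[of x] V by (simp add: tendsto_def)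
          then have "eventually (\<lambda>n. ?p n x = 0) sequentially" by eventually_elim (simp add: True)
          then show ?thesis by (rule tendsto_eventually)
        qed (simp add: indicator_def)
      qed
    qed (auto split: split_indicator)
    then have "(\<lambda>n. 2 * (\<integral>x. ?p n x \<partial>haar)) \<longlonglongrightarrow> 0" by (intro tendsto_mult_right_zero) simp
    moreover have "2 * (\<integral>x. ?p n x \<partial>haar) = (\<integral>x. \<bar>?I V (\<tau> n x) - ?I V x\<bar> \<partial>haar)" for n
    proof -
      have ip: "integrable haar (?p n)"
        using int(1)[OF Vb] int(2)[OF Vb, of n] by auto
      have "(\<integral>x. \<bar>?I V (\<tau> n x) - ?I V x\<bar> \<partial>haar) = (\<integral>x. 2 * ?p n x - (?I V x - ?I V (\<tau> n x)) \<partial>haar)"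
        by (intro Bochner_Integration.integral_cong) (auto split: split_indicator)
      also have "\<dots> = 2 * (\<integral>x. ?p n x \<partial>haar) - ((\<integral>x. ?I V x \<partial>haar) - (\<integral>x. ?I V (\<tau> n x) \<partial>haar))"
        using ip int(1)[OF Vb] int(2)[OF Vb, of n] by simp
      also have "(\<integral>x. ?I V (\<tau> n x) \<partial>haar) = (\<integral>x. ?I V x \<partial>haar)"
        by (rule mpres_integral[OF mp]) measurable
      finally show ?thesis by simp
    qed
    ultimately show ?case by simp
  next
    case (compl A)
    have "\<bar>?I (UNIV - A) (\<tau> n x) - ?I (UNIV - A) x\<bar> = \<bar>?I A (\<tau> n x) - ?I A x\<bar>" for n x
      by (auto split: split_indicator)
    then show ?case using compl by simp
  next
    case (union A)
    then have Ab [measurable]: "A i \<in> sets borel" for i by (auto simp: borel_def)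
    show ?case
    proof (rule LIMSEQ_I)
      fix e :: real assume e: "e > 0"
      \<comment> \<open>Finitely many pieces are covered by the induction hypothesis. The tail
        \<open>?R\<close> has measure below e/4 and contributes twice, at x and at
        \<open>\<tau> n x\<close>, with the same integral.\<close>
      have "(\<lambda>i. measure haar (A i)) sums measure haar (\<Union>i. A i)"
        by (rule finite_measure_UNION) (use union(1) Ab in \<open>auto simp: sets_haar\<close>)
      then have "(\<lambda>N. \<Sum>i<N. measure haar (A i)) \<longlonglongrightarrow> measure haar (\<Union>i. A i)" by (simp add: sums_def)
      from LIMSEQ_D[OF this, of "e/4"] e obtain N where
        N: "\<bar>(\<Sum>i<N. measure haar (A i)) - measure haar (\<Union>i. A i)\<bar> < e/4" by (auto simp: dist_real_def)
      let ?R = "\<Union>i\<in>{N..}. A i"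
      have [measurable]: "?R \<in> sets borel" by measurable
      have "measure haar (\<Union>i. A i) = measure haar (\<Union>i<N. A i) + measure haar ?R"
      proof -
        have "(\<Union>i. A i) = (\<Union>i<N. A i) \<union> ?R" by (auto, metis lessThan_iff not_le_imp_less atLeast_iff)
        moreover have "(\<Union>i<N. A i) \<inter> ?R = {}"
        proof (rule equals0I)
          fix z assume "z \<in> (\<Union>i<N. A i) \<inter> ?R"
          then obtain i j where ij: "i < N" "j \<ge> N" "z \<in> A i" "z \<in> A j" by auto
          then have "A i \<inter> A j = {}" by (intro disjoint_family_onD[OF union(1)]) auto
          then show False using ij by auto
        qed
        ultimately show ?thesis by (simp add: finite_measure_Union sets_haar)
      qed
      moreover have "measure haar (\<Union>i<N. A i) = (\<Sum>i<N. measure haar (A i))"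
        by (rule finite_measure_finite_Union) (use union(1) in \<open>auto simp: sets_haar disjoint_family_on_def\<close>)
      ultimately have R: "measure haar ?R < e/4" using N by linarith
      have "(\<lambda>n. \<Sum>i<N. \<integral>x. \<bar>?I (A i) (\<tau> n x) - ?I (A i) x\<bar> \<partial>haar) \<longlonglongrightarrow> (\<Sum>i<N. 0)"
        by (intro tendsto_sum union)
      from order_tendstoD(2)[OF this, of "e/2"] e obtain M where
        M: "\<And>n. n \<ge> M \<Longrightarrow> (\<Sum>i<N. \<integral>x. \<bar>?I (A i) (\<tau> n x) - ?I (A i) x\<bar> \<partial>haar) < e/2"
        by (auto simp: eventually_sequentially)
      have "norm ((\<integral>x. \<bar>?I (\<Union>i. A i) (\<tau> n x) - ?I (\<Union>i. A i) x\<bar> \<partial>haar) - 0) < e" if "n \<ge> M" for n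
      proof -
        have pt: "\<bar>?I (\<Union>i. A i) y - ?I (\<Union>i. A i) x\<bar> \<le> (\<Sum>i<N. \<bar>?I (A i) y - ?I (A i) x\<bar>) + (?I ?R y + ?I ?R x)" for x y
        proof -
          have "?I (\<Union>i. A i) z = (\<Sum>i<N. ?I (A i) z) + ?I ?R z" for z
          proof (cases "\<exists>i. z \<in> A i")
            case True
            then obtain i where i: "z \<in> A i" by auto
            have j: "z \<in> A j \<longleftrightarrow> j = i" for j
              using union(1) i by (auto simp: disjoint_family_on_def)
            have "(\<Sum>j<N. ?I (A j) z) = (\<Sum>j<N. if j = i then 1 else 0)"
              by (intro sum.cong) (auto simp: indicator_def j)
            then show ?thesis using True by (auto simp: indicator_def j)
          qed (auto simp: indicator_def)
          then have "?I (\<Union>i. A i) y - ?I (\<Union>i. A i) x = (\<Sum>i<N. ?I (A i) y - ?I (A i) x) + (?I ?R y - ?I ?R x)"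
            by (simp add: sum_subtractf)
          moreover have "\<bar>\<Sum>i<N. ?I (A i) y - ?I (A i) x\<bar> \<le> (\<Sum>i<N. \<bar>?I (A i) y - ?I (A i) x\<bar>)" by (rule sum_abs)
          moreover have "\<bar>?I ?R y - ?I ?R x\<bar> \<le> ?I ?R y + ?I ?R x" by (auto split: split_indicator)
          ultimately show ?thesis by linarith
        qed
        have "(\<integral>x. \<bar>?I (\<Union>i. A i) (\<tau> n x) - ?I (\<Union>i. A i) x\<bar> \<partial>haar)
            \<le> (\<integral>x. (\<Sum>i<N. \<bar>?I (A i) (\<tau> n x) - ?I (A i) x\<bar>) + (?I ?R (\<tau> n x) + ?I ?R x) \<partial>haar)"
          by (intro integral_mono pt Bochner_Integration.integrable_add Bochner_Integration.integrable_sum int) measurable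
        also have "\<dots> = (\<Sum>i<N. \<integral>x. \<bar>?I (A i) (\<tau> n x) - ?I (A i) x\<bar> \<partial>haar) + ((\<integral>x. ?I ?R (\<tau> n x) \<partial>haar) + (\<integral>x. ?I ?R x \<partial>haar))"
          by (subst Bochner_Integration.integral_add Bochner_Integration.integral_sum;
              (intro Bochner_Integration.integrable_add Bochner_Integration.integrable_sum int)?; measurable?)+
        also have "(\<integral>x. ?I ?R (\<tau> n x) \<partial>haar) = (\<integral>x. ?I ?R x \<partial>haar)"
          by (rule mpres_integral[OF mp]) measurable
        also have "(\<integral>x. ?I ?R x \<partial>haar) = measure haar ?R" by simp
        finally show ?thesis using M[OF that] R by simp
      qed
      then show "\<exists>no. \<forall>n\<ge>no. norm ((\<integral>x. \<bar>?I (\<Union>i. A i) (\<tau> n x) - ?I (\<Union>i. A i) x\<bar> \<partial>haar) - 0) < e" by blast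
    qed
  qed simp
qed

text \<open>The operators are isometries, so convergence passes to limits in \<open>f\<close>. For
  an indicator function the squared L2 distance is the L1 distance, because the difference takes
  only the values -1, 0 and 1.\<close>

lemma comp_op_tendsto:
  fixes \<tau> :: "nat \<Rightarrow> 'a \<Rightarrow> 'a"
  assumes mp: "\<And>n. mpres (\<tau> n)" and lim: "\<And>x. (\<lambda>n. \<tau> n x) \<longlonglongrightarrow> x"
  shows "(\<lambda>n. comp_op (\<tau> n) f) \<longlonglongrightarrow> f"
proof (induction f rule: L2_induct)
  case (add f g)
  then show ?case by (simp add: comp_op_add[OF mp] tendsto_add)
next
  case (scale c f)
  then show ?case
    using bounded_linear.tendsto[OF bounded_linear_cscale] by (simp add: comp_op_cscale[OF mp])
next
  case (lim X f)
  show ?case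
  proof (rule LIMSEQ_I)
    fix e :: real assume e: "e > 0"
    from LIMSEQ_D[OF lim(2), of "e/3"] e obtain k where k: "norm (X k - f) < e/3" by auto
    from LIMSEQ_D[OF lim(1)[of k], of "e/3"] e obtain N where
      N: "\<And>n. n \<ge> N \<Longrightarrow> norm (comp_op (\<tau> n) (X k) - X k) < e/3" by auto
    have "norm (comp_op (\<tau> n) f - f) < e" if "n \<ge> N" for n
    proof -
      have "comp_op (\<tau> n) f - f = comp_op (\<tau> n) (f - X k) + ((comp_op (\<tau> n) (X k) - X k) + (X k - f))"
        using bounded_linear.linear[OF bounded_linear_comp_op[OF mp], of n] by (simp add: linear_diff)
      also have "norm \<dots> \<le> norm (comp_op (\<tau> n) (f - X k)) + (norm (comp_op (\<tau> n) (X k) - X k) + norm (X k - f))"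
        by (intro order_trans[OF norm_triangle_ineq] add_mono order_refl norm_triangle_ineq)
      also have "norm (comp_op (\<tau> n) (f - X k)) = norm (X k - f)"
        by (simp add: norm_comp_op[OF mp] norm_minus_commute)
      finally show ?thesis using k N[OF that] by linarith
    qed
    then show "\<exists>no. \<forall>n\<ge>no. norm (comp_op (\<tau> n) f - f) < e" by blast
  qed
next
  case (indicator A)
  let ?I = "indicator A :: 'a \<Rightarrow> complex"
  have sq: "sq_integrable ?I" by (rule sq_integrable_indicator[OF indicator])
  have [measurable]: "?I \<in> borel_measurable haar" using sq by (simp add: sq_integrable_def)
  have "(norm (comp_op (\<tau> n) (abs_L2 ?I) - abs_L2 ?I))\<^sup>2 = (\<integral>x. \<bar>indicator A (\<tau> n x) - indicator A x :: real\<bar> \<partial>haar)" for n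
  proof -
    have "(norm (comp_op (\<tau> n) (abs_L2 ?I) - abs_L2 ?I))\<^sup>2 = (\<integral>x. (cmod (?I (\<tau> n x) - ?I x))\<^sup>2 \<partial>haar)"
    proof (rule norm_sq_L2_AE)
      have "(\<lambda>x. ?I (\<tau> n x)) \<in> borel_measurable haar"
        by (rule measurable_compose[OF mpres_measurable[OF mp]]) measurable
      then show "(\<lambda>x. ?I (\<tau> n x) - ?I x) \<in> borel_measurable haar" by measurable
    qed (use rep_minus[of "comp_op (\<tau> n) (abs_L2 ?I)" "abs_L2 ?I"] rep_abs_L2[OF sq] mpres_AE[OF mp[of n] rep_abs_L2[OF sq]]
         rep_comp_op[OF mp[of n], of "abs_L2 ?I"] in \<open>eventually_elim, simp\<close>)
    also have "\<dots> = (\<integral>x. \<bar>indicator A (\<tau> n x) - indicator A x :: real\<bar> \<partial>haar)"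
      by (intro Bochner_Integration.integral_cong) (auto split: split_indicator)
    finally show ?thesis .
  qed
  then show ?case
    using indicator_diff_tendsto[of \<tau> A, OF mp assms(2) indicator] by (intro tendsto_L2I) simp
qed

text \<open>\<open>\<sigma> s r\<close> plays the role of the inverse of \<open>\<tau> s\<close>
  composed with \<open>\<tau> r\<close>. Thus \<open>comp_op (\<tau> r)\<close> is
  \<open>comp_op (\<sigma> s r)\<close> applied after \<open>comp_op (\<tau> s)\<close>, and
  continuity at s follows since \<open>\<sigma> s r\<close> tends to the identity as r tends to
  s.\<close>

lemma continuous_comp_op:
  fixes \<tau> :: "'a \<Rightarrow> 'a \<Rightarrow> 'a"
  assumes mp: "\<And>r. mpres (\<tau> r)" "\<And>s r. mpres (\<sigma> s r)" and \<tau>\<sigma>: "\<And>s r x. \<tau> s (\<sigma> s r x) = \<tau> r x"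
    and cont: "\<And>s x. continuous_on UNIV (\<lambda>r. \<sigma> s r x)" and id: "\<And>s x. \<sigma> s s x = x"
  shows "continuous_on UNIV (\<lambda>r. comp_op (\<tau> r) f)"
proof -
  have "((\<lambda>r. comp_op (\<tau> r) f) \<longlongrightarrow> comp_op (\<tau> s) f) (at s)" for s
    unfolding tendsto_at_iff_sequentially
  proof (intro allI impI)
    fix X assume X: "X \<longlonglongrightarrow> s"
    have "(\<lambda>n. comp_op (\<sigma> s (X n)) (comp_op (\<tau> s) f)) \<longlonglongrightarrow> comp_op (\<tau> s) f"
    proof (rule comp_op_tendsto)
      fix x
      have "isCont (\<lambda>r. \<sigma> s r x) s" using cont by (simp add: continuous_on_eq_continuous_at)
      then show "(\<lambda>n. \<sigma> s (X n) x) \<longlonglongrightarrow> x" using isCont_tendsto_compose[OF _ X] by (fastforce simp: id)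
    qed (rule mp)
    then show "((\<lambda>r. comp_op (\<tau> r) f) \<circ> X) \<longlonglongrightarrow> comp_op (\<tau> s) f"
      by (simp add: comp_op_comp_op mp \<tau>\<sigma> comp_def)
  qed
  then show ?thesis by (simp add: continuous_on_eq_continuous_at isCont_def)
qed

lemma continuous_right_reg: "continuous_on UNIV (\<lambda>r. right_reg r \<cdot> (f :: 'a L2))"
  unfolding right_reg_comp_op
  by (rule continuous_comp_op[where \<sigma> = "\<lambda>s r x. x + (r - s)"])
    (auto intro!: mpres_right continuous_intros simp: add.assoc)

lemma continuous_left_reg: "continuous_on UNIV (\<lambda>r. left_reg r \<cdot> (f :: 'a L2))"
  unfolding left_reg_comp_op
proof (rule continuous_comp_op[where \<sigma> = "\<lambda>s r x. (s - r) + x"])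
  show "- s + ((s - r) + x) = - r + x" for s r x :: 'a
    by (simp add: add.assoc[symmetric] diff_conv_add_uminus del: add_uminus_conv_diff)
qed (auto intro!: mpres_left continuous_intros)

end

section \<open>Weak integrals of continuous vector-valued functions\<close>

lemma AE_summable_norm:
  fixes f :: "nat \<Rightarrow> 'b \<Rightarrow> 'c::{banach, second_countable_topology}"
  assumes int: "\<And>i. integrable M (f i)" and sum: "summable (\<lambda>i. \<integral>x. norm (f i x) \<partial>M)"
  shows "AE x in M. summable (\<lambda>i. norm (f i x))"
proof -
  have [measurable]: "f i \<in> borel_measurable M" for i using int by auto
  have "(\<integral>\<^sup>+x. (\<Sum>i. ennreal (norm (f i x))) \<partial>M) = (\<Sum>i. \<integral>\<^sup>+x. ennreal (norm (f i x)) \<partial>M)"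
    by (rule nn_integral_suminf) measurable
  also have "\<dots> = (\<Sum>i. ennreal (\<integral>x. norm (f i x) \<partial>M))"
    by (simp add: nn_integral_eq_integral[OF integrable_norm[OF int]])
  also have "\<dots> = ennreal (\<Sum>i. \<integral>x. norm (f i x) \<partial>M)"
    by (rule suminf_ennreal2[OF _ sum]) simp
  also have "\<dots> < \<infinity>" by simp
  finally have "AE x in M. (\<Sum>i. ennreal (norm (f i x))) \<noteq> \<infinity>"
    by (intro nn_integral_noteq_infinite) auto
  then show ?thesis
  proof eventually_elim
    case (elim x)
    then show ?case by (intro summable_suminf_not_top) auto
  qed
qed

text \<open>The bounds \<open>B i\<close> depend on the point, as they must for terms such as
  \<open>norm (p i) * cmod (rep_L2 (q i) y)\<close>; summability is asked of their
  integrals.\<close>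

lemma sums_integral_dominated:
  fixes f :: "nat \<Rightarrow> 'b \<Rightarrow> complex"
  assumes int: "\<And>i. integrable M (f i)" and bound: "\<And>i x. cmod (f i x) \<le> B i x"
    and B: "\<And>i. (\<integral>x. B i x \<partial>M) \<le> m i" "summable m" "\<And>i. integrable M (B i)"
  shows "(\<lambda>i. \<integral>x. f i x \<partial>M) sums (\<integral>x. (\<Sum>i. f i x) \<partial>M)"
proof -
  have "(\<integral>x. cmod (f i x) \<partial>M) \<le> m i" for i
    by (rule order_trans[OF integral_mono B(1)]) (use int B bound in auto)
  then have s: "summable (\<lambda>i. \<integral>x. cmod (f i x) \<partial>M)"
    by (intro summable_comparison_test'[OF B(2), of 0]) simp
  then show ?thesis by (intro sums_integral AE_summable_norm int)
qed

text \<open>For the step functions below, t is indexed by n and a pair of indices, and at a given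
  point just one pair is active for each n. The sum over the enumeration of all triples collapses to
  the sum over n.\<close>

lemma has_sum_single_index:
  fixes t :: "'b \<times> 'c \<Rightarrow> 'w::{comm_monoid_add, topological_space}"
  assumes "bij_betw e UNIV UNIV" "\<And>n c. c \<noteq> h n \<Longrightarrow> t (n, c) = 0" "((\<lambda>n. t (n, h n)) has_sum s) UNIV"
  shows "((\<lambda>k. t (e k)) has_sum s) UNIV"
proof -
  have "((t \<circ> (\<lambda>n. (n, h n))) has_sum s) UNIV" using assms(3) by (simp add: comp_def)
  then have "(t has_sum s) (range (\<lambda>n. (n, h n)))"
    by (subst has_sum_reindex) (auto simp: inj_on_def)
  then have "(t has_sum s) UNIV"
    by (rule has_sum_cong_neutral[THEN iffD1, rotated -1]) (auto simp: image_iff intro: assms(2))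
  then show ?thesis by (subst has_sum_reindex_bij_betw[OF assms(1)])
qed

text \<open>The values \<open>a k\<close> are differences of successive approximations of \<open>U\<close> by its values on a countable dense
  set. The Bochner integral of the library is not applicable to functions with values in \<open>L2\<close>, for which
  no instance of \<^class>\<open>second_countable_topology\<close> is available.\<close>

lemma step_decomposition:
  fixes U :: "'x::second_countable_topology \<Rightarrow> 'v::banach"
  assumes cont: "continuous_on UNIV U" and bound: "\<And>r. norm (U r) \<le> M"
  obtains E :: "nat \<Rightarrow> 'x set" and a :: "nat \<Rightarrow> 'v"
  where "\<And>k. E k \<in> sets borel"
    and "\<And>r. (\<lambda>k. indicator (E k) r *\<^sub>R a k) sums U r"
    and "\<And>r. (\<lambda>k. indicator (E k) r * norm (a k)) sums (\<Sum>k. indicator (E k) r * norm (a k))"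
    and "\<And>r. (\<Sum>k. indicator (E k) r * norm (a k)) \<le> 3 * M"
proof (cases "M = 0")
  case True
  then have "U r = 0" for r using bound[of r] by simp
  then show ?thesis using True by (intro that[of "\<lambda>_. {}" "\<lambda>_. 0"]) auto
next
  case False
  then have M: "M > 0" using order_trans[OF norm_ge_zero bound] by (simp add: order_less_le)
  obtain D :: "'x set" where D: "countable D" "\<And>X. open X \<Longrightarrow> X \<noteq> {} \<Longrightarrow> \<exists>d\<in>D. d \<in> X"
    by (erule countable_dense_setE)
  define q where "q = from_nat_into D"
  have q: "\<exists>i. q i \<in> X" if "open X" "X \<noteq> {}" for X
    using D(2)[OF that] D(1) unfolding q_def by (metis from_nat_into_surj)
  \<comment> \<open>\<open>U (q (idx n r))\<close> is the first value on the dense sequence within M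
    / 2^n of \<open>U r\<close>; taking the least index keeps the choice measurable in r.\<close>
  define idx where "idx n r = (LEAST i. norm (U r - U (q i)) < M / 2^n)" for n :: nat and r
  \<comment> \<open>The start 0 is within M = M / 2^0 of \<open>U r\<close> by \<open>bound\<close>,
    and makes the differences telescope with no initial term.\<close>
  define S where "S n r = (if n = 0 then 0 else U (q (idx n r)))" for n r
  have idx: "norm (U r - U (q (idx n r))) < M / 2^n" for n r
  proof -
    have "open {s. norm (U r - U s) < M / 2^n}"
      by (intro open_Collect_less continuous_intros cont)
    moreover have "r \<in> {s. norm (U r - U s) < M / 2^n}" using M by simp
    ultimately obtain i where "norm (U r - U (q i)) < M / 2^n" using q by blast
    then show ?thesis unfolding idx_def by (rule LeastI)
  qed
  have [measurable]: "idx n \<in> measurable borel (count_space UNIV)" for n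
  proof -
    have m: "(\<lambda>r. norm (U r - U (q i))) \<in> borel_measurable borel" for i
      by (intro borel_measurable_continuous_onI continuous_intros cont)
    have "{r \<in> space borel. norm (U r - U (q i)) < M / 2^n} \<in> sets borel" for i
      using borel_measurable_less[OF m[of i] borel_measurable_const] .
    then have "(\<lambda>r. norm (U r - U (q i)) < M / 2^n) \<in> measurable borel (count_space UNIV)" for i
      by (simp add: pred_def)
    then show ?thesis unfolding idx_def[abs_def] by (rule measurable_Least)
  qed
  have S: "norm (U r - S n r) \<le> M / 2^n" for n r
    using bound[of r] less_imp_le[OF idx[of r n]] by (simp add: S_def)
  define d where "d n r = S (Suc n) r - S n r" for n r
  \<comment> \<open>The bound is M / 2^n + M / 2^(n+1); summed over n it gives the 3 M of the
    statement.\<close>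
  have nd: "norm (d n r) \<le> (3/2*M) * (1/2)^n" for n r
  proof -
    have "d n r = (U r - S n r) - (U r - S (Suc n) r)" by (simp add: d_def)
    then have "norm (d n r) \<le> M / 2^n + M / 2^Suc n"
      using norm_triangle_ineq4[of "U r - S n r" "U r - S (Suc n) r"] S[of r n] S[of r "Suc n"] by simp
    also have "\<dots> = (3/2*M) * (1/2)^n" by (simp add: field_simps)
    finally show ?thesis .
  qed
  have geo: "(\<lambda>n. (3/2*M) * (1/2)^n) sums (3*M)"
    using sums_mult[OF geometric_sums[of "1/2::real"], of "3/2*M"] by simp
  have sn: "summable (\<lambda>n. norm (d n r))" for r
    by (rule summable_comparison_test'[OF sums_summable[OF geo], of 0]) (use nd in auto)
  have sums_n: "(\<lambda>n. norm (d n r)) sums (\<Sum>n. norm (d n r))" for r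
    using sn by (rule summable_sums)
  have le: "(\<Sum>n. norm (d n r)) \<le> 3 * M" for r
    using suminf_le[OF nd sn sums_summable[OF geo]] unfolding sums_unique[OF geo, symmetric] .
  have sums_d: "(\<lambda>n. d n r) sums U r" for r
  proof -
    have "(\<lambda>n. M / 2^n) \<longlonglongrightarrow> 0"
      using tendsto_mult_right_zero[OF LIMSEQ_power_zero[of "1/2::real"], of M] by (simp add: field_simps)
    then have "(\<lambda>n. U r - S n r) \<longlonglongrightarrow> 0"
      by (rule Lim_null_comparison[rotated]) (use S in simp)
    from tendsto_diff[OF tendsto_const[of "U r"] this] have "(\<lambda>n. S n r) \<longlonglongrightarrow> U r" by simp
    moreover have "(\<Sum>k<n. d k r) = S n r" for n
      unfolding d_def by (subst sum_lessThan_telescope) (simp add: S_def)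
    ultimately show ?thesis by (simp add: sums_def)
  qed
  define e where "e = from_nat_into (UNIV :: (nat \<times> nat \<times> nat) set)"
  have e: "bij_betw e UNIV UNIV" unfolding e_def
    by (rule bij_betw_from_nat_into) (auto simp: finite_prod)
  \<comment> \<open>Here k codes n and the two selected indices: on \<open>E k\<close> the n-th
    difference has the constant value \<open>a k\<close>.\<close>
  define E where "E k = (case e k of (n, i, j) \<Rightarrow> {r. idx (Suc n) r = i \<and> idx n r = j})" for k
  define a where "a k = (case e k of (n, i, j) \<Rightarrow> U (q i) - (if n = 0 then 0 else U (q j)))" for k
  define t where "t r = (\<lambda>(n, i, j). if idx (Suc n) r = i \<and> idx n r = j then U (q i) - (if n = 0 then 0 else U (q j)) else 0)" for r
  have te: "t r (e k) = indicator (E k) r *\<^sub>R a k" for r k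
    by (auto simp: t_def E_def a_def split: prod.splits)
  let ?h = "\<lambda>r n. (idx (Suc n) r, idx n r)"
  have t0: "t r (n, c) = 0" if "c \<noteq> ?h r n" for r n c
    using that by (cases c) (auto simp: t_def)
  have td: "t r (n, ?h r n) = d n r" for r n
    by (simp add: t_def d_def S_def)
  show ?thesis
  proof (rule that[of E a])
    show "E k \<in> sets borel" for k
    proof -
      obtain n i j where eq: "e k = (n, i, j)" by (cases "e k") auto
      have "{r \<in> space borel. idx (Suc n) r = i \<and> idx n r = j} \<in> sets borel" by measurable
      then show ?thesis by (simp add: E_def eq)
    qed
    show "(\<lambda>k. indicator (E k) r *\<^sub>R a k) sums U r" for r
    proof (rule has_sum_imp_sums)
      have "((\<lambda>n. t r (n, ?h r n)) has_sum U r) UNIV"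
        unfolding td by (rule norm_summable_imp_has_sum[OF sn sums_d])
      then show "((\<lambda>k. indicator (E k) r *\<^sub>R a k) has_sum U r) UNIV"
        unfolding te[symmetric] by (rule has_sum_single_index[OF e, rotated]) (rule t0)
    qed
    have hs: "(\<lambda>k. norm (indicator (E k) r *\<^sub>R a k)) sums (\<Sum>n. norm (d n r))" for r
    proof (rule has_sum_imp_sums)
      have "((\<lambda>n. norm (t r (n, ?h r n))) has_sum (\<Sum>n. norm (d n r))) UNIV"
        unfolding td by (rule norm_summable_imp_has_sum[OF _ sums_n]) (simp add: sn)
      then show "((\<lambda>k. norm (indicator (E k) r *\<^sub>R a k)) has_sum (\<Sum>n. norm (d n r))) UNIV"
        unfolding te[symmetric]
        by (rule has_sum_single_index[where t = "\<lambda>p. norm (t r p)", OF e, rotated]) (simp add: t0)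
    qed
    have eq: "norm (indicator (E k) r *\<^sub>R a k) = indicator (E k) r * norm (a k)" for k r by (simp add: indicator_def)
    show "(\<lambda>k. indicator (E k) r * norm (a k)) sums (\<Sum>k. indicator (E k) r * norm (a k))" for r
      using hs[of r] by (simp only: eq sums_iff)
    show "(\<Sum>k. indicator (E k) r * norm (a k)) \<le> 3 * M" for r
      using hs[of r] le[of r] by (simp only: eq sums_iff)
  qed
qed

definition clinear_functional :: "('a::haar_group L2 \<Rightarrow> complex) \<Rightarrow> bool"
  where "clinear_functional \<phi> \<longleftrightarrow> bounded_linear \<phi> \<and> (\<forall>c f. \<phi> (cscale c f) = c * \<phi> f)"

text \<open>The weak integral of f U. It is tested against all bounded complex-linear functionals,
  not just inner products, so that it also obeys functionals of the form \<phi> composed with an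
  operator.\<close>

definition wint :: "('a::haar_group \<Rightarrow> complex) \<Rightarrow> ('a \<Rightarrow> 'a L2) \<Rightarrow> 'a L2"
  where "wint f U = (SOME w. \<forall>\<phi>. clinear_functional \<phi> \<longrightarrow> \<phi> w = (\<integral>r. f r * \<phi> (U r) \<partial>haar))"

lemma clinear_functional_cinner: "clinear_functional (\<lambda>f. cinner f g)"
  by (simp add: clinear_functional_def bounded_linear_cinner_left cinner_scale_left)

lemma clinear_functional_compose:
  "clinear_functional \<phi> \<Longrightarrow> T \<in> BL2 \<Longrightarrow> clinear_functional (\<lambda>f. \<phi> (T \<cdot> f))"
  by (auto simp: clinear_functional_def BL2_def intro: bounded_linear_compose blinfun.bounded_linear_right)

context compact_haar
begin

lemma continuous_bounded_L2:
  fixes U :: "'a \<Rightarrow> 'a L2"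
  assumes "continuous_on UNIV U" obtains M where "\<And>r. norm (U r) \<le> M"
proof -
  have "bounded (range U)"
    using compact_continuous_image[OF assms compact_UNIV] by (rule compact_imp_bounded)
  then show ?thesis using that by (auto simp: bounded_iff)
qed

lemma integrable_mult_bounded:
  fixes f g :: "'a \<Rightarrow> complex"
  assumes "integrable haar f" "g \<in> borel_measurable haar" "\<And>r. cmod (g r) \<le> M"
  shows "integrable haar (\<lambda>r. f r * g r)"
proof (rule Bochner_Integration.integrable_bound)
  show "integrable haar (\<lambda>r. M * cmod (f r))" using assms(1) by simp
  show "AE r in haar. norm (f r * g r) \<le> norm (M * cmod (f r))"
  proof (rule AE_I2)
    fix r
    have "cmod (f r) * cmod (g r) \<le> cmod (f r) * \<bar>M\<bar>"
      by (intro mult_left_mono) (use assms(3)[of r] in auto)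
    then show "norm (f r * g r) \<le> norm (M * cmod (f r))" by (simp add: norm_mult abs_mult mult.commute)
  qed
qed (use assms in \<open>auto intro: borel_measurable_times\<close>)

lemma continuous_functional_measurable:
  fixes U :: "'a \<Rightarrow> 'a L2"
  assumes "continuous_on UNIV U" "clinear_functional \<phi>"
  shows "(\<lambda>r. \<phi> (U r)) \<in> borel_measurable haar"
  using assms by (intro haar_measurable_continuous) (auto simp: clinear_functional_def intro: bounded_linear.continuous_on)

text \<open>At each point the step weights add up to at most B. Integrating this against |f| bounds
  all partial sums, which yields absolute convergence of the series built from a step
  decomposition.\<close>

lemma step_weight_bound:
  fixes E :: "nat \<Rightarrow> 'a set" and a :: "nat \<Rightarrow> real" and f :: "'a \<Rightarrow> complex"
  assumes f: "integrable haar f" and E: "\<And>k. E k \<in> sets borel" and nn: "\<And>k. a k \<ge> 0"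
    and a: "\<And>r. summable (\<lambda>k. indicator (E k) r * a k)" and le: "\<And>r. (\<Sum>k. indicator (E k) r * a k) \<le> B"
  shows "integrable haar (\<lambda>r. complex_of_real (indicator (E k) r) * f r)"
    and "(\<Sum>k<n. (\<integral>r. cmod (complex_of_real (indicator (E k) r) * f r) \<partial>haar) * a k) \<le> B * (\<integral>r. cmod (f r) \<partial>haar)"
proof -
  have g: "integrable haar (\<lambda>r. complex_of_real (indicator (E k) r) * f r)" for k
    using integrable_mult_indicator[OF _ f, of "E k"] E[of k] by (simp add: scaleR_conv_of_real sets_haar)
  show "integrable haar (\<lambda>r. complex_of_real (indicator (E k) r) * f r)" by (rule g)
  have "(\<Sum>k<n. (\<integral>r. cmod (complex_of_real (indicator (E k) r) * f r) \<partial>haar) * a k)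
      = (\<integral>r. (\<Sum>k<n. cmod (complex_of_real (indicator (E k) r) * f r) * a k) \<partial>haar)"
    by (subst Bochner_Integration.integral_sum) (auto intro: g)
  also have "\<dots> \<le> (\<integral>r. B * cmod (f r) \<partial>haar)"
  proof (rule integral_mono)
    fix r
    have "(\<Sum>k<n. cmod (complex_of_real (indicator (E k) r) * f r) * a k) = cmod (f r) * (\<Sum>k<n. indicator (E k) r * a k)"
      unfolding sum_distrib_left by (intro sum.cong refl) (simp add: norm_mult)
    also have "\<dots> \<le> cmod (f r) * (\<Sum>k. indicator (E k) r * a k)"
      by (intro mult_left_mono sum_le_suminf a) (auto intro!: mult_nonneg_nonneg nn)
    also have "\<dots> \<le> cmod (f r) * B" by (intro mult_left_mono le) auto
    finally show "(\<Sum>k<n. cmod (complex_of_real (indicator (E k) r) * f r) * a k) \<le> B * cmod (f r)" by (simp add: mult_ac)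
  qed (use g f in auto)
  finally show "(\<Sum>k<n. (\<integral>r. cmod (complex_of_real (indicator (E k) r) * f r) \<partial>haar) * a k) \<le> B * (\<integral>r. cmod (f r) \<partial>haar)"
    by simp
qed

text \<open>Once U is the sum of the steps \<open>a k\<close> on \<open>E k\<close>, the integral
  has to be the series of the \<open>a k\<close> multiplied by the integrals of f over
  \<open>E k\<close>, and this series converges absolutely.\<close>

lemma wint_exists:
  fixes U :: "'a \<Rightarrow> 'a L2"
  assumes f: "integrable haar f" and U: "continuous_on UNIV U"
  shows "\<exists>w. \<forall>\<phi>. clinear_functional \<phi> \<longrightarrow> \<phi> w = (\<integral>r. f r * \<phi> (U r) \<partial>haar)"
proof -
  obtain M where M: "\<And>r. norm (U r) \<le> M" using continuous_bounded_L2[OF U] by blast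
  obtain E :: "nat \<Rightarrow> 'a set" and a where
    E: "\<And>k. E k \<in> sets borel" and a: "\<And>r. (\<lambda>k. indicator (E k) r *\<^sub>R a k) sums U r"
    and na: "\<And>r. (\<lambda>k. indicator (E k) r * norm (a k)) sums (\<Sum>k. indicator (E k) r * norm (a k))"
    and le: "\<And>r. (\<Sum>k. indicator (E k) r * norm (a k)) \<le> 3 * M"
    by (rule step_decomposition[OF U M]) (rule that)
  define g where "g k r = complex_of_real (indicator (E k) r) * f r" for k r
  note swb = step_weight_bound[OF f E norm_ge_zero sums_summable[OF na] le]
  have g: "integrable haar (g k)" for k unfolding g_def by (rule swb(1))
  define c where "c k = (\<integral>r. g k r \<partial>haar)" for k
  have part: "(\<Sum>k<n. (\<integral>r. cmod (g k r) \<partial>haar) * norm (a k)) \<le> 3 * M * (\<integral>r. cmod (f r) \<partial>haar)" for n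
    unfolding g_def by (rule swb(2))
  have sumg: "summable (\<lambda>k. (\<integral>r. cmod (g k r) \<partial>haar) * norm (a k))"
    by (rule summableI_nonneg_bounded[OF _ part]) simp
  have "summable (\<lambda>k. norm (cscale (c k) (a k)))"
  proof (rule summable_comparison_test'[OF sumg, of 0])
    fix k
    have "cmod (c k) \<le> (\<integral>r. cmod (g k r) \<partial>haar)" unfolding c_def by (rule integral_norm_bound)
    then show "norm (norm (cscale (c k) (a k))) \<le> (\<integral>r. cmod (g k r) \<partial>haar) * norm (a k)"
      by (simp add: norm_cscale mult_right_mono)
  qed
  then have "summable (\<lambda>k. cscale (c k) (a k))" by (rule summable_norm_cancel)
  then obtain w where w: "(\<lambda>k. cscale (c k) (a k)) sums w" by (auto simp: summable_def)
  have "\<phi> w = (\<integral>r. f r * \<phi> (U r) \<partial>haar)" if \<phi>: "clinear_functional \<phi>" for \<phi>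
  proof -
    have bl: "bounded_linear \<phi>" and sc: "\<And>c f. \<phi> (cscale c f) = c * \<phi> f"
      using \<phi> by (auto simp: clinear_functional_def)
    obtain K where K: "K \<ge> 0" "\<And>u. cmod (\<phi> u) \<le> norm u * K"
      using bounded_linear.nonneg_bounded[OF bl] by auto
    have "(\<lambda>k. c k * \<phi> (a k)) sums \<phi> w" using bounded_linear.sums[OF bl w] by (simp add: sc)
    moreover have "(\<lambda>k. \<integral>r. g k r * \<phi> (a k) \<partial>haar) sums (\<integral>r. (\<Sum>k. g k r * \<phi> (a k)) \<partial>haar)"
    proof (rule sums_integral_dominated)
      show "cmod (g k r * \<phi> (a k)) \<le> K * (cmod (g k r) * norm (a k))" for k r
        using mult_left_mono[OF K(2)[of "a k"], of "cmod (g k r)"] by (simp add: norm_mult mult_ac)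
      show "(\<integral>r. K * (cmod (g k r) * norm (a k)) \<partial>haar) \<le> K * ((\<integral>r. cmod (g k r) \<partial>haar) * norm (a k))" for k
        by simp
    qed (use g sumg in \<open>simp_all add: summable_mult\<close>)
    moreover have "(\<integral>r. g k r * \<phi> (a k) \<partial>haar) = c k * \<phi> (a k)" for k
      unfolding c_def using g[of k] by simp
    moreover have "(\<Sum>k. g k r * \<phi> (a k)) = f r * \<phi> (U r)" for r
    proof -
      have "(\<lambda>k. \<phi> (indicator (E k) r *\<^sub>R a k)) sums \<phi> (U r)" by (rule bounded_linear.sums[OF bl a])
      from sums_mult[OF this, of "f r"] have "(\<lambda>k. f r * \<phi> (indicator (E k) r *\<^sub>R a k)) sums (f r * \<phi> (U r))" .
      moreover have "f r * \<phi> (indicator (E k) r *\<^sub>R a k) = g k r * \<phi> (a k)" for k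
        by (simp add: scaleR_cscale sc g_def)
      ultimately show ?thesis by (simp add: sums_iff)
    qed
    ultimately show ?thesis by (simp add: sums_iff c_def)
  qed
  then show ?thesis by blast
qed

lemma wint:
  fixes U :: "'a \<Rightarrow> 'a L2"
  assumes "integrable haar f" "continuous_on UNIV U" "clinear_functional \<phi>"
  shows "\<phi> (wint f U) = (\<integral>r. f r * \<phi> (U r) \<partial>haar)"
  using someI_ex[OF wint_exists[OF assms(1,2)]] assms(3) unfolding wint_def by blast

lemma cinner_wint:
  fixes U :: "'a \<Rightarrow> 'a L2"
  assumes "integrable haar f" "continuous_on UNIV U"
  shows "cinner (wint f U) v = (\<integral>r. f r * cinner (U r) v \<partial>haar)"
  by (rule wint[OF assms clinear_functional_cinner])

lemma norm_le_of_cinner: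
  fixes w :: "'a L2"
  assumes "\<And>v. cmod (cinner w v) \<le> C * norm v"
  shows "norm w \<le> C"
proof (cases "norm w = 0")
  case True
  have "0 \<le> C * norm v" for v :: "'a L2" using order_trans[OF norm_ge_zero assms] .
  \<comment> \<open>For w = 0 the claim is C \<ge> 0. It follows from the hypothesis at any nonzero
    vector, such as the constant function 1.\<close>
  moreover have "norm (abs_L2 (indicator UNIV) :: 'a L2) > 0"
  proof -
    have "(norm (abs_L2 (indicator UNIV) :: 'a L2))\<^sup>2 = measure haar (UNIV :: 'a set)"
      by (subst norm_sq_abs_L2[OF sq_integrable_indicator]) (auto simp: indicator_def)
    then show ?thesis using haar_UNIV_pos by (metis norm_ge_zero order_less_le power_zero_numeral zero_less_norm_iff)
  qed
  ultimately have "C \<ge> 0" by (metis linorder_not_le mult_less_0_iff)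
  then show ?thesis using True by simp
next
  case False
  have "norm w * norm w \<le> C * norm w"
    using assms[of w] by (simp add: cinner_self_norm power2_eq_square norm_mult)
  then show ?thesis using False by (metis mult_right_le_imp_le norm_ge_zero order_less_le)
qed

text \<open>The bound on U is asked for only where f does not vanish: an average over V can then use
  an estimate valid on V alone.\<close>

lemma norm_wint_le:
  fixes U :: "'a \<Rightarrow> 'a L2"
  assumes f: "integrable haar f" and U: "continuous_on UNIV U" and M: "\<And>r. f r \<noteq> 0 \<Longrightarrow> norm (U r) \<le> M"
  shows "norm (wint f U) \<le> M * (\<integral>r. cmod (f r) \<partial>haar)"
proof (rule norm_le_of_cinner)
  fix v
  have "cmod (cinner (wint f U) v) \<le> (\<integral>r. cmod (f r * cinner (U r) v) \<partial>haar)"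
    unfolding cinner_wint[OF f U] by (rule integral_norm_bound)
  also have "\<dots> \<le> (\<integral>r. (M * norm v) * cmod (f r) \<partial>haar)"
  proof (rule integral_mono')
    show "integrable haar (\<lambda>r. (M * norm v) * cmod (f r))" using f by simp
    fix r
    have "cmod (f r) * cmod (cinner (U r) v) \<le> cmod (f r) * (M * norm v)"
      using mult_left_mono[OF order_trans[OF cmod_cinner_le mult_right_mono[OF M norm_ge_zero]], of r "cmod (f r)" v]
      by (cases "f r = 0") auto
    then show "cmod (f r * cinner (U r) v) \<le> (M * norm v) * cmod (f r)" by (simp add: norm_mult mult_ac)
    then show "0 \<le> (M * norm v) * cmod (f r)" by (rule order_trans[OF norm_ge_zero])
  qed
  finally show "cmod (cinner (wint f U) v) \<le> M * (\<integral>r. cmod (f r) \<partial>haar) * norm v" by (simp add: mult_ac)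
qed

end

section \<open>An approximate identity of convolution operators\<close>

declare borel_measurable_cnj [measurable (raw)]

lemma measurable_rep_compose [measurable (raw)]:
  fixes f :: "'b \<Rightarrow> 'a::haar_group"
  assumes "f \<in> borel_measurable M" shows "(\<lambda>x. rep_L2 u (f x)) \<in> borel_measurable M"
proof -
  have "rep_L2 u \<in> borel_measurable borel"
    using rep_L2_measurable[of u] by (simp add: measurable_cong_sets[OF sets_haar refl])
  then show ?thesis by (rule measurable_compose[OF assms])
qed

lemma measurable_diff_haar [measurable (raw)]:
  fixes f g :: "'b \<Rightarrow> 'a::haar_group"
  assumes [measurable]: "f \<in> borel_measurable M" "g \<in> borel_measurable M"
  shows "(\<lambda>x. f x - g x) \<in> borel_measurable M"
proof -
  have "(\<lambda>x. f x + - g x) \<in> borel_measurable M" by measurable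
  then show ?thesis by simp
qed

definition nind :: "'a::haar_group set \<Rightarrow> 'a \<Rightarrow> complex"
  where "nind V r = complex_of_real (indicator V r / measure haar V)"

text \<open>The operator A_V of the overview, with left convolution written as an average of left
  translates.\<close>

definition avg :: "'a::haar_group set \<Rightarrow> 'a L2 \<Rightarrow> 'a L2"
  where "avg V u = wint (nind V) (\<lambda>s. left_reg s \<cdot> u)"

context compact_haar
begin

lemma fubini_swap:
  fixes H :: "'a \<times> 'a \<Rightarrow> complex"
  assumes "H \<in> borel_measurable (haar \<Otimes>\<^sub>M haar)" "\<And>s. integrable haar (\<lambda>x. H (s, x))"
    "\<And>s. (\<integral>x. cmod (H (s, x)) \<partial>haar) \<le> C s" "integrable haar C"
  shows "integrable (haar \<Otimes>\<^sub>M haar) H"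
    and "(\<integral>s. \<integral>x. H (s, x) \<partial>haar \<partial>haar) = (\<integral>x. \<integral>s. H (s, x) \<partial>haar \<partial>haar)"
proof -
  show int: "integrable (haar \<Otimes>\<^sub>M haar) H"
  proof (rule pair.Fubini_integrable)
    show "integrable haar (\<lambda>x. \<integral>y. norm (H (x, y)) \<partial>haar)"
    proof (rule Bochner_Integration.integrable_bound[OF assms(4)])
      show "(\<lambda>x. \<integral>y. norm (H (x, y)) \<partial>haar) \<in> borel_measurable haar"
        by (rule borel_measurable_lebesgue_integral) (use assms(1) in simp)
      show "AE x in haar. norm (\<integral>y. norm (H (x, y)) \<partial>haar) \<le> norm (C x)"
      proof (rule AE_I2)
        fix x show "norm (\<integral>y. norm (H (x, y)) \<partial>haar) \<le> norm (C x)"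
          using assms(3)[of x] by simp
      qed
    qed
  qed (use assms in auto)
  show "(\<integral>s. \<integral>x. H (s, x) \<partial>haar \<partial>haar) = (\<integral>x. \<integral>s. H (s, x) \<partial>haar \<partial>haar)"
    using pair.Fubini_integral[of "\<lambda>x y. H (x, y)"] int by simp
qed

text \<open>Cauchy-Schwarz for the moduli, which are elements of L2 with the same norms.\<close>

lemma cmod_integral_rep_le:
  fixes u v :: "'a L2"
  shows "integrable haar (\<lambda>x. cmod (rep_L2 u x) * cmod (rep_L2 v x))"
    and "(\<integral>x. cmod (rep_L2 u x) * cmod (rep_L2 v x) \<partial>haar) \<le> norm u * norm v"
proof -
  have sq: "sq_integrable (\<lambda>x. complex_of_real (cmod (rep_L2 w x)))" for w :: "'a L2"
    using sq_integrable_rep[of w] by (auto simp: sq_integrable_def)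
  show i: "integrable haar (\<lambda>x. cmod (rep_L2 u x) * cmod (rep_L2 v x))"
    using integrable_norm[OF sq_integrable_mult[OF sq[of u] sq[of v]]] by (simp add: norm_mult)
  have n: "norm (abs_L2 (\<lambda>x. complex_of_real (cmod (rep_L2 w x)))) = norm w" for w :: "'a L2"
  proof -
    have "(norm (abs_L2 (\<lambda>x. complex_of_real (cmod (rep_L2 w x)))))\<^sup>2 = (norm w)\<^sup>2"
      by (subst norm_sq_abs_L2[OF sq]) (simp add: norm_sq_L2)
    then show ?thesis by simp
  qed
  have "cinner (abs_L2 (\<lambda>x. complex_of_real (cmod (rep_L2 u x)))) (abs_L2 (\<lambda>x. complex_of_real (cmod (rep_L2 v x))))
      = (\<integral>x. complex_of_real (cmod (rep_L2 u x) * cmod (rep_L2 v x)) \<partial>haar)"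
    by (simp add: cinner_abs sq)
  also have "\<dots> = complex_of_real (\<integral>x. cmod (rep_L2 u x) * cmod (rep_L2 v x) \<partial>haar)"
    by (rule integral_complex_of_real)
  finally have "cmod (complex_of_real (\<integral>x. cmod (rep_L2 u x) * cmod (rep_L2 v x) \<partial>haar)) \<le> norm u * norm v"
    using cmod_cinner_le[of "abs_L2 (\<lambda>x. complex_of_real (cmod (rep_L2 u x)))" "abs_L2 (\<lambda>x. complex_of_real (cmod (rep_L2 v x)))"]
    by (simp add: n)
  then show "(\<integral>x. cmod (rep_L2 u x) * cmod (rep_L2 v x) \<partial>haar) \<le> norm u * norm v"
    unfolding norm_of_real by linarith
qed

lemma norm_one_L2: "norm (abs_L2 (\<lambda>_. 1) :: 'a L2) = sqrt (measure haar (UNIV :: 'a set))"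
proof -
  have "(norm (abs_L2 (\<lambda>_. 1) :: 'a L2))\<^sup>2 = measure haar (UNIV :: 'a set)"
    by (subst norm_sq_abs_L2) (auto intro: sq_integrable_bounded[of _ 1])
  then show ?thesis by (metis real_sqrt_unique norm_ge_zero)
qed

text \<open>Cauchy-Schwarz against the constant function 1, which lies in L2 as the measure is
  finite.\<close>

lemma integrable_rep: "integrable haar (rep_L2 (u :: 'a L2))"
  and integral_cmod_rep_le: "(\<integral>x. cmod (rep_L2 u x) \<partial>haar) \<le> norm u * sqrt (measure haar (UNIV :: 'a set))"
proof -
  let ?one = "abs_L2 (\<lambda>_. 1) :: 'a L2"
  have ae: "AE x in haar. cmod (rep_L2 u x) * cmod (rep_L2 ?one x) = cmod (rep_L2 u x)"
    using rep_abs_L2[OF sq_integrable_bounded[of "\<lambda>_ :: 'a. 1" 1]] by (auto elim: eventually_mono)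
  have "integrable haar (\<lambda>x. cmod (rep_L2 u x))"
    using integrable_cong_AE[OF _ _ ae] cmod_integral_rep_le(1)[of u ?one] by simp
  then show "integrable haar (rep_L2 u)" using integrable_norm_iff[OF rep_L2_measurable] by blast
  have "(\<integral>x. cmod (rep_L2 u x) \<partial>haar) = (\<integral>x. cmod (rep_L2 u x) * cmod (rep_L2 ?one x) \<partial>haar)"
    by (rule integral_cong_AE) (use ae in \<open>auto elim: eventually_mono\<close>)
  also have "\<dots> \<le> norm u * sqrt (measure haar (UNIV :: 'a set))"
    using cmod_integral_rep_le(2)[of u ?one] by (simp add: norm_one_L2)
  finally show "(\<integral>x. cmod (rep_L2 u x) \<partial>haar) \<le> norm u * sqrt (measure haar (UNIV :: 'a set))" .
qed

end

locale small_nhd = compact_haar ty for ty :: "'a::haar_group itself" +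
  fixes V :: "'a set"
  assumes open_V: "open V" and zero_V: "0 \<in> V"
begin

lemma measure_V_pos: "measure haar V > 0"
  using haar_open_pos[OF open_V] zero_V by (auto simp: emeasure_eq_measure)

lemma nind_measurable [measurable]: "nind V \<in> borel_measurable borel"
proof -
  have [measurable]: "V \<in> sets borel" using open_V by simp
  show ?thesis unfolding nind_def[abs_def] by measurable
qed

lemma cmod_nind: "cmod (nind V r) = indicator V r / measure haar V"
  by (simp add: nind_def norm_divide del: of_real_divide)

lemma cmod_nind_le: "cmod (nind V r) \<le> 1 / measure haar V"
  by (simp add: cmod_nind divide_right_mono)

lemma cnj_nind [simp]: "cnj (nind V r) = nind V r"
  by (simp add: nind_def)

lemma integrable_nind: "integrable haar (nind V)"
  by (rule integrable_const_bound[of _ "1 / measure haar V"]) (auto simp: cmod_nind_le)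

lemma integral_cmod_nind: "(\<integral>r. cmod (nind V r) \<partial>haar) = 1"
  unfolding cmod_nind using measure_V_pos open_V by simp

lemma integral_nind: "(\<integral>r. nind V r \<partial>haar) = 1"
  unfolding nind_def integral_complex_of_real using measure_V_pos open_V by simp

lemma cinner_avg: "cinner (avg V u) v = (\<integral>s. nind V s * cinner (left_reg s \<cdot> u) v \<partial>haar)"
  unfolding avg_def by (rule cinner_wint[OF integrable_nind continuous_left_reg])

lemma norm_avg: "norm (avg V u) \<le> norm u"
  using norm_wint_le[OF integrable_nind continuous_left_reg[of u], of "norm u"]
  by (simp add: avg_def norm_left_reg integral_cmod_nind)

lemma integrable_nind_cinner: "integrable haar (\<lambda>s. nind V s * cinner (left_reg s \<cdot> u) v)"
proof (rule integrable_mult_bounded[OF integrable_nind])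
  show "(\<lambda>s. cinner (left_reg s \<cdot> u) v) \<in> borel_measurable haar"
    by (rule continuous_functional_measurable[OF continuous_left_reg clinear_functional_cinner])
  show "cmod (cinner (left_reg s \<cdot> u) v) \<le> norm u * norm v" for s
    using cmod_cinner_le[of "left_reg s \<cdot> u" v] by (simp add: norm_left_reg)
qed

lemma left_reg_cscale: "left_reg s \<cdot> cscale c u = cscale c (left_reg s \<cdot> (u :: 'a L2))"
  by (simp add: left_reg_comp_op comp_op_cscale mpres_left)

lemma avg_add: "avg V (u + v) = avg V u + avg V v"
  by (rule cinner_eqI)
   (simp add: cinner_avg cinner_add_left blinfun.add_right distrib_left integrable_nind_cinner)

lemma avg_cscale: "avg V (cscale c u) = cscale c (avg V u)"
proof (rule cinner_eqI)
  fix h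
  have "(\<integral>s. nind V s * (c * cinner (left_reg s \<cdot> u) h) \<partial>haar)
     = (\<integral>s. c * (nind V s * cinner (left_reg s \<cdot> u) h) \<partial>haar)"
    by (simp add: mult_ac)
  also have "\<dots> = c * (\<integral>s. nind V s * cinner (left_reg s \<cdot> u) h \<partial>haar)"
    by (rule Bochner_Integration.integral_mult_right_zero)
  finally show "cinner (avg V (cscale c u)) h = cinner (cscale c (avg V u)) h"
    by (simp add: cinner_avg left_reg_cscale cinner_scale_left)
qed

lemma bounded_linear_avg: "bounded_linear (avg V)"
  by (rule bounded_linear_intro[where K = 1]) (simp_all add: avg_add scaleR_cscale avg_cscale norm_avg)

lemma Blinfun_avg: "Blinfun (avg V) \<cdot> u = avg V u"
  by (simp add: bounded_linear_Blinfun_apply[OF bounded_linear_avg])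

lemma Blinfun_avg_BL2: "Blinfun (avg V) \<in> BL2"
  by (simp add: BL2_def Blinfun_avg avg_cscale)

text \<open>Since \<open>nind V\<close> has integral 1, \<open>avg V u - u\<close> is the average
  over V of the differences \<open>left_reg s \<cdot> u - u\<close>.\<close>

lemma norm_avg_diff:
  assumes "\<And>s. s \<in> V \<Longrightarrow> norm (left_reg s \<cdot> u - u) \<le> e"
  shows "norm (avg V u - u) \<le> e"
proof -
  have cont: "continuous_on UNIV (\<lambda>s. left_reg s \<cdot> u - u)"
    by (intro continuous_intros continuous_left_reg)
  have "avg V u - u = wint (nind V) (\<lambda>s. left_reg s \<cdot> u - u)"
  proof (rule cinner_eqI)
    fix h
    show "cinner (avg V u - u) h = cinner (wint (nind V) (\<lambda>s. left_reg s \<cdot> u - u)) h"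
      unfolding cinner_wint[OF integrable_nind cont] cinner_diff_left cinner_avg right_diff_distrib
      using integrable_nind_cinner integrable_nind integral_nind by simp
  qed
  also have "norm \<dots> \<le> e * (\<integral>r. cmod (nind V r) \<partial>haar)"
    by (rule norm_wint_le[OF integrable_nind cont]) (auto simp: nind_def indicator_def intro: assms split: if_splits)
  finally show ?thesis by (simp add: integral_cmod_nind)
qed

text \<open>\<open>avg V\<close> has the kernel \<open>nind V (x - y)\<close>. Its sections, in y
  for fixed x (\<open>kerL x\<close>) and in x for fixed y (\<open>kerR y\<close>), are right
  translates of two fixed vectors; the first section runs through V backwards, hence the reflected
  \<open>ker0'\<close>. They are the a_x and b_y of the overview.\<close>

definition ker0 :: "'a L2" where "ker0 = abs_L2 (\<lambda>z. nind V z)"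
definition ker0' :: "'a L2" where "ker0' = abs_L2 (\<lambda>z. nind V (- z))"

definition kerL :: "'a \<Rightarrow> 'a L2" where "kerL x = right_reg (- x) \<cdot> ker0'"
definition kerR :: "'a \<Rightarrow> 'a L2" where "kerR y = right_reg (- y) \<cdot> ker0"

lemma continuous_kerL: "continuous_on UNIV kerL" and continuous_kerR: "continuous_on UNIV kerR"
proof -
  have *: "continuous_on UNIV (\<lambda>x. right_reg (- x) \<cdot> (u :: 'a L2))" for u
    by (rule continuous_on_compose2[OF continuous_right_reg]) (auto intro!: continuous_intros)
  show "continuous_on UNIV kerL" "continuous_on UNIV kerR"
    unfolding kerL_def[abs_def] kerR_def[abs_def] by (rule *)+
qed

lemma norm_kerL: "norm (kerL x) = norm ker0'" and norm_kerR: "norm (kerR x) = norm ker0"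
  by (simp_all add: kerL_def kerR_def norm_right_reg)

lemma kerL_add: "right_reg (- r) \<cdot> kerL x = kerL (x + r)"
  and kerR_add: "right_reg (- r) \<cdot> kerR x = kerR (x + r)"
  by (simp_all add: kerL_def kerR_def right_reg_right_reg minus_add)

lemma rep_kerL: "AE z in haar. rep_L2 (kerL x) z = nind V (x - z)"
proof -
  have sq: "sq_integrable (\<lambda>z. nind V (- z))"
    by (rule sq_integrable_bounded[where C = "1 / measure haar V"]) (auto simp: cmod_nind_le)
  have "AE z in haar. rep_L2 ker0' (z + (- x)) = nind V (- (z + (- x)))"
    unfolding ker0'_def by (rule mpres_AE[OF mpres_right rep_abs_L2[OF sq]])
  then show ?thesis using rep_right_reg[of "- x" ker0']
    by eventually_elim (simp add: kerL_def)
qed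

lemma rep_kerR: "AE z in haar. rep_L2 (kerR y) z = nind V (z - y)"
proof -
  have sq: "sq_integrable (\<lambda>z. nind V z)"
    by (rule sq_integrable_bounded[where C = "1 / measure haar V"]) (auto simp: cmod_nind_le)
  have "AE z in haar. rep_L2 ker0 (z + (- y)) = nind V (z + (- y))"
    unfolding ker0_def by (rule mpres_AE[OF mpres_right rep_abs_L2[OF sq]])
  then show ?thesis using rep_right_reg[of "- y" ker0]
    by eventually_elim (simp add: kerR_def)
qed

lemma cinner_kerL: "cinner u (kerL x) = (\<integral>y. rep_L2 u y * nind V (x - y) \<partial>haar)"
  unfolding cinner_rep
  by (rule integral_cong_AE; (measurable; fail)?) (use rep_kerL[of x] in \<open>eventually_elim, simp add: norm_mult\<close>)

lemma cinner_kerR: "cinner (kerR y) v = (\<integral>x. nind V (x - y) * cnj (rep_L2 v x) \<partial>haar)"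
  unfolding cinner_rep
  by (rule integral_cong_AE; (measurable; fail)?) (use rep_kerR[of y] in \<open>eventually_elim, simp add: norm_mult\<close>)

lemma continuous_cinner_kerL: "continuous_on UNIV (\<lambda>x. cinner u (kerL x))"
  using bounded_linear.continuous_on[OF bounded_linear_cinner_right continuous_kerL] .

lemma measurable_cinner_kerL: "(\<lambda>x. cinner u (kerL x)) \<in> borel_measurable haar"
  by (rule haar_measurable_continuous[OF continuous_cinner_kerL])

lemma cmod_cinner_kerL: "cmod (cinner u (kerL x)) \<le> norm u * norm ker0'"
  using cmod_cinner_le[of u "kerL x"] by (simp add: norm_kerL)

text \<open>Fubini, then for fixed x the substitution s = x - y, under which - s + x = y. It
  preserves Haar measure because inversion does.\<close>

lemma cinner_avg_kerL: "cinner (avg V u) v = (\<integral>x. cinner u (kerL x) * cnj (rep_L2 v x) \<partial>haar)"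
proof -
  define H where "H p = nind V (fst p) * (rep_L2 u (- fst p + snd p) * cnj (rep_L2 v (snd p)))" for p
  have rl: "cinner (left_reg s \<cdot> u) v = (\<integral>x. rep_L2 u (- s + x) * cnj (rep_L2 v x) \<partial>haar)" for s
    unfolding cinner_rep
    by (rule integral_cong_AE; (measurable; fail)?) (use rep_left_reg[of s u] in \<open>eventually_elim, simp add: norm_mult\<close>)
  have intu: "integrable haar (\<lambda>x. rep_L2 u (- s + x) * cnj (rep_L2 v x))" for s
    by (rule sq_integrable_mult[OF mpres_sq_integrable[OF mpres_left sq_integrable_rep] sq_integrable_rep])
  have bnd: "(\<integral>x. cmod (H (s, x)) \<partial>haar) \<le> cmod (nind V s) * (norm u * norm v)" for s
  proof -
    have "(\<integral>x. cmod (H (s, x)) \<partial>haar) = (\<integral>x. cmod (nind V s) * (cmod (rep_L2 (left_reg s \<cdot> u) x) * cmod (rep_L2 v x)) \<partial>haar)"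
      unfolding H_def fst_conv snd_conv
      by (rule integral_cong_AE; (measurable; fail)?) (use rep_left_reg[of s u] in \<open>eventually_elim, simp add: norm_mult\<close>)
    also have "\<dots> = cmod (nind V s) * (\<integral>x. cmod (rep_L2 (left_reg s \<cdot> u) x) * cmod (rep_L2 v x) \<partial>haar)"
      by (rule Bochner_Integration.integral_mult_right_zero)
    also have "\<dots> \<le> cmod (nind V s) * (norm (left_reg s \<cdot> u) * norm v)"
      by (intro mult_left_mono cmod_integral_rep_le) simp
    finally show ?thesis by (simp add: norm_left_reg)
  qed
  have "cinner (avg V u) v = (\<integral>s. \<integral>x. H (s, x) \<partial>haar \<partial>haar)"
    unfolding cinner_avg rl using intu by (simp add: H_def)
  also have "\<dots> = (\<integral>x. \<integral>s. H (s, x) \<partial>haar \<partial>haar)"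
  proof (rule fubini_swap(2)[where C = "\<lambda>s. cmod (nind V s) * (norm u * norm v)"])
    show "H \<in> borel_measurable (haar \<Otimes>\<^sub>M haar)"
      unfolding H_def[abs_def] by measurable
    show "integrable haar (\<lambda>x. H (s, x))" for s using intu[of s] by (simp add: H_def)
    show "integrable haar (\<lambda>s. cmod (nind V s) * (norm u * norm v))" using integrable_nind by simp
  qed (rule bnd)
  also have "\<dots> = (\<integral>x. cinner u (kerL x) * cnj (rep_L2 v x) \<partial>haar)"
  proof (rule Bochner_Integration.integral_cong[OF refl])
    fix x
    have "(\<integral>s. H (s, x) \<partial>haar) = (\<integral>y. H (x - y, x) \<partial>haar)"
    proof (rule mpres_integral[OF mpres_reflect(2), symmetric])
      show "(\<lambda>s. H (s, x)) \<in> borel_measurable haar"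
        unfolding H_def fst_conv snd_conv by measurable
    qed
    also have "\<dots> = (\<integral>y. (rep_L2 u y * nind V (x - y)) * cnj (rep_L2 v x) \<partial>haar)"
    proof (rule Bochner_Integration.integral_cong[OF refl])
      fix y
      have "- (x - y) + x = y" by simp
      then show "H (x - y, x) = (rep_L2 u y * nind V (x - y)) * cnj (rep_L2 v x)"
        by (simp add: H_def mult_ac)
    qed
    also have "\<dots> = cinner u (kerL x) * cnj (rep_L2 v x)"
      unfolding cinner_kerL
      by (rule Bochner_Integration.integral_mult_left_zero)
    finally show "(\<integral>s. H (s, x) \<partial>haar) = cinner u (kerL x) * cnj (rep_L2 v x)" .
  qed
  finally show ?thesis .
qed

text \<open>Consequently \<open>avg V u\<close> has a bounded continuous representative.\<close>

lemma rep_avg: "AE x in haar. rep_L2 (avg V u) x = cinner u (kerL x)"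
proof -
  have sq: "sq_integrable (\<lambda>x. cinner u (kerL x))"
    by (rule sq_integrable_bounded[OF measurable_cinner_kerL cmod_cinner_kerL])
  have "avg V u = abs_L2 (\<lambda>x. cinner u (kerL x))"
  proof (rule cinner_eqI)
    fix h
    have "cinner (abs_L2 (\<lambda>x. cinner u (kerL x))) h = (\<integral>x. cinner u (kerL x) * cnj (rep_L2 h x) \<partial>haar)"
      using cinner_abs[OF sq sq_integrable_rep[of h]] by (simp add: abs_rep_L2)
    then show "cinner (avg V u) h = cinner (abs_L2 (\<lambda>x. cinner u (kerL x))) h"
      by (simp add: cinner_avg_kerL)
  qed
  then show ?thesis using rep_abs_L2[OF sq] by simp
qed

text \<open>The same kernel read column by column. In this form a bounded operator can be applied
  under the integral.\<close>

lemma avg_eq_wint: "avg V u = wint (rep_L2 u) kerR"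
proof (rule cinner_eqI)
  fix v
  define H where "H p = rep_L2 u (fst p) * (nind V (snd p - fst p) * cnj (rep_L2 v (snd p)))" for p
  have intv: "integrable haar (\<lambda>x. nind V (x - y) * cnj (rep_L2 v x))" for y
  proof -
    have "integrable haar (\<lambda>x. cnj (rep_L2 v x) * nind V (x - y))"
      by (rule integrable_mult_bounded[where M = "1 / measure haar V"])
        (auto simp: cmod_nind_le integrable_rep)
    then show ?thesis by (simp add: mult.commute)
  qed
  have "cinner (wint (rep_L2 u) kerR) v = (\<integral>y. \<integral>x. H (y, x) \<partial>haar \<partial>haar)"
    unfolding cinner_wint[OF integrable_rep continuous_kerR] cinner_kerR H_def using intv by simp
  also have "\<dots> = (\<integral>x. \<integral>y. H (y, x) \<partial>haar \<partial>haar)"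
  proof (rule fubini_swap(2)[where C = "\<lambda>y. cmod (rep_L2 u y) * (norm v * norm ker0)"])
    show "H \<in> borel_measurable (haar \<Otimes>\<^sub>M haar)"
      unfolding H_def[abs_def] by measurable
    show "integrable haar (\<lambda>x. H (y, x))" for y using intv[of y] by (simp add: H_def)
    show "integrable haar (\<lambda>y. cmod (rep_L2 u y) * (norm v * norm ker0))" using integrable_rep[of u] by simp
    fix y
    have "(\<integral>x. cmod (H (y, x)) \<partial>haar) = (\<integral>x. cmod (rep_L2 u y) * (cmod (rep_L2 v x) * cmod (rep_L2 (kerR y) x)) \<partial>haar)"
      unfolding H_def fst_conv snd_conv
      by (rule integral_cong_AE; (measurable; fail)?) (use rep_kerR[of y] in \<open>eventually_elim, simp add: norm_mult\<close>)
    also have "\<dots> = cmod (rep_L2 u y) * (\<integral>x. cmod (rep_L2 v x) * cmod (rep_L2 (kerR y) x) \<partial>haar)"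
      by (rule Bochner_Integration.integral_mult_right_zero)
    also have "\<dots> \<le> cmod (rep_L2 u y) * (norm v * norm (kerR y))"
      by (intro mult_left_mono cmod_integral_rep_le) simp
    finally show "(\<integral>x. cmod (H (y, x)) \<partial>haar) \<le> cmod (rep_L2 u y) * (norm v * norm ker0)" by (simp add: norm_kerR)
  qed
  also have "\<dots> = (\<integral>x. cinner u (kerL x) * cnj (rep_L2 v x) \<partial>haar)"
  proof (rule Bochner_Integration.integral_cong[OF refl])
    fix x
    have "(\<integral>y. H (y, x) \<partial>haar) = (\<integral>y. (rep_L2 u y * nind V (x - y)) * cnj (rep_L2 v x) \<partial>haar)"
      by (simp add: H_def mult_ac)
    also have "\<dots> = cinner u (kerL x) * cnj (rep_L2 v x)"
      unfolding cinner_kerL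
      by (rule Bochner_Integration.integral_mult_left_zero)
    finally show "(\<integral>y. H (y, x) \<partial>haar) = cinner u (kerL x) * cnj (rep_L2 v x)" .
  qed
  finally show "cinner (avg V u) v = cinner (wint (rep_L2 u) kerR) v"
    by (simp add: cinner_avg_kerL)
qed

end

context compact_haar
begin

text \<open>The neighbourhoods come from a countable base at the identity; by strong continuity
  \<open>left_reg s \<cdot> u\<close> is close to u for all s in \<open>V n\<close> once n is
  large.\<close>

lemma small_nhds_exist:
  obtains V :: "nat \<Rightarrow> 'a set" where "\<And>n. small_nhd (V n)"
    and "\<And>u. (\<lambda>n. avg (V n) u) \<longlonglongrightarrow> u"
proof -
  obtain V :: "nat \<Rightarrow> 'a set" where V: "\<And>i. open (V i)" "\<And>i. 0 \<in> V i"
    "\<And>S. open S \<Longrightarrow> 0 \<in> S \<Longrightarrow> eventually (\<lambda>i. V i \<subseteq> S) sequentially"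
    by (rule countable_basis_at_decseq[of "0 :: 'a"]) (rule that)
  have sn: "small_nhd (V n)" for n
    using V by unfold_locales auto
  have "(\<lambda>n. avg (V n) u) \<longlonglongrightarrow> u" for u
  proof (rule LIMSEQ_I)
    fix e :: real assume e: "e > 0"
    let ?S = "{s. norm (left_reg s \<cdot> u - u) < e / 2}"
    have "open ?S" by (intro open_Collect_less continuous_intros continuous_left_reg)
    moreover have "left_reg 0 \<cdot> u = u"
    proof -
      have "(\<lambda>t :: 'a. - 0 + t) = (\<lambda>t. t)" by simp
      then show ?thesis unfolding left_reg_comp_op by (simp only: comp_op_id)
    qed
    then have "0 \<in> ?S" using e by simp
    ultimately obtain N where N: "\<And>n. n \<ge> N \<Longrightarrow> V n \<subseteq> ?S"
      using V(3)[of ?S] by (auto simp: eventually_sequentially)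
    have "norm (avg (V n) u - u) < e" if "n \<ge> N" for n
    proof -
      interpret small_nhd _ "V n" by (rule sn)
      have "norm (avg (V n) u - u) \<le> e / 2"
        by (rule norm_avg_diff) (use N[OF that] in \<open>auto intro: less_imp_le\<close>)
      then show ?thesis using e by simp
    qed
    then show "\<exists>no. \<forall>n\<ge>no. norm (avg (V n) u - u) < e" by blast
  qed
  with sn show ?thesis by (rule that)
qed

end

section \<open>The predual\<close>

text \<open>Used to merge two representing series, one on the even and one on the odd indices, into
  a series for the sum of the functions.\<close>

lemma sums_interleave:
  fixes f g :: "nat \<Rightarrow> complex"
  assumes "g sums x" "f sums y"
  shows "(\<lambda>n. if even n then f (n div 2) else g ((n - 1) div 2)) sums (x + y)"
proof -
  have "(\<lambda>n. if even n then Re (f (n div 2)) else Re (g ((n - 1) div 2))) sums (Re x + Re y)"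
    "(\<lambda>n. if even n then Im (f (n div 2)) else Im (g ((n - 1) div 2))) sums (Im x + Im y)"
    using assms by (auto simp: sums_complex_iff intro!: sums_if)
  then show ?thesis by (simp add: sums_complex_iff if_distrib)
qed

lemma summable_interleave:
  fixes f g :: "nat \<Rightarrow> real"
  assumes "summable g" "summable f"
  shows "summable (\<lambda>n. if even n then f (n div 2) else g ((n - 1) div 2))"
  using sums_if[of g _ f] assms by (auto simp: summable_def)

lemma summable_mult_squares:
  fixes a b :: "nat \<Rightarrow> real"
  assumes "summable (\<lambda>i. (a i)\<^sup>2)" "summable (\<lambda>i. (b i)\<^sup>2)"
  shows "summable (\<lambda>i. \<bar>a i * b i\<bar>)"
proof (rule summable_comparison_test'[of _ 0])
  show "summable (\<lambda>i. (a i)\<^sup>2 + (b i)\<^sup>2)" by (rule summable_add[OF assms])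
  fix n
  have "\<bar>a n\<bar> * \<bar>b n\<bar> \<le> (a n)\<^sup>2 + (b n)\<^sup>2"
  proof -
    have "0 \<le> \<bar>a n\<bar> * \<bar>b n\<bar>" by simp
    moreover have "2 * (\<bar>a n\<bar> * \<bar>b n\<bar>) \<le> (a n)\<^sup>2 + (b n)\<^sup>2"
      using sum_squares_bound[of "\<bar>a n\<bar>" "\<bar>b n\<bar>"] by simp
    ultimately show ?thesis by linarith
  qed
  then show "norm \<bar>a n * b n\<bar> \<le> (a n)\<^sup>2 + (b n)\<^sup>2" by (simp add: abs_mult)
qed

lemma BL2_cscale: "T \<in> BL2 \<Longrightarrow> T \<cdot> cscale c u = cscale c (T \<cdot> u)"
  by (simp add: BL2_def)

lemma L2_cnj_zero [simp]: "L2_cnj 0 = 0"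
  by (metis norm_L2_cnj norm_eq_zero)

text \<open>As \<open>h\<close> is only determined almost everywhere, \<open>\<lambda>x. h (x, y)\<close> need not be Borel measurable and
  \<^const>\<open>abs_L2\<close> cannot be applied to it.\<close>

definition sect :: "('a::haar_group \<times> 'a \<Rightarrow> complex) \<Rightarrow> 'a \<Rightarrow> 'a L2"
  where "sect h y = (THE w. AE x in haar. rep_L2 w x = h (x, y))"

lemma sectI: "AE x in haar. rep_L2 w x = h (x, y) \<Longrightarrow> sect h y = w"
  unfolding sect_def
proof (rule the_equality)
  fix w' assume "AE x in haar. rep_L2 w x = h (x, y)" "AE x in haar. rep_L2 w' x = h (x, y)"
  then have "AE x in haar. rep_L2 w' x = rep_L2 w x" by eventually_elim simp
  then show "w' = w" by (rule L2_eqI)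
qed

lemma rep_sum: "AE x in haar. rep_L2 (\<Sum>i<n. u i) x = (\<Sum>i<n. rep_L2 (u i) x)" for n :: nat
proof (induction n)
  case 0
  then show ?case using rep_zero by simp
next
  case (Suc n)
  then show ?case using rep_plus[of "\<Sum>i<n. u i" "u n"] by eventually_elim simp
qed

lemma cmod_tpair_term: "cmod (cinner (T \<cdot> p) (L2_cnj q)) \<le> norm T * (norm p * norm q)"
proof -
  have "cmod (cinner (T \<cdot> p) (L2_cnj q)) \<le> norm (T \<cdot> p) * norm q"
    using cmod_cinner_le[of "T \<cdot> p" "L2_cnj q"] by simp
  also have "\<dots> \<le> (norm T * norm p) * norm q" by (intro mult_right_mono norm_blinfun) simp
  finally show ?thesis by (simp add: mult.assoc)
qed

lemma tpair_term_summable: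
  assumes "summable (\<lambda>i. norm (p i) * norm (q i))"
  shows "summable (\<lambda>i. norm (cinner (T \<cdot> p i) (L2_cnj (q i))))"
  by (rule summable_comparison_test'[OF summable_mult[OF assms, of "norm T"], of 0]) (simp add: cmod_tpair_term)

lemma represents_summable:
  assumes "represents p q h" shows "summable (\<lambda>i. norm (p i) * norm (q i))"
proof -
  have "summable (\<lambda>i. \<bar>norm (p i) * norm (q i)\<bar>)"
    using assms by (intro summable_mult_squares) (auto simp: represents_def)
  then show ?thesis by simp
qed

context compact_haar
begin

text \<open>Q is not assumed measurable, so the variables are exchanged for the complement of a
  measurable null set that contains all exceptions.\<close>

lemma AE_pair_swap:
  fixes Q :: "'a \<times> 'a \<Rightarrow> bool"
  assumes "AE p in haar \<Otimes>\<^sub>M haar. Q p"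
  shows "AE y in haar. AE x in haar. Q (x, y)"
proof -
  obtain N where N: "N \<in> sets (haar \<Otimes>\<^sub>M haar)" "emeasure (haar \<Otimes>\<^sub>M haar) N = 0"
    "{x\<in>space (haar \<Otimes>\<^sub>M haar). \<not> Q x} \<subseteq> N"
    using assms unfolding eventually_ae_filter by auto
  have "AE p in haar \<Otimes>\<^sub>M haar. p \<notin> N"
    by (rule AE_not_in) (use N in \<open>auto simp: null_sets_def\<close>)
  then have "AE x in haar. AE y in haar. (x, y) \<notin> N" by (rule pair.AE_pair)
  then have "AE y in haar. AE x in haar. (x, y) \<notin> N"
    using N(1) by (subst pair.AE_commute[symmetric]) auto
  then show ?thesis
    by (elim eventually_mono) (use N(3) in \<open>auto simp: space_pair_measure\<close>)
qed

text \<open>The pointwise series converges absolutely because the L1 norms are summable. Its limit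
  is identified along a subsequence of the partial sums that tends to \<open>w\<close> almost
  everywhere, extracted from their L1 convergence.\<close>

lemma L2_sums_AE:
  fixes u :: "nat \<Rightarrow> 'a L2"
  assumes sum: "summable (\<lambda>i. norm (u i))" and w: "u sums w"
  shows "AE x in haar. (\<lambda>i. rep_L2 (u i) x) sums rep_L2 w x"
proof -
  let ?c = "sqrt (measure haar (UNIV :: 'a set))"
  have "summable (\<lambda>i. \<integral>x. cmod (rep_L2 (u i) x) \<partial>haar)"
    by (rule summable_comparison_test'[OF summable_mult2[OF sum, of ?c], of 0]) (simp add: integral_cmod_rep_le)
  then have 1: "AE x in haar. summable (\<lambda>i. cmod (rep_L2 (u i) x))"
    by (intro AE_summable_norm integrable_rep)
  define s where "s n = (\<Sum>i<n. u i)" for n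
  have sw: "s \<longlonglongrightarrow> w" using w by (simp add: sums_def s_def[abs_def])
  have 2: "AE x in haar. \<forall>n. rep_L2 (s n) x = (\<Sum>i<n. rep_L2 (u i) x)"
    unfolding AE_all_countable s_def using rep_sum by blast
  have "(\<lambda>n. \<integral>x. norm (rep_L2 (s n) x - rep_L2 w x) \<partial>haar) \<longlonglongrightarrow> 0"
  proof (rule Lim_null_comparison)
    have "(\<lambda>n. norm (s n - w) * ?c) \<longlonglongrightarrow> 0 * ?c"
      by (intro tendsto_mult tendsto_const) (use sw in \<open>simp add: tendsto_norm_zero LIM_zero\<close>)
    then show "(\<lambda>n. norm (s n - w) * ?c) \<longlonglongrightarrow> 0" by simp
    have "norm (\<integral>x. norm (rep_L2 (s n) x - rep_L2 w x) \<partial>haar) \<le> norm (s n - w) * ?c" for n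
    proof -
      have "(\<integral>x. norm (rep_L2 (s n) x - rep_L2 w x) \<partial>haar) = (\<integral>x. norm (rep_L2 (s n - w) x) \<partial>haar)"
        by (rule integral_cong_AE; (measurable; fail)?) (use rep_minus[of "s n" w] in \<open>eventually_elim, simp\<close>)
      then show ?thesis using integral_cmod_rep_le[of "s n - w"] by simp
    qed
    then show "\<forall>\<^sub>F n in sequentially. norm (\<integral>x. norm (rep_L2 (s n) x - rep_L2 w x) \<partial>haar) \<le> norm (s n - w) * ?c"
      by simp
  qed
  from tendsto_L1_AE_subseq[OF _ this] obtain r where r: "strict_mono r"
    "AE x in haar. (\<lambda>n. rep_L2 (s (r n)) x - rep_L2 w x) \<longlonglongrightarrow> 0"
    using integrable_rep by auto
  from 1 2 r(2) show ?thesis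
  proof eventually_elim
    case (elim x)
    from elim(1) have "summable (\<lambda>i. rep_L2 (u i) x)" by (rule summable_norm_cancel)
    then obtain l where l: "(\<lambda>i. rep_L2 (u i) x) sums l" by (auto simp: summable_def)
    then have "(\<lambda>n. rep_L2 (s n) x) \<longlonglongrightarrow> l" using elim(2) by (simp add: sums_def)
    then have "(\<lambda>n. rep_L2 (s (r n)) x) \<longlonglongrightarrow> l" using LIMSEQ_subseq_LIMSEQ[OF _ r(1)] by (simp add: comp_def)
    moreover have "(\<lambda>n. rep_L2 (s (r n)) x) \<longlonglongrightarrow> rep_L2 w x" using elim(3) by (rule LIM_zero_cancel)
    ultimately have "l = rep_L2 w x" by (rule LIMSEQ_unique)
    then show ?case using l by simp
  qed
qed

text \<open>The sum of ||p i|| |q i (y)| has finite integral over y, so for almost every y the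
  vectors q i (y) p i are absolutely summable. Their sum agrees almost everywhere with h(., y) and
  so depends on h alone.\<close>

lemma represents_sect:
  fixes p q :: "nat \<Rightarrow> 'a L2"
  assumes rp: "represents p q h"
  shows "AE y in haar. summable (\<lambda>i. norm (p i) * cmod (rep_L2 (q i) y)) \<and>
    (\<lambda>i. cscale (rep_L2 (q i) y) (p i)) sums sect h y"
proof -
  let ?c = "sqrt (measure haar (UNIV :: 'a set))"
  have "summable (\<lambda>i. \<integral>x. norm (of_real (norm (p i)) * rep_L2 (q i) x) \<partial>haar)"
  proof (rule summable_comparison_test'[OF summable_mult2[OF represents_summable[OF rp], of ?c], of 0])
    fix i
    show "norm (\<integral>x. norm (complex_of_real (norm (p i)) * rep_L2 (q i) x) \<partial>haar) \<le> norm (p i) * norm (q i) * ?c"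
      using mult_left_mono[OF integral_cmod_rep_le[of "q i"], of "norm (p i)"] by (simp add: norm_mult mult.assoc)
  qed
  then have "AE y in haar. summable (\<lambda>i. norm (complex_of_real (norm (p i)) * rep_L2 (q i) y))"
    by (rule AE_summable_norm[rotated]) (simp add: integrable_rep)
  moreover have "AE y in haar. AE x in haar. (\<lambda>i. rep_L2 (p i) x * rep_L2 (q i) y) sums h (x, y)"
    using AE_pair_swap[of "\<lambda>(x, y). (\<lambda>i. rep_L2 (p i) x * rep_L2 (q i) y) sums h (x, y)"] rp
    by (simp add: represents_def)
  ultimately show ?thesis
  proof eventually_elim
    case (elim y)
    then have s: "summable (\<lambda>i. norm (p i) * cmod (rep_L2 (q i) y))" by (simp add: norm_mult)
    then have s': "summable (\<lambda>i. norm (cscale (rep_L2 (q i) y) (p i)))" by (simp add: norm_cscale mult.commute)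
    then obtain w where w: "(\<lambda>i. cscale (rep_L2 (q i) y) (p i)) sums w"
      using summable_norm_cancel[OF s'] by (auto simp: summable_def)
    have "AE x in haar. \<forall>i. rep_L2 (cscale (rep_L2 (q i) y) (p i)) x = rep_L2 (q i) y * rep_L2 (p i) x"
      unfolding AE_all_countable using rep_cscale by blast
    with L2_sums_AE[OF s' w] elim(2) have "AE x in haar. rep_L2 w x = h (x, y)"
    proof eventually_elim
      case (elim x)
      then have "(\<lambda>i. rep_L2 (p i) x * rep_L2 (q i) y) sums rep_L2 w x" by (simp add: mult.commute)
      then show ?case using elim(2) by (rule sums_unique2)
    qed
    then have "sect h y = w" by (rule sectI)
    then show ?case using s w by simp
  qed
qed

end

text \<open>The values of \<open>S\<close> depend on the series only through \<open>h\<close>, which makes \<^const>\<open>tpair\<close> well defined.\<close>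

lemma (in small_nhd) represents_avg_sums:
  assumes rp: "represents p q h" and T: "T \<in> BL2"
  shows "\<exists>S \<in> borel_measurable haar. (AE y in haar. S y = cinner (T \<cdot> sect h y) (kerL y)) \<and>
    (\<lambda>i. cinner (avg V (T \<cdot> p i)) (L2_cnj (q i))) sums (\<integral>y. S y \<partial>haar)"
proof -
  let ?c = "sqrt (measure haar (UNIV :: 'a set))" and ?K = "norm T * norm ker0'"
  define t where "t i y = rep_L2 (q i) y * cinner (T \<cdot> p i) (kerL y)" for i y
  have bd: "cmod (cinner (T \<cdot> p i) (kerL y)) \<le> ?K * norm (p i)" for i y
  proof -
    have "cmod (cinner (T \<cdot> p i) (kerL y)) \<le> norm (T \<cdot> p i) * norm ker0'"
      by (rule cmod_cinner_kerL)
    also have "\<dots> \<le> (norm T * norm (p i)) * norm ker0'" by (intro mult_right_mono norm_blinfun) simp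
    finally show ?thesis by (simp add: mult_ac)
  qed
  have bt: "cmod (t i y) \<le> ?K * (norm (p i) * cmod (rep_L2 (q i) y))" for i y
    using mult_left_mono[OF bd[of i y], of "cmod (rep_L2 (q i) y)"] by (simp add: t_def norm_mult mult_ac)
  have it: "integrable haar (t i)" for i
    unfolding t_def by (rule integrable_mult_bounded[OF integrable_rep measurable_cinner_kerL bd])
  have sect: "AE y in haar. summable (\<lambda>i. norm (t i y)) \<and> (\<Sum>i. t i y) = cinner (T \<cdot> sect h y) (kerL y)"
    using represents_sect[OF rp]
  proof eventually_elim
    case (elim y)
    then have 1: "summable (\<lambda>i. norm (p i) * cmod (rep_L2 (q i) y))"
      and 2: "(\<lambda>i. cscale (rep_L2 (q i) y) (p i)) sums sect h y" by auto
    have "summable (\<lambda>i. norm (t i y))"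
      by (rule summable_comparison_test'[OF summable_mult[OF 1, of ?K], of 0]) (use bt in simp)
    moreover have "(\<lambda>i. cinner (T \<cdot> cscale (rep_L2 (q i) y) (p i)) (kerL y)) sums cinner (T \<cdot> sect h y) (kerL y)"
      by (intro bounded_linear.sums[OF bounded_linear_cinner_left] bounded_linear.sums[OF blinfun.bounded_linear_right] 2)
    then have "(\<lambda>i. t i y) sums cinner (T \<cdot> sect h y) (kerL y)"
      by (simp add: BL2_cscale[OF T] cinner_scale_left t_def)
    ultimately show ?case by (simp add: sums_iff)
  qed
  have "(\<lambda>i. \<integral>y. t i y \<partial>haar) sums (\<integral>y. (\<Sum>i. t i y) \<partial>haar)"
  proof (rule sums_integral_dominated[OF it bt])
    show "(\<integral>y. ?K * (norm (p i) * cmod (rep_L2 (q i) y)) \<partial>haar) \<le> ?K * ?c * (norm (p i) * norm (q i))" for i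
      using mult_left_mono[OF integral_cmod_rep_le[of "q i"], of "?K * norm (p i)"] by (simp add: mult_ac)
    show "integrable haar (\<lambda>y. ?K * (norm (p i) * cmod (rep_L2 (q i) y)))" for i using integrable_rep[of "q i"] by simp
  qed (rule summable_mult[OF represents_summable[OF rp]])
  moreover have "(\<integral>y. t i y \<partial>haar) = cinner (avg V (T \<cdot> p i)) (L2_cnj (q i))" for i
    unfolding cinner_L2_cnj_rep
  proof (rule integral_cong_AE)
    show "t i \<in> borel_measurable haar" using it by auto
    show "AE x in haar. t i x = rep_L2 (avg V (T \<cdot> p i)) x * rep_L2 (q i) x"
      using rep_avg[of "T \<cdot> p i"] by eventually_elim (simp add: t_def)
  qed measurable
  \<comment> \<open>The witness is the pointwise sum, whose measurability is clear;
    \<open>sect h y\<close> enters only almost everywhere, as it is not known to depend measurably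
    on y.\<close>
  moreover have "(\<lambda>y. \<Sum>i. t i y) \<in> borel_measurable haar"
    using it by (intro borel_measurable_suminf) auto
  moreover have "AE y in haar. (\<Sum>i. t i y) = cinner (T \<cdot> sect h y) (kerL y)"
    using sect by eventually_elim simp
  ultimately show ?thesis by (intro bexI[of _ "\<lambda>y. \<Sum>i. t i y"]) simp_all
qed

context compact_haar
begin

text \<open>Tannery's theorem: the uniform bound on \<open>w n i\<close> provides the dominating
  series C ||p i|| ||q i||.\<close>

lemma tpair_series_tendsto:
  fixes w :: "nat \<Rightarrow> nat \<Rightarrow> 'a L2"
  assumes pq: "represents p q h" and lim: "\<And>i. (\<lambda>n. w n i) \<longlonglongrightarrow> l i" and le: "\<And>n i. norm (w n i) \<le> C * norm (p i)"
  shows "(\<lambda>n. \<Sum>i. cinner (w n i) (L2_cnj (q i))) \<longlonglongrightarrow> (\<Sum>i. cinner (l i) (L2_cnj (q i)))"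
proof (rule tannerys_theorem[THEN conjunct2, THEN conjunct2])
  show "(\<lambda>n. cinner (w n i) (L2_cnj (q i))) \<longlonglongrightarrow> cinner (l i) (L2_cnj (q i))" for i
    by (rule bounded_linear.tendsto[OF bounded_linear_cinner_left lim])
  show "summable (\<lambda>i. C * (norm (p i) * norm (q i)))" by (rule summable_mult[OF represents_summable[OF pq]])
  have "cmod (cinner (w n i) (L2_cnj (q i))) \<le> C * (norm (p i) * norm (q i))" for n i
    using order_trans[OF cmod_cinner_le mult_right_mono[OF le norm_ge_zero], of n i "L2_cnj (q i)"] by (simp add: mult.assoc)
  then show "\<forall>\<^sub>F (i, n) in sequentially \<times>\<^sub>F sequentially. cmod (cinner (w n i) (L2_cnj (q i))) \<le> C * (norm (p i) * norm (q i))"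
    by (intro always_eventually) auto
qed simp

text \<open>With \<open>avg (V n)\<close> in front of T, both series give the integral of functions
  that agree almost everywhere, being built from \<open>sect h\<close>. The operators
  \<open>avg (V n)\<close> have norm at most 1 and tend strongly to the identity, which carries the
  equality over to T.\<close>

lemma represents_unique:
  fixes h :: "'a \<times> 'a \<Rightarrow> complex"
  assumes rp: "represents p q h" and rp': "represents p' q' h" and T: "T \<in> BL2"
  shows "(\<Sum>i. cinner (T \<cdot> p i) (L2_cnj (q i))) = (\<Sum>i. cinner (T \<cdot> p' i) (L2_cnj (q' i)))"
proof -
  obtain V :: "nat \<Rightarrow> 'a set" where V: "\<And>n. small_nhd (V n)" "\<And>u. (\<lambda>n. avg (V n) u) \<longlonglongrightarrow> u"
    using small_nhds_exist by blast
  define s where "s p q n = (\<Sum>i. cinner (avg (V n) (T \<cdot> p i)) (L2_cnj (q i)))" for p q :: "nat \<Rightarrow> 'a L2" and n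
  have lim: "s p q \<longlonglongrightarrow> (\<Sum>i. cinner (T \<cdot> p i) (L2_cnj (q i)))" if "represents p q h" for p q
  proof -
    have "(\<lambda>n. \<Sum>i. cinner (avg (V n) (T \<cdot> p i)) (L2_cnj (q i))) \<longlonglongrightarrow> (\<Sum>i. cinner (T \<cdot> p i) (L2_cnj (q i)))"
      by (rule tpair_series_tendsto[OF that V(2) order_trans[OF small_nhd.norm_avg[OF V(1)] norm_blinfun]])
    then show ?thesis by (simp add: s_def[abs_def])
  qed
  have "s p q n = s p' q' n" for n
  proof -
    interpret small_nhd _ "V n" by (rule V)
    obtain S where S: "S \<in> borel_measurable haar" "AE y in haar. S y = cinner (T \<cdot> sect h y) (kerL y)"
      "s p q n = (\<integral>y. S y \<partial>haar)"
      using represents_avg_sums[OF rp T] by (auto simp: sums_iff s_def)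
    obtain S' where S': "S' \<in> borel_measurable haar" "AE y in haar. S' y = cinner (T \<cdot> sect h y) (kerL y)"
      "s p' q' n = (\<integral>y. S' y \<partial>haar)"
      using represents_avg_sums[OF rp' T] by (auto simp: sums_iff s_def)
    have "AE y in haar. S y = S' y" using S(2) S'(2) by eventually_elim simp
    then show ?thesis unfolding S(3) S'(3) by (intro integral_cong_AE S S')
  qed
  then have "s p q = s p' q'" by auto
  then show ?thesis using lim[OF rp] lim[OF rp'] by (simp add: LIMSEQ_unique)
qed

lemma tpair_eq:
  fixes h :: "'a \<times> 'a \<Rightarrow> complex"
  assumes rp: "represents p q h" and T: "T \<in> BL2"
  shows "tpair T h = (\<Sum>i. cinner (T \<cdot> p i) (L2_cnj (q i)))"
  unfolding tpair_def
proof (rule the_equality)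
  show "\<exists>f g. represents f g h \<and> (\<Sum>i. cinner (T \<cdot> p i) (L2_cnj (q i))) = (\<Sum>i. cinner (T \<cdot> f i) (L2_cnj (g i)))"
    using rp by blast
  fix c assume "\<exists>f g. represents f g h \<and> c = (\<Sum>i. cinner (T \<cdot> f i) (L2_cnj (g i)))"
  then show "c = (\<Sum>i. cinner (T \<cdot> p i) (L2_cnj (q i)))"
    using represents_unique[OF rp _ T] by metis
qed

lemma tpair_sums:
  fixes h :: "'a \<times> 'a \<Rightarrow> complex"
  assumes "represents p q h" "T \<in> BL2"
  shows "(\<lambda>i. cinner (T \<cdot> p i) (L2_cnj (q i))) sums tpair T h"
  unfolding tpair_eq[OF assms]
  by (rule summable_sums[OF summable_norm_cancel[OF tpair_term_summable[OF represents_summable[OF assms(1)]]]])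

text \<open>Integrating the sums of squares shows them finite almost everywhere, and there the
  products are absolutely summable.\<close>

lemma represents_sums_AE:
  fixes f g :: "nat \<Rightarrow> 'a L2"
  assumes "summable (\<lambda>i. (norm (f i))\<^sup>2)" "summable (\<lambda>i. (norm (g i))\<^sup>2)"
  shows "represents f g (\<lambda>(x, y). \<Sum>i. rep_L2 (f i) x * rep_L2 (g i) y)"
proof -
  have ae: "AE x in haar. (\<Sum>i. ennreal ((cmod (rep_L2 (f i) x))\<^sup>2)) \<noteq> \<infinity>"
    if "summable (\<lambda>i. (norm (f i))\<^sup>2)" for f :: "nat \<Rightarrow> 'a L2"
  proof -
    have "(\<integral>\<^sup>+x. (\<Sum>i. ennreal ((cmod (rep_L2 (f i) x))\<^sup>2)) \<partial>haar) = (\<Sum>i. ennreal ((norm (f i))\<^sup>2))"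
      by (subst nn_integral_suminf) (simp_all add: nn_norm_sq_L2)
    also have "\<dots> = ennreal (\<Sum>i. (norm (f i))\<^sup>2)" by (rule suminf_ennreal2[OF _ that]) simp
    also have "\<dots> < \<infinity>" by simp
    finally show ?thesis by (intro nn_integral_noteq_infinite) auto
  qed
  have "AE p in haar \<Otimes>\<^sub>M haar. (\<Sum>i. ennreal ((cmod (rep_L2 (f i) (fst p)))\<^sup>2)) \<noteq> \<infinity> \<and> (\<Sum>i. ennreal ((cmod (rep_L2 (g i) (snd p)))\<^sup>2)) \<noteq> \<infinity>"
  proof (rule pair.AE_pair_measure)
    show "{p \<in> space (haar \<Otimes>\<^sub>M haar). (\<Sum>i. ennreal ((cmod (rep_L2 (f i) (fst p)))\<^sup>2)) \<noteq> \<infinity> \<and> (\<Sum>i. ennreal ((cmod (rep_L2 (g i) (snd p)))\<^sup>2)) \<noteq> \<infinity>}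
        \<in> sets (haar \<Otimes>\<^sub>M haar)" by measurable
    show "AE x in haar. AE y in haar. (\<Sum>i. ennreal ((cmod (rep_L2 (f i) (fst (x, y))))\<^sup>2)) \<noteq> \<infinity> \<and> (\<Sum>i. ennreal ((cmod (rep_L2 (g i) (snd (x, y))))\<^sup>2)) \<noteq> \<infinity>"
      using ae[OF assms(1)]
    proof eventually_elim
      case (elim x)
      show ?case using ae[OF assms(2)] by eventually_elim (use elim in simp)
    qed
  qed
  then have "AE (x, y) in haar \<Otimes>\<^sub>M haar. (\<lambda>i. rep_L2 (f i) x * rep_L2 (g i) y) sums (\<Sum>i. rep_L2 (f i) x * rep_L2 (g i) y)"
  proof eventually_elim
    case (elim p)
    obtain x y where p: "p = (x, y)" by (cases p) auto
    have "summable (\<lambda>i. (cmod (rep_L2 (f i) x))\<^sup>2)" "summable (\<lambda>i. (cmod (rep_L2 (g i) y))\<^sup>2)"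
      using elim by (auto intro!: summable_suminf_not_top simp: p)
    then have "summable (\<lambda>i. \<bar>cmod (rep_L2 (f i) x) * cmod (rep_L2 (g i) y)\<bar>)" by (rule summable_mult_squares)
    then have "summable (\<lambda>i. norm (rep_L2 (f i) x * rep_L2 (g i) y))" by (simp add: norm_mult)
    from summable_sums[OF summable_norm_cancel[OF this]] show ?case by (simp add: p)
  qed
  then show ?thesis using assms by (simp add: represents_def)
qed

text \<open>Summable products of norms suffice: rescaling the i-th pair by \<open>\<alpha> i\<close>
  and its inverse balances the factors, so that both squared norms become ||p i|| ||q i||.\<close>

lemma TG_of_sequences:
  fixes p q :: "nat \<Rightarrow> 'a L2"
  assumes sum: "summable (\<lambda>i. norm (p i) * norm (q i))"
  obtains h where "h \<in> TG" "\<And>T. T \<in> BL2 \<Longrightarrow> (\<lambda>i. cinner (T \<cdot> p i) (L2_cnj (q i))) sums tpair T h"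
proof -
  \<comment> \<open>If one factor is 0, then \<open>\<alpha> i\<close> = 0 and, as inverse 0 = 0,
    both \<open>f i\<close> and \<open>g i\<close> vanish; the i-th term remains 0.\<close>
  define \<alpha> where "\<alpha> i = sqrt (norm (q i) / norm (p i))" for i
  define f where "f i = \<alpha> i *\<^sub>R p i" for i
  define g where "g i = inverse (\<alpha> i) *\<^sub>R q i" for i
  have \<alpha>2: "(\<alpha> i)\<^sup>2 = norm (q i) / norm (p i)" for i by (simp add: \<alpha>_def)
  have nf: "(norm (f i))\<^sup>2 = norm (p i) * norm (q i)" for i
  proof -
    have "(norm (f i))\<^sup>2 = norm (q i) / norm (p i) * (norm (p i))\<^sup>2" by (simp add: f_def power_mult_distrib \<alpha>2)
    then show ?thesis by (simp add: power2_eq_square[of "norm (p i)"])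
  qed
  have ng: "(norm (g i))\<^sup>2 = norm (p i) * norm (q i)" for i
  proof -
    have "(norm (g i))\<^sup>2 = inverse (norm (q i) / norm (p i)) * (norm (q i))\<^sup>2"
      by (simp only: \<alpha>2[symmetric]) (simp add: g_def power_mult_distrib power_inverse)
    then show ?thesis by (simp add: power2_eq_square[of "norm (q i)"])
  qed
  have rp: "represents f g (\<lambda>(x, y). \<Sum>i. rep_L2 (f i) x * rep_L2 (g i) y)"
    by (rule represents_sums_AE) (simp_all add: nf ng sum)
  have eq: "cinner (T \<cdot> f i) (L2_cnj (g i)) = cinner (T \<cdot> p i) (L2_cnj (q i))" if "T \<in> BL2" for T i
  proof (cases "p i = 0 \<or> q i = 0")
    case True
    then have "cinner (T \<cdot> p i) (L2_cnj (q i)) = 0"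
      by auto
    moreover have "cinner (T \<cdot> f i) (L2_cnj (g i)) = 0"
      using True by (auto simp: f_def g_def \<alpha>_def)
    ultimately show ?thesis by simp
  next
    case False
    then have "\<alpha> i \<noteq> 0" by (simp add: \<alpha>_def)
    then show ?thesis
      by (simp add: f_def g_def scaleR_cscale BL2_cscale[OF that] L2_cnj_cscale cinner_scale_left cinner_scale_right)
  qed
  show ?thesis
  proof (rule that)
    show "(\<lambda>(x, y). \<Sum>i. rep_L2 (f i) x * rep_L2 (g i) y) \<in> TG" using rp by (auto simp: TG_def)
    show "(\<lambda>i. cinner (T \<cdot> p i) (L2_cnj (q i))) sums tpair T (\<lambda>(x, y). \<Sum>i. rep_L2 (f i) x * rep_L2 (g i) y)"
      if "T \<in> BL2" for T
      using tpair_sums[OF rp that] by (simp add: eq[OF that])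
  qed
qed

text \<open>Matrix coefficients as pairings. The second factor is the conjugate of v because
  \<open>tpair\<close> conjugates it once more.\<close>

lemma TG_rank_one:
  fixes u v :: "'a L2"
  obtains h where "h \<in> TG" "\<And>T. T \<in> BL2 \<Longrightarrow> tpair T h = cinner (T \<cdot> u) v"
proof -
  let ?p = "\<lambda>i::nat. if i = 0 then u else 0" and ?q = "\<lambda>i::nat. if i = 0 then L2_cnj v else 0"
  have "summable (\<lambda>i. norm (?p i) * norm (?q i))"
    by (rule summable_finite[of "{0}"]) auto
  then obtain h where h: "h \<in> TG" "\<And>T. T \<in> BL2 \<Longrightarrow> (\<lambda>i. cinner (T \<cdot> ?p i) (L2_cnj (?q i))) sums tpair T h"
    by (rule TG_of_sequences) (rule that)
  have "tpair T h = cinner (T \<cdot> u) v" if "T \<in> BL2" for T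
  proof -
    have "(\<lambda>i. cinner (T \<cdot> ?p i) (L2_cnj (?q i))) sums (\<Sum>i\<in>{0}. cinner (T \<cdot> ?p i) (L2_cnj (?q i)))"
      by (rule sums_finite) auto
    then show ?thesis using h(2)[OF that] by (auto dest: sums_unique2)
  qed
  with h(1) show ?thesis by (rule that)
qed

lemma TG_add:
  fixes h k :: "'a \<times> 'a \<Rightarrow> complex"
  assumes h: "h \<in> TG" and k: "k \<in> TG"
  shows "h + k \<in> TG" and "T \<in> BL2 \<Longrightarrow> tpair T (h + k) = tpair T h + tpair T k"
proof -
  obtain p q where 1: "represents p q h" using h by (auto simp: TG_def)
  obtain p' q' where 2: "represents p' q' k" using k by (auto simp: TG_def)
  define P where "P n = (if even n then p' (n div 2) else p ((n - 1) div 2))" for n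
  define Q where "Q n = (if even n then q' (n div 2) else q ((n - 1) div 2))" for n
  have sq: "summable (\<lambda>i. (norm (if even i then a' (i div 2) else a ((i - 1) div 2)))\<^sup>2)"
    if "summable (\<lambda>i. (norm (a i))\<^sup>2)" "summable (\<lambda>i. (norm (a' i))\<^sup>2)" for a a' :: "nat \<Rightarrow> 'a L2"
    using summable_interleave[OF that] by (rule summable_cong[THEN iffD1, rotated]) simp
  have r: "represents P Q (h + k)"
    unfolding represents_def
  proof (intro conjI)
    show "summable (\<lambda>i. (norm (P i))\<^sup>2)" "summable (\<lambda>i. (norm (Q i))\<^sup>2)"
      unfolding P_def Q_def using 1 2 by (auto intro!: sq simp: represents_def)
    have "AE (x, y) in haar \<Otimes>\<^sub>M haar. (\<lambda>i. rep_L2 (p i) x * rep_L2 (q i) y) sums h (x, y)"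
      "AE (x, y) in haar \<Otimes>\<^sub>M haar. (\<lambda>i. rep_L2 (p' i) x * rep_L2 (q' i) y) sums k (x, y)"
      using 1 2 by (auto simp: represents_def)
    then show "AE (x, y) in haar \<Otimes>\<^sub>M haar. (\<lambda>i. rep_L2 (P i) x * rep_L2 (Q i) y) sums (h + k) (x, y)"
    proof eventually_elim
      case (elim z)
      obtain x y where z: "z = (x, y)" by (cases z) auto
      have "(\<lambda>n. rep_L2 (P n) x * rep_L2 (Q n) y) =
        (\<lambda>n. if even n then rep_L2 (p' (n div 2)) x * rep_L2 (q' (n div 2)) y else rep_L2 (p ((n - 1) div 2)) x * rep_L2 (q ((n - 1) div 2)) y)"
        by (auto simp: P_def Q_def)
      then show ?case using elim sums_interleave[of "\<lambda>i. rep_L2 (p i) x * rep_L2 (q i) y" "h (x, y)" "\<lambda>i. rep_L2 (p' i) x * rep_L2 (q' i) y" "k (x, y)"]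
        by (simp add: z)
    qed
  qed
  then show "h + k \<in> TG" by (auto simp: TG_def)
  assume T: "T \<in> BL2"
  have "(\<lambda>n. cinner (T \<cdot> P n) (L2_cnj (Q n))) =
     (\<lambda>n. if even n then cinner (T \<cdot> p' (n div 2)) (L2_cnj (q' (n div 2))) else cinner (T \<cdot> p ((n - 1) div 2)) (L2_cnj (q ((n - 1) div 2))))"
    by (auto simp: P_def Q_def)
  then have "(\<lambda>n. cinner (T \<cdot> P n) (L2_cnj (Q n))) sums (tpair T h + tpair T k)"
    using sums_interleave[OF tpair_sums[OF 1 T] tpair_sums[OF 2 T]] by simp
  then show "tpair T (h + k) = tpair T h + tpair T k"
    using tpair_sums[OF r T] by (rule sums_unique2[symmetric])
qed

lemma represents_scale:
  fixes h :: "'a \<times> 'a \<Rightarrow> complex"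
  assumes 1: "represents p q h"
  shows "represents (\<lambda>i. cscale c (p i)) q (\<lambda>x. c * h x)"
    unfolding represents_def
  proof (intro conjI)
    show "summable (\<lambda>i. (norm (cscale c (p i)))\<^sup>2)"
      using 1 by (auto simp: represents_def norm_cscale power_mult_distrib intro!: summable_mult)
    show "summable (\<lambda>i. (norm (q i))\<^sup>2)" using 1 by (simp add: represents_def)
    have "AE z in haar \<Otimes>\<^sub>M (haar :: 'a measure). \<forall>i. rep_L2 (cscale c (p i)) (fst z) = c * rep_L2 (p i) (fst z)"
    proof (rule pair.AE_pair_measure)
      show "{z \<in> space (haar \<Otimes>\<^sub>M (haar :: 'a measure)). \<forall>i. rep_L2 (cscale c (p i)) (fst z) = c * rep_L2 (p i) (fst z)} \<in> sets (haar \<Otimes>\<^sub>M haar)"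
        by measurable
      have "AE x in haar. \<forall>i. rep_L2 (cscale c (p i)) x = c * rep_L2 (p i) x"
        unfolding AE_all_countable using rep_cscale by blast
      then show "AE x in haar. AE y in haar. \<forall>i. rep_L2 (cscale c (p i)) (fst (x, y)) = c * rep_L2 (p i) (fst (x, y))"
        by eventually_elim simp
    qed
    moreover have "AE (x, y) in haar \<Otimes>\<^sub>M haar. (\<lambda>i. rep_L2 (p i) x * rep_L2 (q i) y) sums h (x, y)"
      using 1 by (simp add: represents_def)
    ultimately show "AE (x, y) in haar \<Otimes>\<^sub>M haar. (\<lambda>i. rep_L2 (cscale c (p i)) x * rep_L2 (q i) y) sums (c * h (x, y))"
    proof eventually_elim
      case (elim z)
      then show ?case using sums_mult[of "\<lambda>i. rep_L2 (p i) (fst z) * rep_L2 (q i) (snd z)" "h z" c]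
        by (auto simp: split_def mult.assoc)
    qed
  qed

lemma TG_scale:
  fixes h :: "'a \<times> 'a \<Rightarrow> complex"
  assumes h: "h \<in> TG"
  shows "(\<lambda>x. c * h x) \<in> TG" and "T \<in> BL2 \<Longrightarrow> tpair T (\<lambda>x. c * h x) = c * tpair T h"
proof -
  obtain p q where 1: "represents p q h" using h by (auto simp: TG_def)
  from represents_scale[OF 1] have r: "represents (\<lambda>i. cscale c (p i)) q (\<lambda>x. c * h x)" .
  then show "(\<lambda>x. c * h x) \<in> TG" by (auto simp: TG_def)
  assume T: "T \<in> BL2"
  have "(\<lambda>i. cinner (T \<cdot> cscale c (p i)) (L2_cnj (q i))) sums (c * tpair T h)"
    using sums_mult[OF tpair_sums[OF 1 T], of c] by (simp add: BL2_cscale[OF T] cinner_scale_left)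
  then show "tpair T (\<lambda>x. c * h x) = c * tpair T h"
    using tpair_sums[OF r T] by (rule sums_unique2[symmetric])
qed

lemma TG_zero: "(\<lambda>_. 0) \<in> (TG :: ('a \<times> 'a \<Rightarrow> complex) set)" and tpair_zero: "T \<in> BL2 \<Longrightarrow> tpair T (\<lambda>_ :: 'a \<times> 'a. 0) = 0"
proof -
  obtain h :: "'a \<times> 'a \<Rightarrow> complex" where h: "h \<in> TG" using TG_rank_one by blast
  show "(\<lambda>_. 0) \<in> (TG :: ('a \<times> 'a \<Rightarrow> complex) set)" using TG_scale(1)[OF h, of 0] by simp
  show "T \<in> BL2 \<Longrightarrow> tpair T (\<lambda>_ :: 'a \<times> 'a. 0) = 0" using TG_scale(2)[OF h, of T 0] by simp
qed

lemma TG_diff: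
  fixes h k :: "'a \<times> 'a \<Rightarrow> complex"
  assumes h: "h \<in> TG" and k: "k \<in> TG"
  shows "h - k \<in> TG" and "T \<in> BL2 \<Longrightarrow> tpair T (h - k) = tpair T h - tpair T k"
proof -
  have eq: "h - k = h + (\<lambda>x. (-1) * k x)" by (auto simp: fun_eq_iff)
  show "h - k \<in> TG" unfolding eq by (rule TG_add[OF h TG_scale(1)[OF k]])
  show "T \<in> BL2 \<Longrightarrow> tpair T (h - k) = tpair T h - tpair T k"
    unfolding eq by (simp only: TG_add(2)[OF h TG_scale(1)[OF k]] TG_scale(2)[OF k]) simp
qed

lemma tpair_le_tnorm:
  fixes h :: "'a \<times> 'a \<Rightarrow> complex"
  assumes h: "h \<in> TG" and T: "T \<in> BL2"
  shows "cmod (tpair T h) \<le> norm T * tnorm h"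
proof -
  have le: "cmod (tpair T h) \<le> norm T * (\<Sum>i. norm (p i) * norm (q i))" if "represents p q h" for p q
  proof -
    have "cmod (tpair T h) \<le> (\<Sum>i. cmod (cinner (T \<cdot> p i) (L2_cnj (q i))))"
      unfolding tpair_eq[OF that T] by (rule summable_norm[OF tpair_term_summable[OF represents_summable[OF that]]])
    also have "\<dots> \<le> (\<Sum>i. norm T * (norm (p i) * norm (q i)))"
      by (rule suminf_le[OF cmod_tpair_term tpair_term_summable summable_mult]) (rule represents_summable[OF that])+
    also have "\<dots> = norm T * (\<Sum>i. norm (p i) * norm (q i))"
      by (rule suminf_mult[OF represents_summable[OF that]])
    finally show ?thesis .
  qed
  show ?thesis
  proof (cases "norm T = 0")
    case True
    obtain p q where "represents p q h" using h by (auto simp: TG_def)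
    from le[OF this] show ?thesis by (simp add: True)
  next
    case False
    have "cmod (tpair T h) / norm T \<le> tnorm h"
      unfolding tnorm_def
    proof (rule cInf_greatest)
      show "{(\<Sum>i. norm (f i) * norm (g i)) |f g. represents f g h} \<noteq> {}" using h by (auto simp: TG_def)
      fix c assume "c \<in> {(\<Sum>i. norm (f i) * norm (g i)) |f g. represents f g h}"
      then obtain p q where "represents p q h" "c = (\<Sum>i. norm (p i) * norm (q i))" by blast
      then show "cmod (tpair T h) / norm T \<le> c" using le[of p q] False by (simp add: field_simps)
    qed
    then show ?thesis using False by (simp add: field_simps)
  qed
qed

lemma tpair_plus_left:
  fixes h :: "'a \<times> 'a \<Rightarrow> complex"
  assumes h: "h \<in> TG" and S: "S \<in> BL2" and T: "T \<in> BL2"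
  shows "tpair (S + T) h = tpair S h + tpair T h"
proof -
  obtain p q where 1: "represents p q h" using h by (auto simp: TG_def)
  have "S + T \<in> BL2" using S T by (simp add: BL2_def blinfun.add_left cscale_add_right)
  from tpair_sums[OF 1 this] show ?thesis
    using sums_add[OF tpair_sums[OF 1 S] tpair_sums[OF 1 T]]
    by (simp add: blinfun.add_left cinner_add_left) (rule sums_unique2)
qed

lemma tpair_oscale:
  fixes h :: "'a \<times> 'a \<Rightarrow> complex"
  assumes h: "h \<in> TG" and T: "T \<in> BL2"
  shows "tpair (oscale c T) h = c * tpair T h"
proof -
  obtain p q where 1: "represents p q h" using h by (auto simp: TG_def)
  have "oscale c T \<in> BL2" using T by (simp add: BL2_def oscale_apply cscale_cscale mult.commute)
  from tpair_sums[OF 1 this] show ?thesis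
    using sums_mult[OF tpair_sums[OF 1 T], of c]
    by (simp add: oscale_apply cinner_scale_left) (rule sums_unique2)
qed

end

lemma summable_double:
  fixes a :: "nat \<Rightarrow> nat \<Rightarrow> real"
  assumes nn: "\<And>i l. a i l \<ge> 0" and a: "\<And>i. summable (a i)" and A: "summable (\<lambda>i. \<Sum>l. a i l)"
  shows "(\<lambda>(i, l). a i l) summable_on (UNIV \<times> UNIV)"
    and "summable (\<lambda>n. a (fst (prod_decode n)) (snd (prod_decode n)))"
proof -
  have hs: "((\<lambda>l. a i l) has_sum (\<Sum>l. a i l)) UNIV" for i
    by (rule norm_summable_imp_has_sum) (use a[of i] nn in \<open>simp_all add: summable_sums\<close>)
  show *: "(\<lambda>(i, l). a i l) summable_on (UNIV \<times> UNIV)"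
  proof (rule summable_on_SigmaI)
    show "((\<lambda>l. case (i, l) of (i, l) \<Rightarrow> a i l) has_sum (\<Sum>l. a i l)) UNIV" for i using hs by simp
    have "(\<Sum>l. a i l) \<ge> 0" for i by (rule suminf_nonneg[OF a nn])
    then show "(\<lambda>i. \<Sum>l. a i l) summable_on UNIV" using A by (subst summable_on_UNIV_nonneg_real_iff) auto
  qed (use nn in simp)
  then obtain S where "((\<lambda>(i, l). a i l) has_sum S) UNIV" by (auto simp: summable_on_def)
  then have "((\<lambda>n. case prod_decode n of (i, l) \<Rightarrow> a i l) has_sum S) UNIV"
    by (subst has_sum_reindex_bij_betw[OF bij_prod_decode])
  then have "(\<lambda>n. case prod_decode n of (i, l) \<Rightarrow> a i l) sums S" by (rule has_sum_imp_sums)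
  then show "summable (\<lambda>n. a (fst (prod_decode n)) (snd (prod_decode n)))"
    by (auto simp: summable_def split_def)
qed

text \<open>The majorant \<open>a\<close> makes the double series absolutely convergent, so it may
  be summed along \<open>prod_decode\<close>. This flattens the series of series that arises for
  \<open>theta\<close>.\<close>

lemma sums_double:
  fixes c :: "nat \<Rightarrow> nat \<Rightarrow> complex" and a :: "nat \<Rightarrow> nat \<Rightarrow> real"
  assumes bound: "\<And>i l. cmod (c i l) \<le> a i l" and a: "\<And>i. summable (a i)" and A: "summable (\<lambda>i. \<Sum>l. a i l)"
    and c: "\<And>i. c i sums C i" and C: "C sums S"
  shows "(\<lambda>n. c (fst (prod_decode n)) (snd (prod_decode n))) sums S"
proof -
  have nn: "a i l \<ge> 0" for i l using bound order_trans[OF norm_ge_zero] by blast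
  have "(\<lambda>(i, l). a i l) summable_on (UNIV \<times> UNIV)" by (rule summable_double[OF nn a A])
  then have "(\<lambda>p. norm (case p of (i, l) \<Rightarrow> c i l)) summable_on (UNIV \<times> UNIV)"
    by (rule Infinite_Sum.abs_summable_on_comparison_test') (use bound in auto)
  then have s: "(\<lambda>(i, l). c i l) summable_on (UNIV \<times> UNIV)" by (rule Infinite_Sum.abs_summable_summable)
  have sc: "summable (\<lambda>l. norm (c i l))" for i
    by (rule summable_comparison_test'[OF a[of i], of 0]) (use bound in simp)
  have hs: "((\<lambda>l. c i l) has_sum C i) UNIV" for i by (rule norm_summable_imp_has_sum[OF sc c])
  have "norm (C i) \<le> (\<Sum>l. a i l)" for i
    using summable_norm[OF sc[of i]] suminf_le[OF bound sc a, of i] c[of i] by (simp add: sums_iff)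
  then have "summable (\<lambda>i. norm (C i))" by (intro summable_comparison_test'[OF A, of 0]) auto
  then have hC: "(C has_sum S) UNIV" using C by (rule norm_summable_imp_has_sum)
  have "((\<lambda>(i, l). c i l) has_sum S) (UNIV \<times> UNIV)"
    by (rule has_sum_SigmaI[where g = C]) (use hs hC s in auto)
  then have "((\<lambda>(i, l). c i l) has_sum S) UNIV" by simp
  then have "((\<lambda>n. case prod_decode n of (i, l) \<Rightarrow> c i l) has_sum S) UNIV"
    by (subst has_sum_reindex_bij_betw[OF bij_prod_decode])
  then show ?thesis by (auto dest: has_sum_imp_sums simp: split_def)
qed

definition conj_right :: "'a::haar_group \<Rightarrow> 'a oper \<Rightarrow> 'a oper"
  where "conj_right r T = right_reg r o\<^sub>L T o\<^sub>L adj (right_reg r)"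

section \<open>Weak-* closures of spans\<close>

lemma BL2_add: "S \<in> BL2 \<Longrightarrow> T \<in> BL2 \<Longrightarrow> S + T \<in> BL2"
  by (simp add: BL2_def blinfun.add_left cscale_add_right)

lemma BL2_oscale: "T \<in> BL2 \<Longrightarrow> oscale c T \<in> BL2"
  by (simp add: BL2_def oscale_apply cscale_cscale mult.commute)

lemma BL2_zero: "0 \<in> BL2"
  by (simp add: BL2_def)

lemma BL2_compose: "S \<in> BL2 \<Longrightarrow> T \<in> BL2 \<Longrightarrow> S o\<^sub>L T \<in> BL2"
  by (simp add: BL2_def)

lemma subspace_BL2: "oper.subspace BL2"
  by (simp add: oper.subspace_def BL2_add BL2_oscale BL2_zero)

lemma topspace_weak_star: "topspace weak_star = BL2"
  by (auto simp: weak_star_def topspace_pullback_topology)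

lemma continuous_map_tpair: "h \<in> TG \<Longrightarrow> continuous_map weak_star euclidean (\<lambda>T. tpair T h)"
proof -
  assume h: "h \<in> TG"
  have "continuous_map weak_star euclidean ((\<lambda>x. x h) \<circ> (\<lambda>T. restrict (tpair T) TG))"
    unfolding weak_star_def
    by (rule continuous_map_pullback) (rule continuous_map_product_projection[OF h])
  then show ?thesis using h by (simp add: comp_def)
qed

context compact_haar
begin

lemma tpair_zero_left: "h \<in> TG \<Longrightarrow> tpair 0 (h :: 'a \<times> 'a \<Rightarrow> complex) = 0"
  using tpair_oscale[of h 0 0] BL2_zero by simp

lemma subspace_tpair_zero:
  assumes "h \<in> TG" shows "oper.subspace {X \<in> BL2. tpair X (h :: 'a \<times> 'a \<Rightarrow> complex) = 0}"
  using assms by (auto simp: oper.subspace_def BL2_add BL2_oscale BL2_zero tpair_zero_left tpair_plus_left tpair_oscale)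

text \<open>Finite-dimensional duality: the only obstruction to matching T on finitely many h is a
  combination of them vanishing on W but not at T. The induction normalises an element
  \<open>X0\<close> of W on which \<open>h0\<close> takes the value 1, subtracts its multiple from
  T, and continues in the kernel of \<open>h0\<close>.\<close>

lemma subspace_matches_on_finite:
  fixes T :: "'a oper"
  assumes "finite F" "F \<subseteq> TG" "oper.subspace W" "W \<subseteq> BL2" "T \<in> BL2"
    "\<And>h. h \<in> TG \<Longrightarrow> (\<And>X. X \<in> W \<Longrightarrow> tpair X h = 0) \<Longrightarrow> tpair T h = 0"
  shows "\<exists>X\<in>W. \<forall>h\<in>F. tpair X h = tpair T h"
  using assms
proof (induction F arbitrary: W T rule: finite_induct)
  case empty
  then show ?case using oper.subspace_0 by blast
next
  case (insert h0 F)
  have h0: "h0 \<in> TG" and F: "F \<subseteq> TG" using insert.prems(1) by auto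
  note W = insert.prems(2,3) and T = insert.prems(4)
  show ?case
  proof (cases "\<forall>X\<in>W. tpair X h0 = 0")
    case True
    then have "tpair T h0 = 0" using insert.prems(5)[OF h0] by blast
    moreover obtain X where "X \<in> W" "\<forall>h\<in>F. tpair X h = tpair T h"
      using insert.IH[OF F W T insert.prems(5)] by blast
    ultimately show ?thesis using True by auto
  next
    case False
    then obtain X1 where X1: "X1 \<in> W" "tpair X1 h0 \<noteq> 0" by blast
    define X0 where "X0 = oscale (1 / tpair X1 h0) X1"
    have X0: "X0 \<in> W" "X0 \<in> BL2" "tpair X0 h0 = 1"
      using X1 W oper.subspace_scale[OF W(1) X1(1)] tpair_oscale[OF h0, of X1] by (auto simp: X0_def)
    define W' where "W' = {X \<in> W. tpair X h0 = 0}"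
    define T' where "T' = T + oscale (- tpair T h0) X0"
    have tW: "tpair (X + oscale c X0) h = tpair X h + c * tpair X0 h" if "X \<in> BL2" "h \<in> TG" for X c h
      using that X0 by (simp add: tpair_plus_left tpair_oscale BL2_oscale)
    have "W' = W \<inter> {X \<in> BL2. tpair X h0 = 0}" using W(2) by (auto simp: W'_def)
    then have W': "oper.subspace W'" "W' \<subseteq> BL2"
      using oper.subspace_inter[OF W(1) subspace_tpair_zero[OF h0]] W(2) by auto
    have T': "T' \<in> BL2" unfolding T'_def by (intro BL2_add BL2_oscale T X0)
    have tT': "tpair T' h = tpair T h - tpair T h0 * tpair X0 h" if "h \<in> TG" for h
      unfolding T'_def tW[OF T that] by simp
    have kill: "tpair T' h = 0" if h: "h \<in> TG" and hW: "\<And>X. X \<in> W' \<Longrightarrow> tpair X h = 0" for h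
    proof -
      \<comment> \<open>This correction of h vanishes at \<open>X0\<close> and on \<open>W'\<close>,
        hence on all of W, which is spanned by them.\<close>
      let ?k = "h - (\<lambda>x. tpair X0 h * h0 x)"
      have k: "?k \<in> TG" by (rule TG_diff[OF h TG_scale(1)[OF h0]])
      have tk: "tpair X ?k = tpair X h - tpair X0 h * tpair X h0" if "X \<in> BL2" for X
        using that by (simp add: TG_diff(2)[OF h TG_scale(1)[OF h0]] TG_scale(2)[OF h0])
      have "tpair X ?k = 0" if X: "X \<in> W" for X
      proof -
        have XB: "X \<in> BL2" using X W(2) by auto
        have "tpair (X + oscale (- tpair X h0) X0) h0 = 0" unfolding tW[OF XB h0] using X0 by simp
        moreover have "X + oscale (- tpair X h0) X0 \<in> W"
          by (intro oper.subspace_add[OF W(1)] oper.subspace_scale[OF W(1)] X X0)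
        ultimately have "X + oscale (- tpair X h0) X0 \<in> W'" by (simp only: W'_def mem_Collect_eq)
        from hW[OF this] have "tpair X h = tpair X h0 * tpair X0 h" unfolding tW[OF XB h] by simp
        then show ?thesis using tk[OF XB] by simp
      qed
      then have "tpair T ?k = 0" by (rule insert.prems(5)[OF k])
      then show ?thesis using tk[OF T] tT'[OF h] by (simp add: mult.commute)
    qed
    obtain X' where X': "X' \<in> W'" "\<forall>h\<in>F. tpair X' h = tpair T' h"
      using insert.IH[OF F W' T' kill] by blast
    have X'B: "X' \<in> BL2" using X' W' by auto
    show ?thesis
    proof (intro bexI[of _ "X' + oscale (tpair T h0) X0"] ballI)
      show "X' + oscale (tpair T h0) X0 \<in> W"
        using X' X0 by (auto simp: W'_def intro: oper.subspace_add[OF W(1)] oper.subspace_scale[OF W(1)])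
      fix h assume h: "h \<in> insert h0 F"
      then have hT: "h \<in> TG" using h0 F by auto
      show "tpair (X' + oscale (tpair T h0) X0) h = tpair T h"
      proof (cases "h = h0")
        case True
        then show ?thesis using X' X0 by (simp add: W'_def tW[OF X'B h0])
      next
        case False
        then have "tpair X' h = tpair T' h" using X' h by auto
        then show ?thesis using tT'[OF hT] by (simp add: tW[OF X'B hT])
      qed
    qed
  qed
qed

text \<open>The operators annihilated by a fixed h form a closed set, which gives one direction. For
  the other, a basic neighbourhood of T restricts the pairings with finitely many h only, and some
  element of the span matches T on these.\<close>

lemma weak_star_closure_span_iff:
  fixes S :: "'a oper set"
  assumes S: "S \<subseteq> BL2"
  shows "T \<in> weak_star closure_of (oper.span S) \<longleftrightarrow>
    T \<in> BL2 \<and> (\<forall>h\<in>TG. (\<forall>X\<in>S. tpair X h = 0) \<longrightarrow> tpair T h = 0)"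
proof
  assume T: "T \<in> weak_star closure_of (oper.span S)"
  show "T \<in> BL2 \<and> (\<forall>h\<in>TG. (\<forall>X\<in>S. tpair X h = 0) \<longrightarrow> tpair T h = 0)"
  proof (intro conjI ballI impI)
    show "T \<in> BL2" using T by (auto simp: in_closure_of topspace_weak_star)
    fix h :: "'a \<times> 'a \<Rightarrow> complex" assume h: "h \<in> TG" and S0: "\<forall>X\<in>S. tpair X h = 0"
    have "oper.span S \<subseteq> {X \<in> BL2. tpair X h = 0}"
      by (rule oper.span_minimal[OF _ subspace_tpair_zero[OF h]]) (use S S0 in auto)
    moreover have "closedin weak_star {X \<in> topspace weak_star. tpair X h \<in> {0}}"
      by (rule closedin_continuous_map_preimage[OF continuous_map_tpair[OF h]]) simp
    ultimately have "weak_star closure_of (oper.span S) \<subseteq> {X \<in> BL2. tpair X h = 0}"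
      by (intro closure_of_minimal) (auto simp: topspace_weak_star)
    then show "tpair T h = 0" using T by auto
  qed
next
  assume T: "T \<in> BL2 \<and> (\<forall>h\<in>TG. (\<forall>X\<in>S. tpair X h = 0) \<longrightarrow> tpair T h = 0)"
  have sp: "oper.span S \<subseteq> BL2" by (rule oper.span_minimal[OF S subspace_BL2])
  show "T \<in> weak_star closure_of (oper.span S)"
    unfolding in_closure_of topspace_weak_star
  proof (intro conjI allI impI)
    show "T \<in> BL2" using T by simp
    fix U assume U: "T \<in> U \<and> openin weak_star U"
    then obtain O' where O': "openin (product_topology (\<lambda>_. euclidean) TG) O'" "U = (\<lambda>T. restrict (tpair T) TG) -` O' \<inter> BL2"
      by (auto simp: weak_star_def openin_pullback_topology)
    have "restrict (tpair T) TG \<in> O'" using U O' by auto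
    from bspec[OF O'(1)[unfolded openin_product_topology_alt] this] obtain N where N: "finite {h \<in> TG. N h \<noteq> topspace euclidean}"
      "restrict (tpair T) TG \<in> Pi\<^sub>E TG N" "Pi\<^sub>E TG N \<subseteq> O'"
      by (elim exE conjE) (rule that)
    obtain X where X: "X \<in> oper.span S" "\<forall>h\<in>{h \<in> TG. N h \<noteq> topspace euclidean}. tpair X h = tpair T h"
      using subspace_matches_on_finite[OF N(1) _ oper.subspace_span sp, of T] T oper.span_superset[of S] by blast
    have "restrict (tpair X) TG \<in> Pi\<^sub>E TG N"
    proof (rule PiE_I)
      fix h :: "'a \<times> 'a \<Rightarrow> complex" assume h: "h \<in> TG"
      show "restrict (tpair X) TG h \<in> N h"
      proof (cases "N h = topspace euclidean")
        case False
        then have "tpair X h = tpair T h" using X(2) h by auto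
        then show ?thesis using PiE_mem[OF N(2) h] h by simp
      qed simp
    qed simp
    then have "restrict (tpair X) TG \<in> O'" by (rule subsetD[OF N(3)])
    then show "\<exists>y. y \<in> oper.span S \<and> y \<in> U"
      using X(1) subsetD[OF sp X(1)] unfolding O'(2) by blast
  qed
qed

section \<open>The maps Theta and theta\<close>

lemma right_reg_BL2: "right_reg r \<in> (BL2 :: 'a oper set)"
  by (simp add: BL2_def right_reg_comp_op comp_op_cscale mpres_right)

lemma left_reg_BL2: "left_reg r \<in> (BL2 :: 'a oper set)"
  by (simp add: BL2_def left_reg_comp_op comp_op_cscale mpres_left)

lemma right_reg_L2_cnj: "right_reg r \<cdot> L2_cnj (v :: 'a L2) = L2_cnj (right_reg r \<cdot> v)"
  by (simp add: right_reg_comp_op comp_op_L2_cnj mpres_right)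

lemma conj_right_apply: "conj_right r T \<cdot> (u :: 'a L2) = right_reg r \<cdot> T \<cdot> right_reg (- r) \<cdot> u"
  by (simp add: conj_right_def adj_right_reg)

lemma conj_right_BL2: "(T :: 'a oper) \<in> BL2 \<Longrightarrow> conj_right r T \<in> BL2"
  unfolding conj_right_def adj_right_reg by (intro BL2_compose right_reg_BL2)

lemma norm_conj_right_le: "norm (conj_right r T \<cdot> (u :: 'a L2)) \<le> norm T * norm u"
  using norm_blinfun[of T "right_reg (- r) \<cdot> u"] by (simp only: conj_right_apply norm_right_reg)

lemma continuous_right_reg_uminus: "continuous_on UNIV (\<lambda>r. right_reg (- r) \<cdot> (u :: 'a L2))"
  by (rule continuous_on_compose2[OF continuous_right_reg]) (auto intro!: continuous_intros)

text \<open>As right translations are isometries, \<open>right_reg r \<cdot> (U r - U r0)\<close>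
  tends to 0 along with \<open>U r - U r0\<close>; strong continuity at the fixed vector
  \<open>U r0\<close> does the rest.\<close>

lemma continuous_right_reg_apply:
  fixes U :: "'a \<Rightarrow> 'a L2"
  assumes "continuous_on UNIV U"
  shows "continuous_on UNIV (\<lambda>r. right_reg r \<cdot> U r)"
proof -
  have "((\<lambda>r. right_reg r \<cdot> U r) \<longlongrightarrow> right_reg r0 \<cdot> U r0) (at r0)" for r0
  proof -
    have U: "(U \<longlongrightarrow> U r0) (at r0)" using assms by (simp add: continuous_on_eq_continuous_at isCont_def)
    have "((\<lambda>r. norm (U r - U r0)) \<longlongrightarrow> 0) (at r0)" using U by (intro tendsto_norm_zero LIM_zero)
    then have "((\<lambda>r. right_reg r \<cdot> (U r - U r0)) \<longlongrightarrow> 0) (at r0)"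
      by (rule Lim_null_comparison[rotated]) (simp add: norm_right_reg)
    moreover have "((\<lambda>r. right_reg r \<cdot> U r0) \<longlongrightarrow> right_reg r0 \<cdot> U r0) (at r0)"
      using continuous_right_reg[of "U r0"] by (simp add: continuous_on_eq_continuous_at isCont_def)
    ultimately have "((\<lambda>r. right_reg r \<cdot> (U r - U r0) + right_reg r \<cdot> U r0) \<longlongrightarrow> 0 + right_reg r0 \<cdot> U r0) (at r0)"
      by (rule tendsto_add)
    then show ?thesis by (simp add: blinfun.diff_right)
  qed
  then show ?thesis by (simp add: continuous_on_eq_continuous_at isCont_def)
qed

lemma continuous_conj_right: "continuous_on UNIV (\<lambda>r. conj_right r T \<cdot> (u :: 'a L2))"
  unfolding conj_right_apply
  by (intro continuous_right_reg_apply bounded_linear.continuous_on[OF blinfun.bounded_linear_right] continuous_right_reg_uminus)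

text \<open>Conjugating T amounts to translating both factors by - r. Hence \<open>theta f\<close>
  has to send u \<otimes> v to the integral of f(r) times the translated tensor.\<close>

lemma cinner_conj_right:
  "cinner (conj_right r T \<cdot> (u :: 'a L2)) (L2_cnj v) = cinner (T \<cdot> right_reg (- r) \<cdot> u) (L2_cnj (right_reg (- r) \<cdot> v))"
  by (simp only: conj_right_apply cinner_right_reg_left right_reg_L2_cnj)

text \<open>S is defined vector by vector as a weak integral. Its pairing formula passes from rank
  one to a representing series because the i-th integrand is at most ||T|| ||p i|| ||q i||
  |f|.\<close>

lemma Theta_exists:
  assumes f: "integrable haar f" and T: "(T :: 'a oper) \<in> BL2"
  shows "\<exists>S\<in>BL2. (\<forall>u. S \<cdot> u = wint f (\<lambda>r. conj_right r T \<cdot> u)) \<and>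
    (\<forall>h\<in>TG. tpair S h = (\<integral>r. f r * tpair (conj_right r T) h \<partial>haar))"
proof -
  define W where "W u = wint f (\<lambda>r. conj_right r T \<cdot> u)" for u
  have W: "cinner (W u) v = (\<integral>r. f r * cinner (conj_right r T \<cdot> u) v \<partial>haar)" for u v
    unfolding W_def by (rule cinner_wint[OF f continuous_conj_right])
  have bd: "cmod (cinner (conj_right r T \<cdot> u) v) \<le> norm T * norm u * norm v" for r u v
    by (rule order_trans[OF cmod_cinner_le mult_right_mono[OF norm_conj_right_le]]) simp
  have int: "integrable haar (\<lambda>r. f r * cinner (conj_right r T \<cdot> u) v)" for u v
    by (rule integrable_mult_bounded[OF f continuous_functional_measurable[OF continuous_conj_right clinear_functional_cinner] bd])
  have add: "W (u + v) = W u + W v" for u v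
    by (rule cinner_eqI) (simp add: W cinner_add_left blinfun.add_right distrib_left int)
  have scale: "W (cscale c u) = cscale c (W u)" for c u
  proof (rule cinner_eqI)
    fix h
    have "cinner (W (cscale c u)) h = (\<integral>r. c * (f r * cinner (conj_right r T \<cdot> u) h) \<partial>haar)"
      unfolding W by (simp only: BL2_cscale[OF conj_right_BL2[OF T]] cinner_scale_left mult.left_commute)
    also have "\<dots> = c * cinner (W u) h" unfolding W by (rule Bochner_Integration.integral_mult_right_zero)
    finally show "cinner (W (cscale c u)) h = cinner (cscale c (W u)) h" by (simp add: cinner_scale_left)
  qed
  have bl: "bounded_linear W"
  proof (rule bounded_linear_intro[where K = "norm T * (\<integral>r. cmod (f r) \<partial>haar)"])
    fix u show "norm (W u) \<le> norm u * (norm T * (\<integral>r. cmod (f r) \<partial>haar))"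
      using norm_wint_le[OF f continuous_conj_right norm_conj_right_le, of T u] by (simp add: W_def mult_ac)
  qed (simp_all add: add scale scaleR_cscale)
  define S where "S = Blinfun W"
  have S: "S \<cdot> u = W u" for u by (simp add: S_def bounded_linear_Blinfun_apply[OF bl])
  have SB: "S \<in> BL2" by (simp add: BL2_def S scale)
  have "tpair S h = (\<integral>r. f r * tpair (conj_right r T) h \<partial>haar)" if h: "h \<in> TG" for h
  proof -
    obtain p q where 1: "represents p q h" using h by (auto simp: TG_def)
    have "(\<lambda>i. \<integral>r. f r * cinner (conj_right r T \<cdot> p i) (L2_cnj (q i)) \<partial>haar)
       sums (\<integral>r. (\<Sum>i. f r * cinner (conj_right r T \<cdot> p i) (L2_cnj (q i))) \<partial>haar)"
    proof (rule sums_integral_dominated[OF int])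
      show "cmod (f r * cinner (conj_right r T \<cdot> p i) (L2_cnj (q i))) \<le> norm T * (norm (p i) * norm (q i)) * cmod (f r)" for r i
        using mult_left_mono[OF bd[of r "p i" "L2_cnj (q i)"], of "cmod (f r)"] by (simp add: norm_mult mult_ac)
      show "(\<integral>r. norm T * (norm (p i) * norm (q i)) * cmod (f r) \<partial>haar) \<le> norm T * (norm (p i) * norm (q i)) * (\<integral>r. cmod (f r) \<partial>haar)" for i
        by simp
      show "summable (\<lambda>i. norm T * (norm (p i) * norm (q i)) * (\<integral>r. cmod (f r) \<partial>haar))"
        by (intro summable_mult2 summable_mult represents_summable[OF 1])
    qed (use f in simp)
    moreover have "(\<Sum>i. f r * cinner (conj_right r T \<cdot> p i) (L2_cnj (q i))) = f r * tpair (conj_right r T) h" for r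
      using sums_mult[OF tpair_sums[OF 1 conj_right_BL2[OF T]]] by (rule sums_unique[symmetric])
    ultimately have "(\<lambda>i. cinner (S \<cdot> p i) (L2_cnj (q i))) sums (\<integral>r. f r * tpair (conj_right r T) h \<partial>haar)"
      by (simp add: S W)
    then show ?thesis using tpair_sums[OF 1 SB] by (rule sums_unique2[symmetric])
  qed
  then show ?thesis using SB S W_def by auto
qed

text \<open>Elements of rank one already separate operators; this gives the uniqueness in the
  description of \<open>Theta\<close>.\<close>

lemma blinfun_eq_of_tpair:
  assumes "S \<in> BL2" "T \<in> (BL2 :: 'a oper set)" "\<And>h. h \<in> TG \<Longrightarrow> tpair S h = tpair T h"
  shows "S = T"
proof (intro blinfun_eqI cinner_eqI)
  fix u v
  obtain h :: "'a \<times> 'a \<Rightarrow> complex" where "h \<in> TG" "\<And>T. T \<in> BL2 \<Longrightarrow> tpair T h = cinner (T \<cdot> u) v"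
    using TG_rank_one by blast
  then show "cinner (S \<cdot> u) v = cinner (T \<cdot> u) v" using assms by metis
qed

lemma Theta:
  assumes f: "integrable haar f" and T: "(T :: 'a oper) \<in> BL2"
  shows "Theta f T \<in> BL2" "Theta f T \<cdot> u = wint f (\<lambda>r. conj_right r T \<cdot> u)"
    "h \<in> TG \<Longrightarrow> tpair (Theta f T) h = (\<integral>r. f r * tpair (conj_right r T) h \<partial>haar)"
proof -
  obtain S where S: "S \<in> BL2" "\<And>u. S \<cdot> u = wint f (\<lambda>r. conj_right r T \<cdot> u)"
    "\<And>h. h \<in> TG \<Longrightarrow> tpair S h = (\<integral>r. f r * tpair (conj_right r T) h \<partial>haar)"
    using Theta_exists[OF f T] by blast
  have "Theta f T = S" unfolding Theta_def conj_right_def[symmetric]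
  proof (rule the_equality)
    fix S' assume "S' \<in> BL2 \<and> (\<forall>h\<in>TG. tpair S' h = (\<integral>r. f r * tpair (conj_right r T) h \<partial>haar))"
    then show "S' = S" using S by (intro blinfun_eq_of_tpair) auto
  qed (use S in blast)
  then show "Theta f T \<in> BL2" "Theta f T \<cdot> u = wint f (\<lambda>r. conj_right r T \<cdot> u)"
    "h \<in> TG \<Longrightarrow> tpair (Theta f T) h = (\<integral>r. f r * tpair (conj_right r T) h \<partial>haar)"
    using S by auto
qed

end

context compact_haar
begin

text \<open>If \<open>r \<mapsto> right_reg (- r) v\<close> decomposes as \<open>\<Sum>\<^sub>l 1\<^bsub>E\<^sub>l\<^esub> b\<^sub>l\<close> and \<open>w\<^sub>l\<close> is the integral of
  \<open>f(r) right_reg (- r) u\<close> over \<open>E\<^sub>l\<close>, then \<open>\<Sum>\<^sub>l w\<^sub>l(x) b\<^sub>l(y)\<close> is $\theta(f)(u \otimes v)$.\<close>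

lemma theta_rank_one:
  fixes u v :: "'a L2"
  assumes f: "integrable haar f"
  shows "\<exists>w b. summable (\<lambda>l::nat. norm (w l) * norm (b l)) \<and> (\<Sum>l. norm (w l) * norm (b l)) \<le> 3 * (\<integral>r. cmod (f r) \<partial>haar) * (norm u * norm v)
    \<and> (\<forall>T\<in>BL2. (\<lambda>l. cinner (T \<cdot> w l) (L2_cnj (b l))) sums (\<integral>r. f r * cinner (conj_right r T \<cdot> u) (L2_cnj v) \<partial>haar))"
proof -
  define U where "U r = right_reg (- r) \<cdot> u" for r
  define W where "W r = right_reg (- r) \<cdot> v" for r
  have cU: "continuous_on UNIV U" unfolding U_def[abs_def] by (rule continuous_right_reg_uminus)
  have cW: "continuous_on UNIV W" unfolding W_def[abs_def] by (rule continuous_right_reg_uminus)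
  have nU: "norm (U r) = norm u" for r by (simp add: U_def norm_right_reg)
  have nW: "norm (W r) \<le> norm v" for r by (simp add: W_def norm_right_reg)
  \<comment> \<open>Only the second factor is cut into steps; the first stays inside the weak
    integrals \<open>w k\<close>. The 3 of the statement is the constant of the step
    decomposition.\<close>
  obtain E :: "nat \<Rightarrow> 'a set" and b where
    E: "\<And>k. E k \<in> sets borel" and b: "\<And>r. (\<lambda>k. indicator (E k) r *\<^sub>R b k) sums W r"
    and nb: "\<And>r. (\<lambda>k. indicator (E k) r * norm (b k)) sums (\<Sum>k. indicator (E k) r * norm (b k))"
    and le: "\<And>r. (\<Sum>k. indicator (E k) r * norm (b k)) \<le> 3 * norm v"
    by (rule step_decomposition[OF cW nW]) (rule that)
  define g where "g k r = complex_of_real (indicator (E k) r) * f r" for k r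
  note swb = step_weight_bound[OF f E norm_ge_zero sums_summable[OF nb] le]
  have g: "integrable haar (g k)" for k unfolding g_def by (rule swb(1))
  have part: "(\<Sum>k<n. (\<integral>r. cmod (g k r) \<partial>haar) * norm (b k)) \<le> 3 * norm v * (\<integral>r. cmod (f r) \<partial>haar)" for n
    unfolding g_def by (rule swb(2))
  have sumg: "summable (\<lambda>k. (\<integral>r. cmod (g k r) \<partial>haar) * norm (b k))"
    by (rule summableI_nonneg_bounded[OF _ part]) simp
  define w where "w k = wint (g k) U" for k
  have nw: "norm (w k) * norm (b k) \<le> norm u * ((\<integral>r. cmod (g k r) \<partial>haar) * norm (b k))" for k
    using mult_right_mono[OF norm_wint_le[OF g[of k] cU, of "norm u"], of "norm (b k)"] nU by (simp add: w_def mult.assoc)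
  have s: "summable (\<lambda>k. norm (w k) * norm (b k))"
    by (rule summable_comparison_test'[OF summable_mult[OF sumg, of "norm u"], of 0]) (use nw in simp)
  have "(\<Sum>k. norm (w k) * norm (b k)) \<le> (\<Sum>k. norm u * ((\<integral>r. cmod (g k r) \<partial>haar) * norm (b k)))"
    by (rule suminf_le[OF nw s summable_mult[OF sumg]])
  also have "\<dots> = norm u * (\<Sum>k. (\<integral>r. cmod (g k r) \<partial>haar) * norm (b k))" by (rule suminf_mult[OF sumg])
  also have "\<dots> \<le> norm u * (3 * norm v * (\<integral>r. cmod (f r) \<partial>haar))"
    by (intro mult_left_mono suminf_le_const[OF sumg part]) simp
  finally have bound: "(\<Sum>l. norm (w l) * norm (b l)) \<le> 3 * (\<integral>r. cmod (f r) \<partial>haar) * (norm u * norm v)"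
    by (simp add: mult_ac)
  have "(\<lambda>l. cinner (T \<cdot> w l) (L2_cnj (b l))) sums (\<integral>r. f r * cinner (conj_right r T \<cdot> u) (L2_cnj v) \<partial>haar)"
    if T: "T \<in> BL2" for T
  proof -
    define t where "t l r = g l r * cinner (T \<cdot> U r) (L2_cnj (b l))" for l r
    have cl: "clinear_functional (\<lambda>x. cinner (T \<cdot> x) z)" for z
      by (rule clinear_functional_compose[OF clinear_functional_cinner T])
    have ct: "cmod (cinner (T \<cdot> U r) (L2_cnj z)) \<le> norm T * (norm u * norm z)" for r z
      using cmod_tpair_term[of T "U r" z] by (simp add: nU)
    have it: "integrable haar (t l)" for l
      unfolding t_def by (rule integrable_mult_bounded[OF g continuous_functional_measurable[OF cU cl] ct])
    have bt: "cmod (t l r) \<le> norm T * norm u * (cmod (g l r) * norm (b l))" for l r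
      using mult_left_mono[OF ct[of r "b l"], of "cmod (g l r)"] by (simp add: t_def norm_mult mult_ac)
    have "(\<lambda>l. \<integral>r. t l r \<partial>haar) sums (\<integral>r. (\<Sum>l. t l r) \<partial>haar)"
    proof (rule sums_integral_dominated[OF it bt])
      show "(\<integral>r. norm T * norm u * (cmod (g l r) * norm (b l)) \<partial>haar) \<le> norm T * norm u * ((\<integral>r. cmod (g l r) \<partial>haar) * norm (b l))" for l
        by simp
    qed (use g sumg in \<open>simp_all add: summable_mult\<close>)
    moreover have "(\<integral>r. t l r \<partial>haar) = cinner (T \<cdot> w l) (L2_cnj (b l))" for l
      unfolding t_def w_def by (rule wint[OF g cU cl, symmetric])
    moreover have "(\<Sum>l. t l r) = f r * cinner (conj_right r T \<cdot> u) (L2_cnj v)" for r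
    proof (rule sums_unique[symmetric])
      \<comment> \<open>By the symmetry of the bilinear form, \<open>b l\<close> is moved into the
        first argument, where the step series of \<open>W r\<close> can be summed by
        linearity.\<close>
      have "(\<lambda>l. cinner (indicator (E l) r *\<^sub>R b l) (L2_cnj (T \<cdot> U r))) sums cinner (W r) (L2_cnj (T \<cdot> U r))"
        by (rule bounded_linear.sums[OF bounded_linear_cinner_left b])
      from sums_mult[OF this, of "f r"]
      have "(\<lambda>l. f r * (complex_of_real (indicator (E l) r) * cinner (b l) (L2_cnj (T \<cdot> U r)))) sums (f r * cinner (W r) (L2_cnj (T \<cdot> U r)))"
        by (simp only: scaleR_cscale cinner_scale_left)
      moreover have "f r * (complex_of_real (indicator (E l) r) * cinner (b l) (L2_cnj (T \<cdot> U r))) = t l r" for l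
        unfolding t_def g_def by (simp only: cinner_cnj[of "b l"] mult_ac)
      moreover have "cinner (W r) (L2_cnj (T \<cdot> U r)) = cinner (conj_right r T \<cdot> u) (L2_cnj v)"
        unfolding cinner_conj_right U_def W_def by (rule cinner_cnj)
      ultimately show "(\<lambda>l. t l r) sums (f r * cinner (conj_right r T \<cdot> u) (L2_cnj v))" by simp
    qed
    ultimately show ?thesis by simp
  qed
  with s bound show ?thesis by blast
qed

text \<open>The rank-one solutions for all p i \<otimes> q i are put together. Their bound has the
  factor 3 ||f||_1 for every i, so the double series is absolutely summable and can be flattened
  into one pair of sequences.\<close>

lemma theta_exists:
  fixes h :: "'a \<times> 'a \<Rightarrow> complex"
  assumes f: "integrable haar f" and h: "h \<in> TG"
  shows "\<exists>k. k \<in> TG \<and> (\<forall>T\<in>BL2. tpair T k = tpair (Theta f T) h)"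
proof -
  obtain p q where pq: "represents p q h" using h by (auto simp: TG_def)
  define P where "P i w b \<longleftrightarrow> summable (\<lambda>l::nat. norm (w l) * norm (b l)) \<and> (\<Sum>l. norm (w l) * norm (b l)) \<le> 3 * (\<integral>r. cmod (f r) \<partial>haar) * (norm (p i) * norm (q i))
    \<and> (\<forall>T\<in>BL2. (\<lambda>l. cinner (T \<cdot> w l) (L2_cnj (b l))) sums (\<integral>r. f r * cinner (conj_right r T \<cdot> p i) (L2_cnj (q i)) \<partial>haar))" for i w b
  have "\<forall>i. \<exists>w b. P i w b" unfolding P_def using theta_rank_one[OF f] by blast
  then obtain w b where "\<And>i. P i (w i) (b i)" by metis
  then have s: "\<And>i. summable (\<lambda>l. norm (w i l) * norm (b i l))"
    and le: "\<And>i. (\<Sum>l. norm (w i l) * norm (b i l)) \<le> 3 * (\<integral>r. cmod (f r) \<partial>haar) * (norm (p i) * norm (q i))"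
    and sums: "\<And>i T. T \<in> BL2 \<Longrightarrow> (\<lambda>l. cinner (T \<cdot> w i l) (L2_cnj (b i l))) sums (\<integral>r. f r * cinner (conj_right r T \<cdot> p i) (L2_cnj (q i)) \<partial>haar)"
    by (simp_all add: P_def)
  let ?a = "\<lambda>i l. norm (w i l) * norm (b i l)"
  have nn: "?a i l \<ge> 0" for i l by simp
  have A: "summable (\<lambda>i. \<Sum>l. ?a i l)"
    by (rule summable_comparison_test'[OF summable_mult[OF represents_summable[OF pq], of "3 * (\<integral>r. cmod (f r) \<partial>haar)"], of 0])
      (use le suminf_nonneg[OF s nn] in simp)
  let ?d = "\<lambda>x n. x (fst (prod_decode n)) (snd (prod_decode n))"
  have "summable (\<lambda>n. norm (?d w n) * norm (?d b n))"
    using summable_double(2)[of ?a, OF nn s A] .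
  then obtain k where k: "k \<in> TG" "\<And>T. T \<in> BL2 \<Longrightarrow> (\<lambda>n. cinner (T \<cdot> ?d w n) (L2_cnj (?d b n))) sums tpair T k"
    by (rule TG_of_sequences[where p = "?d w" and q = "?d b"]) (rule that)
  have "tpair T k = tpair (Theta f T) h" if T: "T \<in> BL2" for T
  proof -
    have "(\<lambda>i. \<integral>r. f r * cinner (conj_right r T \<cdot> p i) (L2_cnj (q i)) \<partial>haar) sums tpair (Theta f T) h"
      using tpair_sums[OF pq Theta(1)[OF f T]] by (simp only: Theta(2)[OF f T] cinner_wint[OF f continuous_conj_right])
    from sums_double[where c = "\<lambda>i l. cinner (T \<cdot> w i l) (L2_cnj (b i l))" and a = "\<lambda>i l. norm T * ?a i l",
        OF cmod_tpair_term summable_mult[OF s] _ sums[OF T] this]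
    have "(\<lambda>n. cinner (T \<cdot> ?d w n) (L2_cnj (?d b n))) sums tpair (Theta f T) h"
      using summable_mult[OF A, of "norm T"] by (simp add: suminf_mult[OF s])
    with k(2)[OF T] show ?thesis by (rule sums_unique2)
  qed
  with k(1) show ?thesis by blast
qed

lemma theta:
  fixes h :: "'a \<times> 'a \<Rightarrow> complex"
  assumes f: "integrable haar f" and h: "h \<in> TG"
  shows "theta f h \<in> TG" "T \<in> BL2 \<Longrightarrow> tpair T (theta f h) = tpair (Theta f T) h"
  using someI_ex[OF theta_exists[OF assms]] by (auto simp: theta_def)

text \<open>Ensures that each \<open>theta f h\<close> belongs to \<open>Ran\<close>: as a member of
  the norm closure it is approximated by itself, with difference 0.\<close>

lemma tnorm_zero: "tnorm (\<lambda>_ :: 'a \<times> 'a. 0) \<le> 0"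
proof -
  obtain h :: "'a \<times> 'a \<Rightarrow> complex" where "h \<in> TG" using TG_zero by blast
  then obtain p q where "represents p q h" by (auto simp: TG_def)
  from represents_scale[OF this, of 0] have r: "represents (\<lambda>i. cscale 0 (p i)) q (\<lambda>_. 0)" by simp
  show ?thesis unfolding tnorm_def
  proof (rule cInf_lower)
    show "0 \<in> {(\<Sum>i. norm (f i) * norm (g i)) |f g. represents f g (\<lambda>_ :: 'a \<times> 'a. 0)}"
      using r by (intro CollectI exI[of _ "\<lambda>i. cscale 0 (p i)"] exI[of _ q]) simp
    show "bdd_below {(\<Sum>i. norm (f i) * norm (g i)) |f g. represents f g (\<lambda>_ :: 'a \<times> 'a. 0)}"
      by (rule bdd_belowI[of _ 0]) (auto intro!: suminf_nonneg represents_summable)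
  qed
qed

text \<open>The kernel of \<open>tpair T\<close> is a subspace and is closed for
  \<open>tnorm\<close>, so testing T on the generators of \<open>Ran J\<close> is enough.\<close>

lemma TG_perp_Ran_iff:
  fixes J :: "('a \<Rightarrow> complex) set"
  assumes J: "J \<subseteq> L1"
  shows "T \<in> TG_perp (Ran J) \<longleftrightarrow> T \<in> BL2 \<and> (\<forall>f\<in>J. \<forall>h\<in>TG. tpair T (theta f h) = 0)"
proof
  assume T: "T \<in> TG_perp (Ran J)"
  have "theta f h \<in> Ran J" if "f \<in> J" "h \<in> TG" for f h
    unfolding Ran_def norm_closure_def
  proof (intro CollectI conjI allI impI)
    have f: "integrable haar f" using that J by (auto simp: L1_def)
    show "theta f h \<in> TG" by (rule theta[OF f that(2)])
    fix e :: real assume e: "e > 0"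
    have "theta f h - theta f h = (\<lambda>_. 0)" by (simp add: fun_eq_iff)
    then have "tnorm (theta f h - theta f h) < e" using tnorm_zero e by simp
    then show "\<exists>y\<in>cfun.span {theta f h |f h. f \<in> J \<and> h \<in> TG}. tnorm (theta f h - y) < e"
      using that by (intro bexI[of _ "theta f h"] cfun.span_base) auto
  qed
  then show "T \<in> BL2 \<and> (\<forall>f\<in>J. \<forall>h\<in>TG. tpair T (theta f h) = 0)"
    using T by (auto simp: TG_perp_def)
next
  assume T: "T \<in> BL2 \<and> (\<forall>f\<in>J. \<forall>h\<in>TG. tpair T (theta f h) = 0)"
  have sub: "cfun.subspace {k \<in> TG. tpair T k = 0}"
    unfolding cfun.subspace_def
  proof (intro conjI ballI allI)
    show "0 \<in> {k \<in> TG. tpair T k = 0}" using T TG_zero tpair_zero by (simp add: zero_fun_def)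
  qed (use T TG_add TG_scale in auto)
  have span: "cfun.span {theta f h |f h. f \<in> J \<and> h \<in> TG} \<subseteq> {k \<in> TG. tpair T k = 0}"
    by (rule cfun.span_minimal[OF _ sub]) (use T J theta(1) in \<open>auto simp: L1_def\<close>)
  have "tpair T k = 0" if k: "k \<in> Ran J" for k
  proof -
    have kT: "k \<in> TG" using k by (simp add: Ran_def norm_closure_def)
    have "cmod (tpair T k) \<le> 0 + e" if e: "e > 0" for e
    proof -
      \<comment> \<open>Adding 1 avoids a division by 0 when T = 0.\<close>
      have "e / (norm T + 1) > 0" using e by (simp add: add_nonneg_pos)
      then obtain y where y: "y \<in> cfun.span {theta f h |f h. f \<in> J \<and> h \<in> TG}" "tnorm (k - y) < e / (norm T + 1)"
        using k by (auto simp: Ran_def norm_closure_def)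
      then have yT: "y \<in> TG" "tpair T y = 0" using span by auto
      have "cmod (tpair T k) = cmod (tpair T (k - y))" using T yT by (simp add: TG_diff[OF kT])
      also have "\<dots> \<le> norm T * tnorm (k - y)" using T by (intro tpair_le_tnorm TG_diff kT yT) auto
      also have "\<dots> \<le> norm T * (e / (norm T + 1))" using y by (intro mult_left_mono) auto
      also have "\<dots> \<le> e" using e add_nonneg_pos[OF norm_ge_zero[of T] zero_less_one]
        by (simp add: pos_divide_le_eq ring_distribs)
      finally show ?thesis by simp
    qed
    then have "cmod (tpair T k) \<le> 0" by (rule field_le_epsilon)
    then show ?thesis by simp
  qed
  then show "T \<in> TG_perp (Ran J)" using T by (simp add: TG_perp_def)
qed

end

section \<open>Multiplication operators\<close>

lemma bounded_mult_sq_integrable: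
  assumes a: "a \<in> borel_measurable haar" "\<And>x. cmod (a x) \<le> C" and f: "sq_integrable f"
  shows "sq_integrable (\<lambda>x. a x * f x)"
  unfolding sq_integrable_def
proof
  have m: "f \<in> borel_measurable haar" using f by (simp add: sq_integrable_def)
  show "(\<lambda>x. a x * f x) \<in> borel_measurable haar" using a m by simp
  show "integrable haar (\<lambda>x. (cmod (a x * f x))\<^sup>2)"
  proof (rule Bochner_Integration.integrable_bound)
    show "integrable haar (\<lambda>x. C\<^sup>2 * (cmod (f x))\<^sup>2)" using f by (simp add: sq_integrable_def)
    show "(\<lambda>x. (cmod (a x * f x))\<^sup>2) \<in> borel_measurable haar" using a m by simp
    show "AE x in haar. norm ((cmod (a x * f x))\<^sup>2) \<le> norm (C\<^sup>2 * (cmod (f x))\<^sup>2)"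
      using power_mono[OF a(2) norm_ge_zero, of _ 2]
      by (intro AE_I2) (simp add: norm_mult power_mult_distrib mult_right_mono)
  qed
qed

text \<open>The bound holds at every point. An essentially bounded function is replaced by such a
  representative later, which keeps null sets out of the estimates and of the translates.\<close>

locale bounded_function =
  fixes a :: "'a::haar_group \<Rightarrow> complex" and C :: real
  assumes measurable_a: "a \<in> borel_measurable haar" and bound_a: "cmod (a x) \<le> C"
begin

lemma C_nonneg: "C \<ge> 0"
  using order_trans[OF norm_ge_zero bound_a] .

lemma rep_mult: "AE x in haar. rep_L2 (abs_L2 (\<lambda>x. a x * rep_L2 f x)) x = a x * rep_L2 f x"
  by (rule rep_abs_L2[OF bounded_mult_sq_integrable[OF measurable_a bound_a sq_integrable_rep]])

lemma mult_op_apply: "mult_op a \<cdot> f = abs_L2 (\<lambda>x. a x * rep_L2 f x)"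
proof -
  have "bounded_linear (\<lambda>f. abs_L2 (\<lambda>x. a x * rep_L2 f x))"
  proof (rule bounded_linear_intro[where K = C])
    fix f g :: "'a L2" and r :: real
    show "abs_L2 (\<lambda>x. a x * rep_L2 (f + g) x) = abs_L2 (\<lambda>x. a x * rep_L2 f x) + abs_L2 (\<lambda>x. a x * rep_L2 g x)"
      by (rule L2_eqI) (use rep_mult[of f] rep_mult[of g] rep_mult[of "f + g"] rep_plus[of f g]
        rep_plus[of "abs_L2 (\<lambda>x. a x * rep_L2 f x)" "abs_L2 (\<lambda>x. a x * rep_L2 g x)"]
        in \<open>eventually_elim, simp add: distrib_left\<close>)
    show "abs_L2 (\<lambda>x. a x * rep_L2 (r *\<^sub>R f) x) = r *\<^sub>R abs_L2 (\<lambda>x. a x * rep_L2 f x)"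
      unfolding scaleR_cscale
      by (rule L2_eqI) (use rep_mult[of f] rep_mult[of "cscale r f"] rep_cscale[of r f]
        rep_cscale[of r "abs_L2 (\<lambda>x. a x * rep_L2 f x)"]
        in \<open>eventually_elim, simp\<close>)
    have "(norm (abs_L2 (\<lambda>x. a x * rep_L2 f x)))\<^sup>2 = (\<integral>x. (cmod (a x * rep_L2 f x))\<^sup>2 \<partial>haar)"
      by (rule norm_sq_abs_L2[OF bounded_mult_sq_integrable[OF measurable_a bound_a sq_integrable_rep]])
    also have "\<dots> \<le> (\<integral>x. C\<^sup>2 * (cmod (rep_L2 f x))\<^sup>2 \<partial>haar)"
    proof (rule integral_mono)
      show "integrable haar (\<lambda>x. (cmod (a x * rep_L2 f x))\<^sup>2)"
        using bounded_mult_sq_integrable[OF measurable_a bound_a sq_integrable_rep[of f]] by (simp add: sq_integrable_def)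
      show "integrable haar (\<lambda>x. C\<^sup>2 * (cmod (rep_L2 f x))\<^sup>2)" using sq_integrable_rep[of f] by (simp add: sq_integrable_def)
      show "(cmod (a x * rep_L2 f x))\<^sup>2 \<le> C\<^sup>2 * (cmod (rep_L2 f x))\<^sup>2" for x
        using power_mono[OF bound_a norm_ge_zero, of x 2] by (simp add: norm_mult power_mult_distrib mult_right_mono)
    qed
    also have "\<dots> = (C * norm f)\<^sup>2" by (simp add: norm_sq_L2 power_mult_distrib)
    finally show "norm (abs_L2 (\<lambda>x. a x * rep_L2 f x)) \<le> norm f * C"
      using C_nonneg by (simp add: power2_le_iff_abs_le mult.commute)
  qed
  then show ?thesis by (simp add: mult_op_def bounded_linear_Blinfun_apply)
qed

lemma rep_mult_op: "AE x in haar. rep_L2 (mult_op a \<cdot> f) x = a x * rep_L2 f x"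
  unfolding mult_op_apply by (rule rep_mult)

lemma mult_op_BL2: "mult_op a \<in> BL2"
  unfolding BL2_def
proof (intro CollectI allI)
  fix c and f :: "'a L2"
  show "mult_op a \<cdot> cscale c f = cscale c (mult_op a \<cdot> f)"
    by (rule L2_eqI) (use rep_mult_op[of f] rep_mult_op[of "cscale c f"] rep_cscale[of c f] rep_cscale[of c "mult_op a \<cdot> f"]
      in \<open>eventually_elim, simp\<close>)
qed

lemma cinner_mult_op: "cinner (mult_op a \<cdot> u) v = (\<integral>x. a x * (rep_L2 u x * cnj (rep_L2 v x)) \<partial>haar)"
  unfolding cinner_rep
proof (rule integral_cong_AE)
  show "AE x in haar. rep_L2 (mult_op a \<cdot> u) x * cnj (rep_L2 v x) = a x * (rep_L2 u x * cnj (rep_L2 v x))"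
    using rep_mult_op[of u] by eventually_elim simp
qed (use measurable_a in measurable)

end

text \<open>Equality almost everywhere must first transfer square integrability from b f to a f,
  since \<open>abs_L2\<close> is meaningful on square integrable functions only.\<close>

lemma mult_op_cong_AE:
  assumes a: "a \<in> borel_measurable haar" and b: "bounded_function b C" and ab: "AE x in haar. a x = b x"
  shows "mult_op a = mult_op b"
proof -
  interpret bounded_function b C by (rule b)
  have "abs_L2 (\<lambda>x. a x * rep_L2 f x) = abs_L2 (\<lambda>x. b x * rep_L2 f x)" for f
  proof -
    have sb: "sq_integrable (\<lambda>x. b x * rep_L2 f x)"
      by (rule bounded_mult_sq_integrable[OF measurable_a bound_a sq_integrable_rep])
    have ae: "AE x in haar. a x * rep_L2 f x = b x * rep_L2 f x" using ab by eventually_elim simp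
    have "integrable haar (\<lambda>x. (cmod (a x * rep_L2 f x))\<^sup>2) \<longleftrightarrow> integrable haar (\<lambda>x. (cmod (b x * rep_L2 f x))\<^sup>2)"
    proof (rule integrable_cong_AE)
      show "AE x in haar. (cmod (a x * rep_L2 f x))\<^sup>2 = (cmod (b x * rep_L2 f x))\<^sup>2" using ae by eventually_elim (simp only:)
    qed (use a measurable_a in measurable)
    then have "sq_integrable (\<lambda>x. a x * rep_L2 f x)" using sb a by (simp add: sq_integrable_def)
    then show ?thesis by (rule abs_L2_eqI[OF _ sb ae])
  qed
  then show ?thesis by (simp add: mult_op_def)
qed

lemma L1_perp_bounded_version:
  assumes a: "a \<in> L1_perp J" and J: "J \<subseteq> L1"
  obtains b C where "bounded_function b C" "b \<in> L1_perp J" "mult_op a = mult_op b"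
proof -
  from a obtain C where am: "a \<in> borel_measurable haar" and C: "AE x in haar. cmod (a x) \<le> C"
    by (auto simp: L1_perp_def Linf_def)
  define b where "b x = (if cmod (a x) \<le> C then a x else 0)" for x
  have bm: "b \<in> borel_measurable haar" unfolding b_def[abs_def] using am by measurable
  \<comment> \<open>Where |a| exceeds C the value is 0, so the bound has to be nonnegative.\<close>
  have bb: "bounded_function b (max 0 C)"
    by unfold_locales (use bm in \<open>auto simp: b_def\<close>)
  have ab: "AE x in haar. a x = b x" using C by eventually_elim (simp add: b_def)
  have "(\<integral>x. b x * f x \<partial>haar) = 0" if f: "f \<in> J" for f
  proof -
    have fm: "f \<in> borel_measurable haar" using f J by (auto simp: L1_def)
    have "(\<integral>x. b x * f x \<partial>haar) = (\<integral>x. a x * f x \<partial>haar)"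
    proof (rule integral_cong_AE)
      show "AE x in haar. b x * f x = a x * f x" using ab by eventually_elim simp
    qed (use am bm fm in measurable)
    then show ?thesis using a f by (simp add: L1_perp_def)
  qed
  moreover have "b \<in> Linf"
    using bm bounded_function.bound_a[OF bb] by (auto simp: Linf_def)
  ultimately have "b \<in> L1_perp J" by (simp add: L1_perp_def)
  then show ?thesis using that bb mult_op_cong_AE[OF am bb ab] by blast
qed

section \<open>The bimodule annihilates the range\<close>

context compact_haar
begin

lemma wint_apply:
  assumes f: "integrable haar f" and U: "continuous_on UNIV U" and A: "(A :: 'a oper) \<in> BL2"
  shows "A \<cdot> wint f U = wint f (\<lambda>r. A \<cdot> U r)"
proof (rule cinner_eqI)
  fix v
  have cA: "continuous_on UNIV (\<lambda>r. A \<cdot> U r)"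
    by (rule bounded_linear.continuous_on[OF blinfun.bounded_linear_right U])
  show "cinner (A \<cdot> wint f U) v = cinner (wint f (\<lambda>r. A \<cdot> U r)) v"
    unfolding cinner_wint[OF f cA]
    by (rule wint[OF f U clinear_functional_compose[OF clinear_functional_cinner A]])
qed

lemma VN_BL2: "VN \<subseteq> (BL2 :: 'a oper set)"
  unfolding VN_def using closure_of_subset_topspace[of weak_star] by (auto simp: topspace_weak_star)

lemma left_reg_VN: "left_reg s \<in> (VN :: 'a oper set)"
  unfolding VN_def
  by (subst weak_star_closure_span_iff) (auto simp: left_reg_BL2)

text \<open>Pairing T with \<open>h1 - h2\<close> gives a coefficient of the commutator of T and
  \<open>right_reg r\<close>. It vanishes for left translations and therefore on the weak-* closure
  of their span.\<close>

lemma VN_commutes_right_reg: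
  assumes A: "(A :: 'a oper) \<in> VN"
  shows "A \<cdot> right_reg r \<cdot> u = right_reg r \<cdot> A \<cdot> u"
proof (rule cinner_eqI)
  fix v
  obtain h1 :: "'a \<times> 'a \<Rightarrow> complex" where h1: "h1 \<in> TG" "\<And>T. T \<in> BL2 \<Longrightarrow> tpair T h1 = cinner (T \<cdot> right_reg r \<cdot> u) v"
    by (rule TG_rank_one[of "right_reg r \<cdot> u" v]) (rule that)
  obtain h2 :: "'a \<times> 'a \<Rightarrow> complex" where h2: "h2 \<in> TG" "\<And>T. T \<in> BL2 \<Longrightarrow> tpair T h2 = cinner (T \<cdot> u) (right_reg (- r) \<cdot> v)"
    by (rule TG_rank_one[of u "right_reg (- r) \<cdot> v"]) (rule that)
  have t: "tpair T (h1 - h2) = cinner (T \<cdot> right_reg r \<cdot> u) v - cinner (right_reg r \<cdot> T \<cdot> u) v"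
    if "T \<in> BL2" for T
    using that by (simp add: TG_diff[OF h1(1) h2(1)] h1(2) h2(2) cinner_right_reg_left)
  have "tpair X (h1 - h2) = 0" if "X \<in> range left_reg" for X
    using that t left_reg_BL2 by (auto simp: left_right_commute)
  then have "tpair A (h1 - h2) = 0"
    using A TG_diff(1)[OF h1(1) h2(1)] weak_star_closure_span_iff[of "range left_reg" A] left_reg_BL2
    by (auto simp: VN_def)
  then show "cinner (A \<cdot> right_reg r \<cdot> u) v = cinner (right_reg r \<cdot> A \<cdot> u) v"
    using t[of A] A VN_BL2 by auto
qed

text \<open>Pairing \<open>a\<close> with \<open>convol g f\<close>, where \<open>g\<close> is the conjugate of the function in question, gives its
  \<open>L\<^sup>2\<close> norm; no invariance of \<open>J\<close> under left translations is needed.\<close>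

lemma left_ideal_perp_translate:
  fixes J :: "('a \<Rightarrow> complex) set"
  assumes J: "closed_left_ideal J" and f: "f \<in> J" and a: "a \<in> L1_perp J" and b: "bounded_function a C"
  shows "AE s in haar. (\<integral>r. f r * a (s + r) \<partial>haar) = 0"
proof -
  interpret bounded_function a C by (rule b)
  have fi: "integrable haar f" using J f by (auto simp: closed_left_ideal_def L1_def)
  have [measurable]: "f \<in> borel_measurable haar" "a \<in> borel_measurable haar"
    using fi measurable_a by auto
  define H where "H s = (\<integral>r. f r * a (s + r) \<partial>haar)" for s
  have Hm [measurable]: "H \<in> borel_measurable haar"
    unfolding H_def[abs_def] by (rule borel_measurable_lebesgue_integral) measurable
  have Hb: "cmod (H s) \<le> C * (\<integral>r. cmod (f r) \<partial>haar)" for s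
  proof -
    have "cmod (H s) \<le> (\<integral>r. cmod (f r * a (s + r)) \<partial>haar)" unfolding H_def by (rule integral_norm_bound)
    also have "\<dots> \<le> (\<integral>r. C * cmod (f r) \<partial>haar)"
    proof (rule integral_mono')
      fix r show "cmod (f r * a (s + r)) \<le> C * cmod (f r)"
        using mult_left_mono[OF bound_a, of "cmod (f r)" "s + r"] by (simp add: norm_mult mult.commute)
    qed (use fi C_nonneg in auto)
    finally show ?thesis by simp
  qed
  define g where "g s = cnj (H s)" for s
  have gb: "cmod (g s) \<le> C * (\<integral>r. cmod (f r) \<partial>haar)" for s using Hb by (simp add: g_def)
  have [measurable]: "g \<in> borel_measurable haar" unfolding g_def[abs_def] by measurable
  have gi: "integrable haar g"
    by (rule integrable_const_bound[of _ "C * (\<integral>r. cmod (f r) \<partial>haar)"]) (use gb in auto)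
  then have "convol g f \<in> J" using J f by (auto simp: closed_left_ideal_def L1_def)
  then have "0 = (\<integral>t. a t * convol g f t \<partial>haar)" using a by (simp add: L1_perp_def)
  also have "\<dots> = (\<integral>t. \<integral>s. g s * (f (- s + t) * a t) \<partial>haar \<partial>haar)"
  proof (rule Bochner_Integration.integral_cong[OF refl])
    fix t
    have "a t * convol g f t = (\<integral>s. a t * (g s * f (- s + t)) \<partial>haar)"
      unfolding convol_def by (rule Bochner_Integration.integral_mult_right_zero[symmetric])
    then show "a t * convol g f t = (\<integral>s. g s * (f (- s + t) * a t) \<partial>haar)" by (simp add: mult_ac)
  qed
  also have "\<dots> = (\<integral>s. \<integral>t. g s * (f (- s + t) * a t) \<partial>haar \<partial>haar)"
  proof -
    define K where "K p = g (fst p) * (f (- fst p + snd p) * a (snd p))" for p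
    have fs: "integrable haar (\<lambda>t. f (- s + t))" for s by (rule mpres_integrable[OF mpres_left fi])
    have i: "integrable haar (\<lambda>t. f (- s + t) * a t)" for s
      by (rule integrable_mult_bounded[OF fs measurable_a bound_a])
    have "(\<integral>s. \<integral>t. K (s, t) \<partial>haar \<partial>haar) = (\<integral>t. \<integral>s. K (s, t) \<partial>haar \<partial>haar)"
    proof (rule fubini_swap(2)[where C = "\<lambda>s. cmod (g s) * (C * (\<integral>r. cmod (f r) \<partial>haar))"])
      show "K \<in> borel_measurable (haar \<Otimes>\<^sub>M haar)" unfolding K_def[abs_def] by measurable
      show "integrable haar (\<lambda>x. K (s, x))" for s unfolding K_def using i[of s] by simp
      show "integrable haar (\<lambda>s. cmod (g s) * (C * (\<integral>r. cmod (f r) \<partial>haar)))" using gi by simp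
      fix s
      have "(\<integral>t. cmod (K (s, t)) \<partial>haar) \<le> (\<integral>t. cmod (g s) * (C * cmod (f (- s + t))) \<partial>haar)"
      proof (rule integral_mono')
        fix t show "cmod (K (s, t)) \<le> cmod (g s) * (C * cmod (f (- s + t)))"
          unfolding K_def norm_mult fst_conv snd_conv
          using mult_left_mono[OF bound_a[of t], of "cmod (f (- s + t))"] by (intro mult_left_mono) (auto simp: mult.commute)
      qed (use fs[of s] C_nonneg in auto)
      also have "\<dots> = cmod (g s) * (C * (\<integral>t. cmod (f (- s + t)) \<partial>haar))" by simp
      also have "(\<integral>t. cmod (f (- s + t)) \<partial>haar) = (\<integral>t. cmod (f t) \<partial>haar)"
        by (rule mpres_integral[OF mpres_left]) measurable
      finally show "(\<integral>t. cmod (K (s, t)) \<partial>haar) \<le> cmod (g s) * (C * (\<integral>r. cmod (f r) \<partial>haar))" .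
    qed
    then show ?thesis by (simp add: K_def)
  qed
  \<comment> \<open>Under t = s + r the integral of f (- s + t) a t becomes H s, and its product
    with g s is |H s|^2.\<close>
  also have "\<dots> = (\<integral>s. complex_of_real ((cmod (H s))\<^sup>2) \<partial>haar)"
  proof (rule Bochner_Integration.integral_cong[OF refl])
    fix s
    have "(\<integral>t. g s * (f (- s + t) * a t) \<partial>haar) = g s * (\<integral>t. f (- s + t) * a t \<partial>haar)"
      by (rule Bochner_Integration.integral_mult_right_zero)
    also have "(\<integral>t. f (- s + t) * a t \<partial>haar) = (\<integral>r. f (- s + (s + r)) * a (s + r) \<partial>haar)"
      by (rule mpres_integral[OF mpres_left, symmetric]) measurable
    also have "\<dots> = H s" by (simp add: H_def add.assoc[symmetric])
    finally show "(\<integral>t. g s * (f (- s + t) * a t) \<partial>haar) = complex_of_real ((cmod (H s))\<^sup>2)"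
      unfolding g_def complex_norm_square by (simp only: mult.commute)
  qed
  also have "\<dots> = complex_of_real (\<integral>s. (cmod (H s))\<^sup>2 \<partial>haar)" by (rule integral_complex_of_real)
  finally have "(\<integral>s. (cmod (H s))\<^sup>2 \<partial>haar) = 0" by simp
  moreover have "integrable haar (\<lambda>s. (cmod (H s))\<^sup>2)"
    using sq_integrable_bounded[OF Hm Hb] by (simp add: sq_integrable_def)
  ultimately have "AE s in haar. (cmod (H s))\<^sup>2 = 0"
    by (subst (asm) integral_nonneg_eq_0_iff_AE) auto
  then show ?thesis by eventually_elim (simp add: H_def)
qed

lemma conj_right_mult_op:
  assumes "bounded_function a C"
  shows "bounded_function (\<lambda>x. a (x + r)) C" "conj_right r (mult_op a) = mult_op (\<lambda>x :: 'a. a (x + r))"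
proof -
  interpret bounded_function a C by fact
  show b: "bounded_function (\<lambda>x. a (x + r)) C"
    by unfold_locales (rule measurable_compose[OF mpres_measurable[OF mpres_right] measurable_a], rule bound_a)
  interpret b: bounded_function "\<lambda>x. a (x + r)" C by (rule b)
  show "conj_right r (mult_op a) = mult_op (\<lambda>x. a (x + r))"
  proof (intro blinfun_eqI L2_eqI)
    fix u
    let ?u = "right_reg (- r) \<cdot> u"
    have 1: "AE x in haar. rep_L2 (mult_op a \<cdot> ?u) (x + r) = a (x + r) * rep_L2 ?u (x + r)"
      by (rule mpres_AE[OF mpres_right rep_mult_op])
    have 2: "AE x in haar. rep_L2 ?u (x + r) = rep_L2 u (x + r + (- r))"
      by (rule mpres_AE[OF mpres_right rep_right_reg])
    show "AE x in haar. rep_L2 (conj_right r (mult_op a) \<cdot> u) x = rep_L2 (mult_op (\<lambda>x. a (x + r)) \<cdot> u) x"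
      using 1 2 rep_right_reg[of r "mult_op a \<cdot> ?u"] b.rep_mult_op[of u]
      unfolding conj_right_apply by eventually_elim (simp add: add.assoc)
  qed
qed

text \<open>With w the product of u and the conjugate of v, Fubini turns the coefficient into the
  integral over x of w(x) times the integral of f(r) a(x + r) over r, and the latter is 0 for almost
  every x.\<close>

lemma Theta_mult_op_zero:
  fixes J :: "('a \<Rightarrow> complex) set"
  assumes J: "closed_left_ideal J" and f: "f \<in> J" and a: "a \<in> L1_perp J" and b: "bounded_function a C"
  shows "Theta f (mult_op a) = 0"
proof (intro blinfun_eqI cinner_eqI)
  fix u v :: "'a L2"
  interpret bounded_function a C by (rule b)
  have fi: "integrable haar f" using J f by (auto simp: closed_left_ideal_def L1_def)
  have [measurable]: "f \<in> borel_measurable haar" "a \<in> borel_measurable haar"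
    using fi measurable_a by auto
  define w where "w x = rep_L2 u x * cnj (rep_L2 v x)" for x
  have wi: "integrable haar w" unfolding w_def by (rule sq_integrable_mult[OF sq_integrable_rep sq_integrable_rep])
  have [measurable]: "w \<in> borel_measurable haar" using wi by auto
  define K where "K p = f (fst p) * (w (snd p) * a (snd p + fst p))" for p
  have ba: "cmod (a (x + r)) \<le> C" for x r by (rule bound_a)
  have iw: "integrable haar (\<lambda>x. w x * a (x + r))" for r
    by (rule integrable_mult_bounded[OF wi _ ba]) measurable
  have "cinner (Theta f (mult_op a) \<cdot> u) v = (\<integral>r. f r * cinner (mult_op (\<lambda>x. a (x + r)) \<cdot> u) v \<partial>haar)"
    unfolding Theta(2)[OF fi mult_op_BL2] cinner_wint[OF fi continuous_conj_right] by (simp only: conj_right_mult_op(2)[OF b])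
  also have "\<dots> = (\<integral>r. \<integral>x. K (r, x) \<partial>haar \<partial>haar)"
  proof (rule Bochner_Integration.integral_cong[OF refl])
    fix r
    have "cinner (mult_op (\<lambda>x. a (x + r)) \<cdot> u) v = (\<integral>x. w x * a (x + r) \<partial>haar)"
      unfolding bounded_function.cinner_mult_op[OF conj_right_mult_op(1)[OF b]] w_def by (simp add: mult.commute)
    then show "f r * cinner (mult_op (\<lambda>x. a (x + r)) \<cdot> u) v = (\<integral>x. K (r, x) \<partial>haar)"
      using iw[of r] by (simp add: K_def)
  qed
  also have "\<dots> = (\<integral>x. \<integral>r. K (r, x) \<partial>haar \<partial>haar)"
  proof (rule fubini_swap(2)[where C = "\<lambda>r. cmod (f r) * (C * (\<integral>x. cmod (w x) \<partial>haar))"])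
    show "K \<in> borel_measurable (haar \<Otimes>\<^sub>M haar)" unfolding K_def[abs_def] by measurable
    show "integrable haar (\<lambda>x. K (r, x))" for r unfolding K_def using iw[of r] by simp
    show "integrable haar (\<lambda>r. cmod (f r) * (C * (\<integral>x. cmod (w x) \<partial>haar)))" using fi by simp
    fix r
    have "(\<integral>x. cmod (K (r, x)) \<partial>haar) \<le> (\<integral>x. cmod (f r) * (C * cmod (w x)) \<partial>haar)"
    proof (rule integral_mono')
      fix x show "cmod (K (r, x)) \<le> cmod (f r) * (C * cmod (w x))"
        unfolding K_def norm_mult fst_conv snd_conv
        using mult_left_mono[OF ba[of x r], of "cmod (w x)"] by (intro mult_left_mono) (auto simp: mult.commute)
    qed (use wi C_nonneg in auto)
    then show "(\<integral>x. cmod (K (r, x)) \<partial>haar) \<le> cmod (f r) * (C * (\<integral>x. cmod (w x) \<partial>haar))" by simp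
  qed
  also have "\<dots> = (\<integral>x. 0 \<partial>(haar :: 'a measure))"
  proof (rule integral_cong_AE)
    show "AE x in haar. (\<integral>r. K (r, x) \<partial>haar) = 0"
      using left_ideal_perp_translate[OF J f a b]
    proof eventually_elim
      case (elim x)
      have "(\<integral>r. K (r, x) \<partial>haar) = (\<integral>r. w x * (f r * a (x + r)) \<partial>haar)" by (simp add: K_def mult_ac)
      also have "\<dots> = w x * (\<integral>r. f r * a (x + r) \<partial>haar)" by (rule Bochner_Integration.integral_mult_right_zero)
      finally show ?case by (simp add: elim)
    qed
    show "(\<lambda>x. \<integral>r. K (r, x) \<partial>haar) \<in> borel_measurable haar"
      unfolding K_def[abs_def] fst_conv snd_conv by (rule borel_measurable_lebesgue_integral) measurable
  qed simp
  finally show "cinner (Theta f (mult_op a) \<cdot> u) v = cinner (0 \<cdot> u) v" by simp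
qed

lemma Theta_bimodule_zero:
  fixes J :: "('a \<Rightarrow> complex) set"
  assumes J: "closed_left_ideal J" and f: "f \<in> J" and a: "a \<in> L1_perp J" and b: "bounded_function a C"
    and A: "A \<in> VN" and B: "B \<in> VN"
  shows "Theta f (A o\<^sub>L mult_op a o\<^sub>L B) = 0"
proof (rule blinfun_eqI)
  fix u
  interpret bounded_function a C by (rule b)
  have fi: "integrable haar f" using J f by (auto simp: closed_left_ideal_def L1_def)
  have AB: "A \<in> BL2" "B \<in> BL2" using A B VN_BL2 by auto
  have "conj_right r (A o\<^sub>L mult_op a o\<^sub>L B) = A o\<^sub>L conj_right r (mult_op a) o\<^sub>L B" for r
    by (rule blinfun_eqI) (simp add: conj_right_apply VN_commutes_right_reg[OF A] VN_commutes_right_reg[OF B])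
  then have "Theta f (A o\<^sub>L mult_op a o\<^sub>L B) \<cdot> u
      = wint f (\<lambda>r. A \<cdot> conj_right r (mult_op a) \<cdot> B \<cdot> u)"
    using Theta(2)[OF fi, of "A o\<^sub>L mult_op a o\<^sub>L B" u] AB mult_op_BL2 by (simp add: BL2_compose)
  also have "\<dots> = A \<cdot> Theta f (mult_op a) \<cdot> B \<cdot> u"
    unfolding Theta(2)[OF fi mult_op_BL2] by (rule wint_apply[OF fi continuous_conj_right AB(1), symmetric])
  finally show "Theta f (A o\<^sub>L mult_op a o\<^sub>L B) \<cdot> u = 0 \<cdot> u"
    by (simp add: Theta_mult_op_zero[OF J f a b])
qed

lemma mult_op_L1_perp_BL2:
  fixes J :: "('a \<Rightarrow> complex) set"
  assumes "closed_left_ideal J" "a \<in> L1_perp J" shows "mult_op a \<in> BL2"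
proof -
  have J: "J \<subseteq> L1" using assms by (simp add: closed_left_ideal_def)
  obtain b C where b: "bounded_function b C" "b \<in> L1_perp J" "mult_op a = mult_op b"
    by (rule L1_perp_bounded_version[OF assms(2) J]) (rule that)
  then show ?thesis using bounded_function.mult_op_BL2 by metis
qed

lemma bimodule_generators_BL2:
  fixes J :: "('a \<Rightarrow> complex) set"
  assumes "closed_left_ideal J"
  shows "{A o\<^sub>L mult_op a o\<^sub>L B | A a B. A \<in> VN \<and> B \<in> VN \<and> a \<in> L1_perp J} \<subseteq> BL2"
  using VN_BL2 mult_op_L1_perp_BL2[OF assms] by (auto intro!: BL2_compose)

text \<open>The functions \<open>theta f h\<close> serve as test elements in the closure criterion:
  each generator X satisfies \<open>tpair X (theta f h) = tpair (Theta f X) h = 0\<close>.\<close>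

lemma Bim_subset_TG_perp_Ran:
  fixes J :: "('a \<Rightarrow> complex) set"
  assumes J: "closed_left_ideal J"
  shows "Bim (L1_perp J) \<subseteq> TG_perp (Ran J)"
proof
  have J1: "J \<subseteq> L1" using J by (simp add: closed_left_ideal_def)
  fix T assume T: "T \<in> Bim (L1_perp J)"
  then have TB: "T \<in> BL2" and kill: "\<And>h. h \<in> TG \<Longrightarrow> (\<And>(A :: 'a oper) a (B :: 'a oper). A \<in> VN \<Longrightarrow> B \<in> VN \<Longrightarrow> a \<in> L1_perp J \<Longrightarrow> tpair (A o\<^sub>L mult_op a o\<^sub>L B) h = 0) \<Longrightarrow> tpair T h = 0"
    unfolding Bim_def weak_star_closure_span_iff[OF bimodule_generators_BL2[OF J]] by blast+
  show "T \<in> TG_perp (Ran J)"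
    unfolding TG_perp_Ran_iff[OF J1]
  proof (intro conjI ballI TB)
    fix f and h :: "'a \<times> 'a \<Rightarrow> complex" assume f: "f \<in> J" and h: "h \<in> TG"
    have fi: "integrable haar f" using J1 f by (auto simp: L1_def)
    show "tpair T (theta f h) = 0"
    proof (rule kill[OF theta(1)[OF fi h]])
      fix A B :: "'a oper" and a assume AB: "A \<in> VN" "B \<in> VN" and a: "a \<in> L1_perp J"
      obtain b C where b: "bounded_function b C" "b \<in> L1_perp J" "mult_op a = mult_op b"
        by (rule L1_perp_bounded_version[OF a J1]) (rule that)
      have "A o\<^sub>L mult_op b o\<^sub>L B \<in> BL2" using bimodule_generators_BL2[OF J] AB b(2) by blast
      then show "tpair (A o\<^sub>L mult_op a o\<^sub>L B) (theta f h) = 0"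
        unfolding b(3) by (simp add: theta(2)[OF fi h] Theta_bimodule_zero[OF J f b(2,1) AB] tpair_zero_left[OF h])
    qed
  qed
qed

end

section \<open>Expansion of the averaged operator along translates of the diagonal\<close>

text \<open>The kernel of \<open>avg V T avg V\<close> along the left translate by \<open>t\<close> of the diagonal.\<close>

definition (in small_nhd) fourier_coeff :: "'a oper \<Rightarrow> 'a \<Rightarrow> 'a \<Rightarrow> complex"
  where "fourier_coeff T t x = cinner (T \<cdot> kerR (- t + x)) (kerL x)"

context small_nhd
begin

text \<open>Along the translated diagonal both vectors move by the same
  \<open>right_reg (- x)\<close>. So a_t is a coefficient of T at the fixed vectors
  \<open>kerR (- t)\<close> and \<open>kerL 0\<close>, which is what places it in
  \<open>L1_perp J\<close>.\<close>

lemma fourier_coeff_conj_right: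
  "fourier_coeff T t x = cinner (conj_right x T \<cdot> kerR (- t)) (kerL 0)"
proof -
  have "kerR (- t + x) = right_reg (- x) \<cdot> kerR (- t)" "kerL x = right_reg (- x) \<cdot> kerL 0"
    using kerR_add[of x "- t"] kerL_add[of x 0] by simp_all
  then show ?thesis by (simp only: fourier_coeff_def conj_right_apply cinner_right_reg_left)
qed

lemma cmod_fourier_coeff: "cmod (fourier_coeff T t x) \<le> norm T * norm ker0 * norm ker0'"
proof -
  have "cmod (fourier_coeff T t x) \<le> norm (T \<cdot> kerR (- t + x)) * norm (kerL x)"
    unfolding fourier_coeff_def by (rule cmod_cinner_le)
  also have "\<dots> \<le> (norm T * norm (kerR (- t + x))) * norm (kerL x)" by (intro mult_right_mono norm_blinfun) simp
  finally show ?thesis by (simp only: norm_kerL norm_kerR)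
qed

text \<open>The coefficient is jointly continuous because both vectors depend norm-continuously on
  their parameters, and by second countability the product of the Borel algebras is the Borel
  algebra of the product.\<close>

lemma fourier_coeff_measurable: "(\<lambda>p. fourier_coeff T (fst p) (snd p)) \<in> borel_measurable (haar \<Otimes>\<^sub>M haar)"
proof -
  have "continuous_on UNIV (\<lambda>p :: 'a \<times> 'a. fourier_coeff T (fst p) (snd p))"
    unfolding fourier_coeff_def
    by (intro bounded_bilinear.continuous_on[OF bounded_bilinear_cinner]
        bounded_linear.continuous_on[OF blinfun.bounded_linear_right]
        continuous_on_compose2[OF continuous_kerR] continuous_on_compose2[OF continuous_kerL])
      (auto intro!: continuous_intros)
  then have m: "(\<lambda>p. fourier_coeff T (fst p) (snd p)) \<in> borel_measurable borel" by (rule borel_measurable_continuous_onI)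
  have eq: "sets (haar \<Otimes>\<^sub>M haar) = sets (borel :: ('a \<times> 'a) measure)"
    unfolding borel_prod[symmetric] by (rule sets_pair_measure_cong[OF sets_haar sets_haar])
  show ?thesis unfolding measurable_cong_sets[OF eq refl] by (rule m)
qed

lemma fourier_coeff_bounded: "bounded_function (fourier_coeff T t) (norm T * norm ker0 * norm ker0')"
proof
  show "fourier_coeff T t \<in> borel_measurable haar"
    unfolding fourier_coeff_conj_right[abs_def]
    by (rule continuous_functional_measurable[OF continuous_conj_right clinear_functional_cinner])
qed (rule cmod_fourier_coeff)

text \<open>The factor \<^term>\<open>left_reg 0\<close> is the identity; it only brings the operator into the form required of the
  generators of \<^const>\<open>Bim\<close>.\<close>

definition fourier_op :: "'a oper \<Rightarrow> 'a \<Rightarrow> 'a oper"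
  where "fourier_op T t = left_reg 0 o\<^sub>L mult_op (fourier_coeff T t) o\<^sub>L left_reg t"

lemma fourier_op_BL2: "fourier_op T t \<in> BL2"
  unfolding fourier_op_def by (intro BL2_compose left_reg_BL2 bounded_function.mult_op_BL2[OF fourier_coeff_bounded])

lemma cinner_fourier_op:
  "cinner (fourier_op T t \<cdot> u) v = (\<integral>x. fourier_coeff T t x * (rep_L2 u (- t + x) * cnj (rep_L2 v x)) \<partial>haar)"
proof -
  interpret bounded_function "fourier_coeff T t" "norm T * norm ker0 * norm ker0'" by (rule fourier_coeff_bounded)
  have "(\<lambda>t :: 'a. - 0 + t) = (\<lambda>t. t)" by simp
  then have "left_reg 0 \<cdot> w = w" for w :: "'a L2" unfolding left_reg_comp_op by (simp only: comp_op_id)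
  then have "cinner (fourier_op T t \<cdot> u) v = (\<integral>x. fourier_coeff T t x * (rep_L2 (left_reg t \<cdot> u) x * cnj (rep_L2 v x)) \<partial>haar)"
    by (simp add: fourier_op_def cinner_mult_op)
  also have "\<dots> = (\<integral>x. fourier_coeff T t x * (rep_L2 u (- t + x) * cnj (rep_L2 v x)) \<partial>haar)"
  proof (rule integral_cong_AE)
    show "AE x in haar. fourier_coeff T t x * (rep_L2 (left_reg t \<cdot> u) x * cnj (rep_L2 v x)) = fourier_coeff T t x * (rep_L2 u (- t + x) * cnj (rep_L2 v x))"
      using rep_left_reg[of t u] by eventually_elim simp
  qed (use measurable_a in measurable)
  finally show ?thesis .
qed

lemma cmod_fourier_op: "cmod (cinner (fourier_op T t \<cdot> u) v) \<le> norm T * norm ker0 * norm ker0' * (norm u * norm v)"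
  and fourier_op_integral_bound: "(\<integral>x. cmod (fourier_coeff T t x * (rep_L2 u (- t + x) * cnj (rep_L2 v x))) \<partial>haar) \<le> norm T * norm ker0 * norm ker0' * (norm u * norm v)"
  and fourier_op_integrable: "integrable haar (\<lambda>x. fourier_coeff T t x * (rep_L2 u (- t + x) * cnj (rep_L2 v x)))"
proof -
  let ?C = "norm T * norm ker0 * norm ker0'"
  interpret bounded_function "fourier_coeff T t" ?C by (rule fourier_coeff_bounded)
  have i: "integrable haar (\<lambda>x. rep_L2 u (- t + x) * cnj (rep_L2 v x))"
    by (rule sq_integrable_mult[OF mpres_sq_integrable[OF mpres_left sq_integrable_rep] sq_integrable_rep])
  have "integrable haar (\<lambda>x. (rep_L2 u (- t + x) * cnj (rep_L2 v x)) * fourier_coeff T t x)"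
    by (rule integrable_mult_bounded[OF i measurable_a bound_a])
  then show "integrable haar (\<lambda>x. fourier_coeff T t x * (rep_L2 u (- t + x) * cnj (rep_L2 v x)))" by (simp only: mult.commute)
  have "(\<integral>x. cmod (fourier_coeff T t x * (rep_L2 u (- t + x) * cnj (rep_L2 v x))) \<partial>haar)
     \<le> (\<integral>x. ?C * cmod (rep_L2 u (- t + x) * cnj (rep_L2 v x)) \<partial>haar)"
  proof (rule integral_mono')
    show "integrable haar (\<lambda>x. ?C * cmod (rep_L2 u (- t + x) * cnj (rep_L2 v x)))"
      by (rule Bochner_Integration.integrable_mult_right, rule integrable_norm[OF i])
    fix x
    show "cmod (fourier_coeff T t x * (rep_L2 u (- t + x) * cnj (rep_L2 v x))) \<le> ?C * cmod (rep_L2 u (- t + x) * cnj (rep_L2 v x))"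
      unfolding norm_mult[of "fourier_coeff T t x"] by (rule mult_right_mono[OF bound_a norm_ge_zero])
    show "0 \<le> ?C * cmod (rep_L2 u (- t + x) * cnj (rep_L2 v x))" using C_nonneg by (rule mult_nonneg_nonneg) simp
  qed
  also have "\<dots> = ?C * (\<integral>x. cmod (rep_L2 u (- t + x) * cnj (rep_L2 v x)) \<partial>haar)"
    by (rule Bochner_Integration.integral_mult_right_zero)
  also have "(\<integral>x. cmod (rep_L2 u (- t + x) * cnj (rep_L2 v x)) \<partial>haar)
      = (\<integral>x. cmod (rep_L2 (left_reg t \<cdot> u) x) * cmod (rep_L2 v x) \<partial>haar)"
  proof (rule integral_cong_AE)
    show "AE x in haar. cmod (rep_L2 u (- t + x) * cnj (rep_L2 v x)) = cmod (rep_L2 (left_reg t \<cdot> u) x) * cmod (rep_L2 v x)"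
      using rep_left_reg[of t u] by eventually_elim (simp add: norm_mult)
  qed measurable
  also have "?C * \<dots> \<le> ?C * (norm (left_reg t \<cdot> u) * norm v)"
    by (rule mult_left_mono[OF cmod_integral_rep_le(2) C_nonneg])
  finally show b: "(\<integral>x. cmod (fourier_coeff T t x * (rep_L2 u (- t + x) * cnj (rep_L2 v x))) \<partial>haar) \<le> ?C * (norm u * norm v)"
    by (simp only: norm_left_reg)
  show "cmod (cinner (fourier_op T t \<cdot> u) v) \<le> ?C * (norm u * norm v)"
    unfolding cinner_fourier_op by (rule order_trans[OF integral_norm_bound b])
qed

text \<open>The averaged operator has the kernel \<open>cinner (T \<cdot> kerR y) (kerL x)\<close>.
  For fixed x the measure-preserving substitution y = - t + x regroups it by translates of the
  diagonal, and Fubini puts t outside.\<close>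

lemma fourier_inversion:
  assumes T: "T \<in> BL2"
  shows "cinner (avg V (T \<cdot> avg V u)) v = (\<integral>t. cinner (fourier_op T t \<cdot> u) v \<partial>haar)"
proof -
  define K where "K p = fourier_coeff T (fst p) (snd p) * (rep_L2 u (- fst p + snd p) * cnj (rep_L2 v (snd p)))" for p
  have "cinner (avg V (T \<cdot> avg V u)) v = (\<integral>x. cinner (T \<cdot> avg V u) (kerL x) * cnj (rep_L2 v x) \<partial>haar)"
    by (rule cinner_avg_kerL)
  also have "\<dots> = (\<integral>x. \<integral>t. K (t, x) \<partial>haar \<partial>haar)"
  proof (rule Bochner_Integration.integral_cong[OF refl])
    fix x
    have cf: "clinear_functional (\<lambda>w. cinner (T \<cdot> w) (kerL x))"
      by (rule clinear_functional_compose[OF clinear_functional_cinner T])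
    have m: "(\<lambda>y. cinner (T \<cdot> kerR y) (kerL x)) \<in> borel_measurable haar"
      by (rule continuous_functional_measurable[OF continuous_kerR cf])
    have "cinner (T \<cdot> avg V u) (kerL x) = (\<integral>y. rep_L2 u y * cinner (T \<cdot> kerR y) (kerL x) \<partial>haar)"
      unfolding avg_eq_wint by (rule wint[OF integrable_rep continuous_kerR cf])
    also have "\<dots> = (\<integral>t. rep_L2 u (- t + x) * cinner (T \<cdot> kerR (- t + x)) (kerL x) \<partial>haar)"
      by (rule mpres_integral[OF mpres_reflect(1), symmetric]) (use m in measurable)
    finally have "cinner (T \<cdot> avg V u) (kerL x) * cnj (rep_L2 v x)
       = (\<integral>t. rep_L2 u (- t + x) * cinner (T \<cdot> kerR (- t + x)) (kerL x) * cnj (rep_L2 v x) \<partial>haar)"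
      by (simp only: Bochner_Integration.integral_mult_left_zero)
    then show "cinner (T \<cdot> avg V u) (kerL x) * cnj (rep_L2 v x) = (\<integral>t. K (t, x) \<partial>haar)"
      by (simp add: K_def fourier_coeff_def mult_ac)
  qed
  also have "\<dots> = (\<integral>t. \<integral>x. K (t, x) \<partial>haar \<partial>haar)"
  proof (rule fubini_swap(2)[symmetric, where C = "\<lambda>_. norm T * norm ker0 * norm ker0' * (norm u * norm v)"])
    show "K \<in> borel_measurable (haar \<Otimes>\<^sub>M haar)"
      unfolding K_def[abs_def] using fourier_coeff_measurable by measurable
    show "integrable haar (\<lambda>x. K (t, x))" "(\<integral>x. cmod (K (t, x)) \<partial>haar) \<le> norm T * norm ker0 * norm ker0' * (norm u * norm v)" for t
      unfolding K_def fst_conv snd_conv by (rule fourier_op_integrable fourier_op_integral_bound)+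
  qed simp
  also have "\<dots> = (\<integral>t. cinner (fourier_op T t \<cdot> u) v \<partial>haar)"
    by (simp add: cinner_fourier_op K_def)
  finally show ?thesis .
qed

lemma cinner_fourier_op_measurable: "(\<lambda>t. cinner (fourier_op T t \<cdot> u) v) \<in> borel_measurable haar"
proof -
  have "(\<lambda>p. fourier_coeff T (fst p) (snd p) * (rep_L2 u (- fst p + snd p) * cnj (rep_L2 v (snd p)))) \<in> borel_measurable (haar \<Otimes>\<^sub>M haar)"
    using fourier_coeff_measurable by measurable
  then show ?thesis unfolding cinner_fourier_op
    by (intro borel_measurable_lebesgue_integral) (simp add: split_def)
qed

text \<open>The inversion formula is summed over a representing series; the bound on the
  coefficients of \<open>fourier_op\<close> is uniform in t, hence integrable for the finite
  measure.\<close>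

lemma tpair_avg_eq_integral:
  assumes T: "T \<in> BL2" and h: "h \<in> TG"
  shows "tpair (Blinfun (avg V) o\<^sub>L T o\<^sub>L Blinfun (avg V)) h = (\<integral>t. tpair (fourier_op T t) h \<partial>haar)"
proof -
  let ?C = "norm T * norm ker0 * norm ker0'" and ?P = "Blinfun (avg V) o\<^sub>L T o\<^sub>L Blinfun (avg V)"
  obtain p q where pq: "represents p q h" using h by (auto simp: TG_def)
  have P: "?P \<in> BL2" by (intro BL2_compose Blinfun_avg_BL2 T)
  define c where "c i t = cinner (fourier_op T t \<cdot> p i) (L2_cnj (q i))" for i t
  have bc: "cmod (c i t) \<le> ?C * (norm (p i) * norm (q i))" for i t
    using cmod_fourier_op[of T t "p i" "L2_cnj (q i)"] by (simp add: c_def)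
  have cm: "c i \<in> borel_measurable haar" for i unfolding c_def[abs_def] by (rule cinner_fourier_op_measurable)
  have ci: "integrable haar (c i)" for i
    by (rule integrable_const_bound[OF _ cm]) (use bc in auto)
  have "(\<lambda>i. \<integral>t. c i t \<partial>haar) sums (\<integral>t. (\<Sum>i. c i t) \<partial>haar)"
  proof (rule sums_integral_dominated[OF ci bc])
    show "(\<integral>t. ?C * (norm (p i) * norm (q i)) \<partial>(haar :: 'a measure)) \<le> measure haar (UNIV :: 'a set) * ?C * (norm (p i) * norm (q i))" for i
      by simp
  qed (simp_all add: summable_mult represents_summable[OF pq])
  moreover have "(\<integral>t. c i t \<partial>haar) = cinner (?P \<cdot> p i) (L2_cnj (q i))" for i
    unfolding c_def by (simp add: Blinfun_avg fourier_inversion[OF T])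
  moreover have "(\<Sum>i. c i t) = tpair (fourier_op T t) h" for t
    unfolding c_def by (rule tpair_eq[OF pq fourier_op_BL2, symmetric])
  ultimately have "(\<lambda>i. cinner (?P \<cdot> p i) (L2_cnj (q i))) sums (\<integral>t. tpair (fourier_op T t) h \<partial>haar)" by simp
  with tpair_sums[OF pq P] show ?thesis by (rule sums_unique2)
qed

end

context compact_haar
begin

text \<open>The averages are contractions converging strongly to the identity, so the two-sided
  product converges strongly to T with norms at most \<open>norm T\<close>.\<close>

lemma tpair_avg_tendsto:
  assumes V: "\<And>n. small_nhd (V n)" "\<And>u :: 'a L2. (\<lambda>n. avg (V n) u) \<longlonglongrightarrow> u" and T: "T \<in> BL2" and h: "h \<in> TG"
  shows "(\<lambda>n. tpair (Blinfun (avg (V n)) o\<^sub>L T o\<^sub>L Blinfun (avg (V n))) h) \<longlonglongrightarrow> tpair T h"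
proof -
  obtain p q where pq: "represents p q h" using h by (auto simp: TG_def)
  let ?c = "\<lambda>i n. cinner (avg (V n) (T \<cdot> avg (V n) (p i))) (L2_cnj (q i))"
  have na: "norm (avg (V n) u) \<le> norm u" for n u
    by (rule small_nhd.norm_avg[OF V(1)])
  have "(\<lambda>n. \<Sum>i. ?c i n) \<longlonglongrightarrow> (\<Sum>i. cinner (T \<cdot> p i) (L2_cnj (q i)))"
  proof (rule tpair_series_tendsto[OF pq])
    fix i
    show "(\<lambda>n. avg (V n) (T \<cdot> avg (V n) (p i))) \<longlonglongrightarrow> T \<cdot> p i"
    proof (rule LIM_zero_cancel)
      \<comment> \<open>The error splits into \<open>avg (V n)\<close> applied to the first vector
        and the second difference; the contraction property removes the outer average from the
        first.\<close>
      have "(\<lambda>n. norm (T \<cdot> (avg (V n) (p i) - p i)) + norm (avg (V n) (T \<cdot> p i) - T \<cdot> p i)) \<longlonglongrightarrow> 0 + 0"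
      proof (rule tendsto_add)
        have "(\<lambda>n. T \<cdot> (avg (V n) (p i) - p i)) \<longlonglongrightarrow> T \<cdot> (p i - p i)"
          by (intro bounded_linear.tendsto[OF blinfun.bounded_linear_right] tendsto_diff V tendsto_const)
        then show "(\<lambda>n. norm (T \<cdot> (avg (V n) (p i) - p i))) \<longlonglongrightarrow> 0"
          by (intro tendsto_norm_zero) simp
        show "(\<lambda>n. norm (avg (V n) (T \<cdot> p i) - T \<cdot> p i)) \<longlonglongrightarrow> 0"
          by (intro tendsto_norm_zero LIM_zero V)
      qed
      then have lim: "(\<lambda>n. norm (T \<cdot> (avg (V n) (p i) - p i)) + norm (avg (V n) (T \<cdot> p i) - T \<cdot> p i)) \<longlonglongrightarrow> 0" by simp
      have le: "norm (avg (V n) (T \<cdot> avg (V n) (p i)) - T \<cdot> p i)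
          \<le> norm (T \<cdot> (avg (V n) (p i) - p i)) + norm (avg (V n) (T \<cdot> p i) - T \<cdot> p i)" for n
      proof -
        have "avg (V n) (T \<cdot> avg (V n) (p i)) - T \<cdot> p i
          = avg (V n) (T \<cdot> (avg (V n) (p i) - p i)) + (avg (V n) (T \<cdot> p i) - T \<cdot> p i)"
          using linear_diff[OF bounded_linear.linear[OF small_nhd.bounded_linear_avg[OF V(1)[of n]]]]
          by (simp add: blinfun.diff_right)
        also have "norm \<dots> \<le> norm (avg (V n) (T \<cdot> (avg (V n) (p i) - p i))) + norm (avg (V n) (T \<cdot> p i) - T \<cdot> p i)"
          by (rule norm_triangle_ineq)
        finally show ?thesis using na[of n "T \<cdot> (avg (V n) (p i) - p i)"] by linarith
      qed
      show "(\<lambda>n. avg (V n) (T \<cdot> avg (V n) (p i)) - T \<cdot> p i) \<longlonglongrightarrow> 0"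
        by (rule Lim_null_comparison[OF _ lim]) (use le in simp)
    qed
  next
    show "norm (avg (V n) (T \<cdot> avg (V n) (p i))) \<le> norm T * norm (p i)" for n i
      by (intro order_trans[OF na] order_trans[OF norm_blinfun] mult_left_mono na) auto
  qed
  moreover have "(\<Sum>i. ?c i n) = tpair (Blinfun (avg (V n)) o\<^sub>L T o\<^sub>L Blinfun (avg (V n))) h" for n
  proof -
    interpret small_nhd _ "V n" by (rule V)
    show ?thesis by (subst tpair_eq[OF pq]) (auto intro!: BL2_compose Blinfun_avg_BL2 T simp: Blinfun_avg)
  qed
  ultimately show ?thesis by (simp add: tpair_eq[OF pq T])
qed

text \<open>If h annihilates the generators, it annihilates every \<open>fourier_op T t\<close>,
  hence by integration the averaged operators, and in the limit T. The operator-valued integral of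
  the overview thus occurs only after pairing with h.\<close>

lemma TG_perp_Ran_subset_Bim:
  fixes J :: "('a \<Rightarrow> complex) set"
  assumes J: "closed_left_ideal J"
  shows "TG_perp (Ran J) \<subseteq> Bim (L1_perp J)"
proof
  have J1: "J \<subseteq> L1" using J by (simp add: closed_left_ideal_def)
  fix T assume "T \<in> TG_perp (Ran J)"
  then have T: "T \<in> BL2" and kill: "\<And>f h. f \<in> J \<Longrightarrow> h \<in> TG \<Longrightarrow> tpair T (theta f h) = 0"
    by (auto simp: TG_perp_Ran_iff[OF J1])
  have orth: "(\<integral>r. cinner (conj_right r T \<cdot> u) v * f r \<partial>haar) = 0" if f: "f \<in> J" for f u v
  proof -
    have fi: "integrable haar f" using J1 f by (auto simp: L1_def)
    obtain h :: "'a \<times> 'a \<Rightarrow> complex" where h: "h \<in> TG" "\<And>T. T \<in> BL2 \<Longrightarrow> tpair T h = cinner (T \<cdot> u) v"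
      by (rule TG_rank_one[of u v]) (rule that)
    have "0 = (\<integral>r. f r * tpair (conj_right r T) h \<partial>haar)"
      using kill[OF f h(1)] by (simp add: theta(2)[OF fi h(1) T] Theta(3)[OF fi T h(1)])
    then show ?thesis by (simp add: h(2) conj_right_BL2[OF T] mult.commute)
  qed
  obtain V :: "nat \<Rightarrow> 'a set" where V: "\<And>n. small_nhd (V n)" "\<And>u. (\<lambda>n. avg (V n) u) \<longlonglongrightarrow> u"
    by (rule small_nhds_exist) (rule that)
  show "T \<in> Bim (L1_perp J)"
    unfolding Bim_def weak_star_closure_span_iff[OF bimodule_generators_BL2[OF J]]
  proof (intro conjI T ballI impI)
    fix h :: "'a \<times> 'a \<Rightarrow> complex" assume h: "h \<in> TG"
      and van: "\<forall>X\<in>{A o\<^sub>L mult_op a o\<^sub>L B | A a B. A \<in> VN \<and> B \<in> VN \<and> a \<in> L1_perp J}. tpair X h = 0"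
    have "tpair (Blinfun (avg (V n)) o\<^sub>L T o\<^sub>L Blinfun (avg (V n))) h = 0" for n
    proof -
      interpret small_nhd _ "V n" by (rule V)
      have "fourier_coeff T t \<in> Linf" for t
        unfolding Linf_def
        by (intro CollectI conjI exI[of _ "norm T * norm ker0 * norm ker0'"] AE_I2)
          (rule bounded_function.measurable_a[OF fourier_coeff_bounded], rule cmod_fourier_coeff)
      then have "fourier_coeff T t \<in> L1_perp J" for t
        by (simp add: L1_perp_def fourier_coeff_conj_right orth)
      then have "tpair (fourier_op T t) h = 0" for t
        using van left_reg_VN unfolding fourier_op_def by blast
      then show ?thesis by (simp add: tpair_avg_eq_integral[OF T h])
    qed
    then show "tpair T h = 0" using tpair_avg_tendsto[OF V T h] by (simp add: LIMSEQ_const_iff)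
  qed
qed

end

theorem theorem6p5:
  fixes J :: "('a::haar_group \<Rightarrow> complex) set"
  assumes "compact (UNIV :: 'a set)"
    and "closed_left_ideal J"
  shows "TG_perp (Ran J) = Bim (L1_perp J)"
proof -
  interpret compact_haar "TYPE('a)" by unfold_locales (rule assms)
  show ?thesis using TG_perp_Ran_subset_Bim[OF assms(2)] Bim_subset_TG_perp_Ran[OF assms(2)] by (rule equalityI)
qed

end
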